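(* Let $M$ be a complete hyperbolic $3$-manifold with a decomposition $\{\mathcal{P}_i\}$ into right-angled ideal polyhedra, with face pairing isometries $\phi_f$. For a face $f$ of $\mathcal{P}_i$, let $\gamma_f$ be the reflection in the hyperplane containing $f$. If for each face $f$ of each $\mathcal{P}_i$, $\phi_f\circ\gamma_f$ restricts to an isometry from $\mathcal{P}_i$ to the polyhedron $\mathcal{P}_j$ containing $\phi_f(f)$, then $\pi_1 M$ is contained in $\Gamma\rtimes\mathrm{Sym}(\mathcal{P}_1)$, where $\Gamma$ is the reflection group in $\mathcal{P}_1$ and $\mathrm{Sym}(\mathcal{P}_1)$ is the symmetry group of $\mathcal{P}_1$.
   Context: An ideal polyhedron in $\mathbb{H}^3$ is a finite-volume, finite-sided convex polyhedron all of whose vertices lie on $\partial\mathbb{H}^3$. Let $\{\mathcal{P}_i\}_{i=1}^n$ be a finite collection of disjoint ideal polyhedra in $\mathbb{H}^3$. A face pairing on $\{\mathcal{P}_i\}$ is a collection of isometries $\phi_f$ of $\mathbb{H}^3$, one for each $2$-dimensional face $f$ of each $\mathcal{P}_i$, such that if $f$ is a face of $\mathcal{P}_i$ then $\phi_f$ takes $f$ onto a face $f'$ of some $\mathcal{P}_j$, with $\phi_f(\mathcal{P}_i)\cap\mathcal{P}_j=f'$ and $\phi_{f'}=\phi_f^{-1}$. An ideal polyhedral decomposition of $M$ is an isometry between $M$ and a quotient $\bigsqcup_i\mathcal{P}_i/\sim$, where $\sim$ is the equivalence relation generated by a face pairing. It is a decomposition into right-angled ideal polyhedra if all dihedral angles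 of every $\mathcal{P}_i$ equal $\pi/2$. The reflection group $\Gamma$ in $\mathcal{P}_1$ is the subgroup of $\mathrm{Isom}(\mathbb{H}^3)$ generated by reflections in the hyperplanes containing the faces of $\mathcal{P}_1$; $\mathrm{Sym}(\mathcal{P}_1)<\mathrm{Isom}(\mathbb{H}^3)$ is the stabilizer of $\mathcal{P}_1$. Here $\pi_1M$ is identified with a discrete subgroup of $\mathrm{Isom}(\mathbb{H}^3)$ with quotient $M$, well defined up to conjugation, and the containment is understood for a suitable choice of such an identification. *)

theory Defs
  imports "HOL-Analysis.Analysis" "HOL-Algebra.Generated_Groups"
begin

section \<open>Hyperbolic 3-space: the hyperboloid model\<close>

text \<open>The Lorentzian form on \<open>R^{1,3}\<close>; the time-like coordinate is the first component.\<close>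

definition lor :: "real \<times> (real^3) \<Rightarrow> real \<times> (real^3) \<Rightarrow> real" where
  "lor p q = snd p \<bullet> snd q - fst p * fst q"

lemma lor_commute: "lor p q = lor q p"
  by (simp add: lor_def inner_commute mult.commute)

lemma lor_add_left: "lor (p + q) r = lor p r + lor q r"
  by (simp add: lor_def algebra_simps)

lemma lor_diff_left: "lor (p - q) r = lor p r - lor q r"
  by (simp add: lor_def algebra_simps)

lemma lor_scaleR_left: "lor (c *\<^sub>R p) r = c * lor p r"
  by (simp add: lor_def algebra_simps)

lemma lor_add_right: "lor r (p + q) = lor r p + lor r q"
  by (simp add: lor_def algebra_simps)

lemma lor_diff_right: "lor r (p - q) = lor r p - lor r q"
  by (simp add: lor_def algebra_simps)

lemma lor_scaleR_right: "lor r (c *\<^sub>R p) = c * lor r p"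
  by (simp add: lor_def algebra_simps)

lemmas lor_simps = lor_add_left lor_diff_left lor_scaleR_left
  lor_add_right lor_diff_right lor_scaleR_right

typedef hyp3 = "{p :: real \<times> (real^3). lor p p = -1 \<and> fst p > 0}"
  morphisms vec_of Hyp
  by (rule exI[of _ "(1, 0)"]) (simp add: lor_def)

lemma lor_vec_self [simp]: "lor (vec_of x) (vec_of x) = -1"
  and fst_vec_pos [simp]: "fst (vec_of x) > 0"
  using vec_of[of x] by auto

text \<open>A vector that is Lorentz-orthogonal to a point of the hyperboloid is space-like.\<close>

lemma lor_orthogonal_nonneg:
  assumes "lor u (vec_of y) = 0"
  shows "lor u u \<ge> 0"
proof -
  obtain a v where u: "u = (a, v)" by (cases u)
  obtain b w where y: "vec_of y = (b, w)" by (cases "vec_of y")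
  have b: "b > 0" "w \<bullet> w = b\<^sup>2 - 1"
    using fst_vec_pos[of y] lor_vec_self[of y] by (auto simp: y lor_def power2_eq_square)
  have vw: "v \<bullet> w = a * b" using assms by (simp add: u y lor_def)
  have "(v \<bullet> w)\<^sup>2 \<le> (v \<bullet> v) * (w \<bullet> w)" by (rule Cauchy_Schwarz_ineq)
  then have "a\<^sup>2 * b\<^sup>2 \<le> (v \<bullet> v) * (b\<^sup>2 - 1)" by (simp add: vw b power_mult_distrib)
  also have "\<dots> \<le> (v \<bullet> v) * b\<^sup>2" by (intro mult_left_mono) auto
  finally have "a\<^sup>2 \<le> v \<bullet> v" using b by simp
  then show ?thesis by (simp add: u lor_def power2_eq_square)
qed

lemma lor_orthogonal_Cauchy_Schwarz:
  assumes u: "lor u (vec_of y) = 0" and v: "lor v (vec_of y) = 0"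
  shows "(lor u v)\<^sup>2 \<le> lor u u * lor v v"
proof -
  have q: "0 \<le> s\<^sup>2 * lor u u - 2 * s * t * lor u v + t\<^sup>2 * lor v v" for s t
  proof -
    have "lor (s *\<^sub>R u - t *\<^sub>R v) (vec_of y) = 0" by (simp add: lor_simps u v)
    from lor_orthogonal_nonneg[OF this] show ?thesis
      by (simp add: lor_simps lor_commute[of v u] power2_eq_square algebra_simps)
  qed
  have uu: "lor u u \<ge> 0" and vv: "lor v v \<ge> 0"
    using lor_orthogonal_nonneg u v by auto
  show ?thesis
  proof (cases "lor v v = 0")
    case True
    have "lor u v = 0"
    proof (rule ccontr)
      assume nz: "lor u v \<noteq> 0"
      from q[of 1 "(lor u u + 1) / (2 * lor u v)"] nz True show False by simp
    qed
    then show ?thesis using True by simp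
  next
    case False
    then have pos: "lor v v > 0" using vv by simp
    from q[of "lor v v" "lor u v"]
    have "0 \<le> lor v v * (lor u u * lor v v - (lor u v)\<^sup>2)"
      by (simp add: power2_eq_square algebra_simps)
    then show ?thesis using pos by (simp add: zero_le_mult_iff)
  qed
qed

lemma lor_vec_le: "- lor (vec_of x) (vec_of y) \<ge> 1"
proof -
  obtain a v where x: "vec_of x = (a, v)" by (cases "vec_of x")
  obtain b w where y: "vec_of y = (b, w)" by (cases "vec_of y")
  have a: "a > 0" "v \<bullet> v = a\<^sup>2 - 1"
    using fst_vec_pos[of x] lor_vec_self[of x] by (auto simp: x lor_def power2_eq_square)
  have b: "b > 0" "w \<bullet> w = b\<^sup>2 - 1"
    using fst_vec_pos[of y] lor_vec_self[of y] by (auto simp: y lor_def power2_eq_square)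
  have "a\<^sup>2 \<ge> 1" "b\<^sup>2 \<ge> 1" using a(2) b(2) inner_ge_zero[of v] inner_ge_zero[of w] by linarith+
  then have ab: "a \<ge> 1" "b \<ge> 1" using a(1) b(1) power2_le_imp_le[of 1 a] power2_le_imp_le[of 1 b] by simp_all
  then have ab1: "a * b \<ge> 1" using mult_mono[of 1 a 1 b] by simp
  have "(v \<bullet> w)\<^sup>2 \<le> (a\<^sup>2 - 1) * (b\<^sup>2 - 1)" using Cauchy_Schwarz_ineq[of v w] a b by simp
  also have "\<dots> = (a * b - 1)\<^sup>2 - (a - b)\<^sup>2" by (simp add: power2_eq_square algebra_simps)
  also have "\<dots> \<le> (a * b - 1)\<^sup>2" by simp
  finally have "v \<bullet> w \<le> a * b - 1" using ab1 power2_le_imp_le[of "v \<bullet> w" "a * b - 1"] by simp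
  then show ?thesis by (simp add: x y lor_def)
qed

lemma lor_vec_eq_imp:
  assumes "- lor (vec_of x) (vec_of y) = 1"
  shows "x = y"
proof -
  let ?u = "vec_of x - vec_of y"
  have uu: "lor ?u ?u = 0" and uy: "lor ?u (vec_of y) = 0"
    using assms by (simp_all add: lor_simps lor_commute[of "vec_of y" "vec_of x"])
  obtain a v where u: "?u = (a, v)" by (cases ?u)
  obtain b w where y: "vec_of y = (b, w)" by (cases "vec_of y")
  have b: "b > 0" "w \<bullet> w = b\<^sup>2 - 1"
    using fst_vec_pos[of y] lor_vec_self[of y] by (auto simp: y lor_def power2_eq_square)
  have vv: "v \<bullet> v = a\<^sup>2" using uu unfolding u by (simp add: lor_def power2_eq_square)
  have "lor (a, v) (b, w) = 0" using uy by (simp only: u) (simp only: y)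
  then have vw: "v \<bullet> w = a * b" by (simp add: lor_def)
  have "(a * b)\<^sup>2 \<le> a\<^sup>2 * (b\<^sup>2 - 1)" using Cauchy_Schwarz_ineq[of v w] by (simp add: vv vw b)
  then have "a\<^sup>2 \<le> 0" by (simp add: power_mult_distrib algebra_simps)
  then have "a = 0" by simp
  then have "?u = 0" using u vv by (simp add: zero_prod_def)
  then show ?thesis by (simp add: vec_of_inject)
qed

text \<open>The hyperbolic metric: \<open>cosh d(x,y) = - <x,y>\<close>.\<close>

instantiation hyp3 :: metric_space
begin

definition dist_hyp3 :: "hyp3 \<Rightarrow> hyp3 \<Rightarrow> real" where
  "dist_hyp3 x y = arcosh (- lor (vec_of x) (vec_of y))"

definition uniformity_hyp3 :: "(hyp3 \<times> hyp3) filter" where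
  "uniformity_hyp3 = (INF e\<in>{0<..}. principal {(x, y). dist x y < e})"

definition open_hyp3 :: "hyp3 set \<Rightarrow> bool" where
  "open_hyp3 U = (\<forall>x\<in>U. eventually (\<lambda>(x', y). x' = x \<longrightarrow> y \<in> U) uniformity)"

instance
proof
  fix x y z :: hyp3
  show "(dist x y = 0) = (x = y)"
    using lor_vec_le[of x y] lor_vec_eq_imp[of x y]
    by (auto simp: dist_hyp3_def arcosh_eq_0_iff_real)
  have tri: "dist x y \<le> dist x z + dist z y"
  proof -
    let ?a = "- lor (vec_of x) (vec_of z)" and ?b = "- lor (vec_of y) (vec_of z)"
    let ?u = "vec_of x - ?a *\<^sub>R vec_of z" and ?v = "vec_of y - ?b *\<^sub>R vec_of z"
    note comm = lor_commute[of "vec_of z" "vec_of x"] lor_commute[of "vec_of z" "vec_of y"]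
    have a: "?a \<ge> 1" and b: "?b \<ge> 1" and c: "- lor (vec_of x) (vec_of y) \<ge> 1"
      by (rule lor_vec_le)+
    have u: "lor ?u (vec_of z) = 0" and v: "lor ?v (vec_of z) = 0"
      by (simp_all add: lor_simps)
    have uu: "lor ?u ?u = ?a\<^sup>2 - 1" and vv: "lor ?v ?v = ?b\<^sup>2 - 1"
      and uv: "lor ?u ?v = lor (vec_of x) (vec_of y) + ?a * ?b"
      by (simp_all add: lor_simps comm power2_eq_square algebra_simps)
    have "(lor ?u ?v)\<^sup>2 \<le> (?a\<^sup>2 - 1) * (?b\<^sup>2 - 1)"
      using lor_orthogonal_Cauchy_Schwarz[OF u v] by (simp only: uu vv)
    then have "\<bar>lor ?u ?v\<bar> \<le> sqrt ((?a\<^sup>2 - 1) * (?b\<^sup>2 - 1))"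
      using real_le_rsqrt[of "\<bar>lor ?u ?v\<bar>"] by simp
    then have "\<bar>lor ?u ?v\<bar> \<le> sinh (arcosh ?a) * sinh (arcosh ?b)"
      using a b by (simp add: sinh_arcosh_real real_sqrt_mult)
    then have "- lor (vec_of x) (vec_of y) \<le> cosh (arcosh ?a + arcosh ?b)"
      using a b uv by (simp add: cosh_add)
    then have "arcosh (- lor (vec_of x) (vec_of y)) \<le> arcosh (cosh (arcosh ?a + arcosh ?b))"
      using c arcosh_less_iff_real[OF cosh_real_ge_1 c] by (simp add: not_less[symmetric] del: arcosh_less_iff_real)
    also have "\<dots> = arcosh ?a + arcosh ?b"
      by (intro arcosh_cosh_real add_nonneg_nonneg arcosh_nonneg_real a b)
    finally show ?thesis by (simp add: dist_hyp3_def lor_commute[of "vec_of z" "vec_of y"])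
  qed
  show "dist x y \<le> dist x z + dist y z"
    using tri by (simp add: dist_hyp3_def lor_commute[of "vec_of z" "vec_of y"])
qed (rule uniformity_hyp3_def open_hyp3_def)+

end

text \<open>
  The graph parametrisation of the hyperboloid; in these coordinates the hyperbolic
  volume form is \<open>dv / sqrt (1 + |v|^2)\<close>.
\<close>

definition graph_point :: "real^3 \<Rightarrow> hyp3" where
  "graph_point v = Hyp (sqrt (1 + v \<bullet> v), v)"

lemma vec_of_graph_point [simp]: "vec_of (graph_point v) = (sqrt (1 + v \<bullet> v), v)"
  unfolding graph_point_def
  by (intro Hyp_inverse) (auto simp: lor_def add_pos_nonneg simp flip: power2_eq_square)

definition hyp_volume :: "hyp3 set \<Rightarrow> ennreal" where
  "hyp_volume S = (\<integral>\<^sup>+v. ennreal (indicator S (graph_point v) / sqrt (1 + v \<bullet> v)) \<partial>lborel)"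


section \<open>Isometries, hyperplanes and reflections\<close>

definition hyp_isometry :: "(hyp3 \<Rightarrow> hyp3) \<Rightarrow> bool" where
  "hyp_isometry g \<longleftrightarrow> bij g \<and> (\<forall>x y. dist (g x) (g y) = dist x y)"

definition IsomH3 :: "(hyp3 \<Rightarrow> hyp3) monoid" where
  "IsomH3 = \<lparr>carrier = {g. hyp_isometry g}, mult = (\<circ>), one = id\<rparr>"

lemma group_IsomH3: "group IsomH3"
proof (rule groupI)
  fix g assume "g \<in> carrier IsomH3"
  then have g: "bij g" "\<And>x y. dist (g x) (g y) = dist x y"
    by (auto simp: IsomH3_def hyp_isometry_def)
  have "dist (inv_into UNIV g x) (inv_into UNIV g y) = dist x y" for x y
    using g(2)[of "inv_into UNIV g x" "inv_into UNIV g y"] g(1)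
    by (simp add: bij_is_surj surj_f_inv_f)
  then have "hyp_isometry (inv_into UNIV g)"
    using g(1) by (simp add: hyp_isometry_def bij_imp_bij_inv)
  moreover have "inv_into UNIV g \<circ> g = id" using g(1) by (simp add: bij_is_inj)
  ultimately show "\<exists>h\<in>carrier IsomH3. h \<otimes>\<^bsub>IsomH3\<^esub> g = \<one>\<^bsub>IsomH3\<^esub>"
    by (auto simp: IsomH3_def)
qed (auto simp: IsomH3_def hyp_isometry_def bij_comp o_assoc)

text \<open>Hyperplanes and closed half-spaces are given by unit space-like vectors.\<close>

definition unit_spacelike :: "real \<times> (real^3) \<Rightarrow> bool" where
  "unit_spacelike n \<longleftrightarrow> lor n n = 1"

definition hplane :: "real \<times> (real^3) \<Rightarrow> hyp3 set" where
  "hplane n = {x. lor (vec_of x) n = 0}"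

definition halfspace :: "real \<times> (real^3) \<Rightarrow> hyp3 set" where
  "halfspace n = {x. lor (vec_of x) n \<le> 0}"

definition reflection :: "real \<times> (real^3) \<Rightarrow> hyp3 \<Rightarrow> hyp3" where
  "reflection n x = Hyp (vec_of x - (2 * lor (vec_of x) n) *\<^sub>R n)"

lemma vec_of_reflection:
  assumes "unit_spacelike n"
  shows "vec_of (reflection n x) = vec_of x - (2 * lor (vec_of x) n) *\<^sub>R n"
proof -
  let ?c = "lor (vec_of x) n" and ?r = "vec_of x - (2 * lor (vec_of x) n) *\<^sub>R n"
  have nn: "lor n n = 1" using assms by (simp add: unit_spacelike_def)
  have rr: "lor ?r ?r = -1"
    by (simp add: lor_simps nn lor_commute[of n "vec_of x"] algebra_simps)
  have xr: "lor ?r (vec_of x) = -1 - 2 * ?c\<^sup>2"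
    by (simp add: lor_simps lor_commute[of n "vec_of x"] power2_eq_square)
  obtain a v where r: "?r = (a, v)" by (cases ?r)
  obtain b w where x: "vec_of x = (b, w)" by (cases "vec_of x")
  have b: "b > 0" "w \<bullet> w = b\<^sup>2 - 1"
    using fst_vec_pos[of x] lor_vec_self[of x] by (auto simp: x lor_def power2_eq_square)
  have vv: "v \<bullet> v = a\<^sup>2 - 1" using rr unfolding r by (simp add: lor_def power2_eq_square)
  have "lor ?r (vec_of x) < 0" unfolding xr using zero_le_power2[of ?c] by linarith
  then have "lor (a, v) (b, w) < 0" by (simp only: r) (simp only: x)
  then have "v \<bullet> w - a * b < 0" by (simp add: lor_def)
  moreover have "a > 0 \<or> v \<bullet> w - a * b \<ge> 0"
  proof (rule disjCI)
    assume "\<not> (v \<bullet> w - a * b \<ge> 0)"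
    show "a > 0"
    proof (rule ccontr)
      assume "\<not> a > 0"
      have "(v \<bullet> w)\<^sup>2 \<le> (a\<^sup>2 - 1) * (b\<^sup>2 - 1)" using Cauchy_Schwarz_ineq[of v w] vv b by simp
      also have "\<dots> \<le> a\<^sup>2 * b\<^sup>2"
        using inner_ge_zero[of v] inner_ge_zero[of w] vv b by (intro mult_mono) auto
      also have "\<dots> = (- a * b)\<^sup>2" by (simp add: power_mult_distrib)
      finally have "\<bar>v \<bullet> w\<bar> \<le> \<bar>- a * b\<bar>" by (simp only: abs_le_square_iff)
      moreover have "\<bar>- a * b\<bar> = - a * b"
        using \<open>\<not> a > 0\<close> b(1) by (simp add: abs_mult)
      ultimately show False using \<open>\<not> (v \<bullet> w - a * b \<ge> 0)\<close> by linarith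
    qed
  qed
  ultimately have "fst ?r > 0" unfolding r by auto
  with rr show ?thesis unfolding reflection_def by (intro Hyp_inverse) auto
qed


section \<open>Ideal polyhedra\<close>

text \<open>A finite-sided convex polyhedron of dimension 3.\<close>

definition convex_polyhedron :: "hyp3 set \<Rightarrow> bool" where
  "convex_polyhedron P \<longleftrightarrow>
     (\<exists>N. finite N \<and> (\<forall>n\<in>N. unit_spacelike n) \<and> P = (\<Inter>n\<in>N. halfspace n)) \<and> interior P \<noteq> {}"

text \<open>
  The 2-dimensional faces: intersections with supporting hyperplanes
  that have non-empty relative interior in the hyperplane.
\<close>

definition outward_normal :: "hyp3 set \<Rightarrow> hyp3 set \<Rightarrow> real \<times> (real^3) \<Rightarrow> bool" where
  "outward_normal P f n \<longleftrightarrow> unit_spacelike n \<and> P \<subseteq> halfspace n \<and> f = P \<inter> hplane n"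

definition faces :: "hyp3 set \<Rightarrow> hyp3 set set" where
  "faces P = {f. \<exists>n. outward_normal P f n \<and> top_of_set (hplane n) interior_of f \<noteq> {}}"

definition face_normal :: "hyp3 set \<Rightarrow> hyp3 set \<Rightarrow> real \<times> (real^3)" where
  "face_normal P f = (THE n. outward_normal P f n)"

definition face_reflection :: "hyp3 set \<Rightarrow> hyp3 set \<Rightarrow> hyp3 \<Rightarrow> hyp3" where
  "face_reflection P f = reflection (face_normal P f)"

text \<open>
  The vertices of \<open>P\<close> that lie in hyperbolic space itself: points of \<open>P\<close> that are not interior
  to a geodesic segment contained in \<open>P\<close>.  All vertices of \<open>P\<close> lie on the sphere at infinity
  iff there is none of these.
\<close>

definition finite_vertices :: "hyp3 set \<Rightarrow> hyp3 set" where
  "finite_vertices P =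
     {x \<in> P. \<forall>y\<in>P. \<forall>z\<in>P. dist y x + dist x z = dist y z \<longrightarrow> x = y \<or> x = z}"

definition ideal_polyhedron :: "hyp3 set \<Rightarrow> bool" where
  "ideal_polyhedron P \<longleftrightarrow>
     convex_polyhedron P \<and> hyp_volume P < \<infinity> \<and> finite_vertices P = {}"

text \<open>
  Two distinct faces are adjacent when they share an edge, i.e. when their intersection (a convex
  subset of a geodesic) is not empty or a single point.  The interior dihedral angle is \<open>\<pi>\<close> minus
  the angle between the outward normals.
\<close>

definition adjacent_faces :: "hyp3 set \<Rightarrow> hyp3 set \<Rightarrow> bool" where
  "adjacent_faces f g \<longleftrightarrow> f \<noteq> g \<and> (\<exists>x\<in>f \<inter> g. \<exists>y\<in>f \<inter> g. x \<noteq> y)"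

definition dihedral_angle :: "hyp3 set \<Rightarrow> hyp3 set \<Rightarrow> hyp3 set \<Rightarrow> real" where
  "dihedral_angle P f g = pi - arccos (lor (face_normal P f) (face_normal P g))"

definition right_angled :: "hyp3 set \<Rightarrow> bool" where
  "right_angled P \<longleftrightarrow>
     (\<forall>f\<in>faces P. \<forall>g\<in>faces P. adjacent_faces f g \<longrightarrow> dihedral_angle P f g = pi / 2)"

definition reflection_group :: "hyp3 set \<Rightarrow> (hyp3 \<Rightarrow> hyp3) set" where
  "reflection_group P = generate IsomH3 (face_reflection P ` faces P)"

definition symmetry_group :: "hyp3 set \<Rightarrow> (hyp3 \<Rightarrow> hyp3) set" where
  "symmetry_group P = {g \<in> carrier IsomH3. g ` P = P}"


section \<open>Polyhedral decompositions\<close>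

text \<open>
  The polyhedra are \<open>P 1, \<dots>, P n\<close>.  They are pairwise disjoint, so a face belongs to
  exactly one of them and the pairing isometries can be indexed by the faces alone.
\<close>

definition disjoint_ideal_polyhedra :: "nat \<Rightarrow> (nat \<Rightarrow> hyp3 set) \<Rightarrow> bool" where
  "disjoint_ideal_polyhedra n P \<longleftrightarrow>
     (\<forall>i\<in>{1..n}. ideal_polyhedron (P i)) \<and> disjoint_family_on P {1..n}"

definition face_pairing ::
  "nat \<Rightarrow> (nat \<Rightarrow> hyp3 set) \<Rightarrow> (hyp3 set \<Rightarrow> hyp3 \<Rightarrow> hyp3) \<Rightarrow> bool" where
  "face_pairing n P \<phi> \<longleftrightarrow>
     (\<forall>i\<in>{1..n}. \<forall>f\<in>faces (P i). hyp_isometry (\<phi> f) \<and>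
        (\<exists>j\<in>{1..n}. \<exists>f'\<in>faces (P j).
           \<phi> f ` f = f' \<and> \<phi> f ` P i \<inter> P j = f' \<and> \<phi> f' = inv_into UNIV (\<phi> f)))"

definition pairing_rel ::
  "nat \<Rightarrow> (nat \<Rightarrow> hyp3 set) \<Rightarrow> (hyp3 set \<Rightarrow> hyp3 \<Rightarrow> hyp3) \<Rightarrow> (hyp3 \<times> hyp3) set" where
  "pairing_rel n P \<phi> = {(x, y). \<exists>i\<in>{1..n}. \<exists>f\<in>faces (P i). x \<in> f \<and> y = \<phi> f x}"

definition glue_rel ::
  "nat \<Rightarrow> (nat \<Rightarrow> hyp3 set) \<Rightarrow> (hyp3 set \<Rightarrow> hyp3 \<Rightarrow> hyp3) \<Rightarrow> (hyp3 \<times> hyp3) set" where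
  "glue_rel n P \<phi> =
     (pairing_rel n P \<phi> \<union> (pairing_rel n P \<phi>)\<inverse>)\<^sup>* \<inter> (\<Union>i\<in>{1..n}. P i) \<times> (\<Union>i\<in>{1..n}. P i)"

definition glued_space ::
  "nat \<Rightarrow> (nat \<Rightarrow> hyp3 set) \<Rightarrow> (hyp3 set \<Rightarrow> hyp3 \<Rightarrow> hyp3) \<Rightarrow> hyp3 set set" where
  "glued_space n P \<phi> = (\<Union>i\<in>{1..n}. P i) // glue_rel n P \<phi>"

text \<open>
  The quotient metric on the disjoint union of the \<open>P i\<close> (distinct pieces being infinitely far
  apart): the infimum of the lengths of chains \<open>(x\<^sub>1, y\<^sub>1), \<dots>, (x\<^sub>k, y\<^sub>k)\<close> such that \<open>x\<^sub>j, y\<^sub>j\<close> lie in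
  the same piece and \<open>y\<^sub>j\<close> is identified with the next \<open>x\<close>.  It is \<open>\<infinity>\<close> if there is no chain.
\<close>

definition glue_chain ::
  "nat \<Rightarrow> (nat \<Rightarrow> hyp3 set) \<Rightarrow> (hyp3 set \<Rightarrow> hyp3 \<Rightarrow> hyp3) \<Rightarrow>
   hyp3 set \<Rightarrow> hyp3 set \<Rightarrow> (hyp3 \<times> hyp3) list \<Rightarrow> bool" where
  "glue_chain n P \<phi> A B c \<longleftrightarrow>
     c \<noteq> [] \<and> fst (hd c) \<in> A \<and> snd (last c) \<in> B \<and>
     (\<forall>(x, y)\<in>set c. \<exists>i\<in>{1..n}. x \<in> P i \<and> y \<in> P i) \<and>
     (\<forall>k. Suc k < length c \<longrightarrow> (snd (c ! k), fst (c ! Suc k)) \<in> glue_rel n P \<phi>)"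

definition glued_dist ::
  "nat \<Rightarrow> (nat \<Rightarrow> hyp3 set) \<Rightarrow> (hyp3 set \<Rightarrow> hyp3 \<Rightarrow> hyp3) \<Rightarrow> hyp3 set \<Rightarrow> hyp3 set \<Rightarrow> ereal" where
  "glued_dist n P \<phi> A B =
     (INF c\<in>{c. glue_chain n P \<phi> A B c}. ereal (\<Sum>(x, y)\<leftarrow>c. dist x y))"

definition isometric :: "'a set \<Rightarrow> ('a \<Rightarrow> 'a \<Rightarrow> 'c) \<Rightarrow> 'b set \<Rightarrow> ('b \<Rightarrow> 'b \<Rightarrow> 'c) \<Rightarrow> bool" where
  "isometric X dX Y dY \<longleftrightarrow>
     (\<exists>h. bij_betw h X Y \<and> (\<forall>x\<in>X. \<forall>y\<in>X. dY (h x) (h y) = dX x y))"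

text \<open>An ideal polyhedral decomposition of the metric space \<open>(M, d)\<close>.\<close>

definition ideal_decomposition ::
  "nat \<Rightarrow> (nat \<Rightarrow> hyp3 set) \<Rightarrow> (hyp3 set \<Rightarrow> hyp3 \<Rightarrow> hyp3) \<Rightarrow> 'm set \<Rightarrow> ('m \<Rightarrow> 'm \<Rightarrow> real) \<Rightarrow> bool" where
  "ideal_decomposition n P \<phi> M d \<longleftrightarrow>
     disjoint_ideal_polyhedra n P \<and> face_pairing n P \<phi> \<and>
     isometric M (\<lambda>x y. ereal (d x y)) (glued_space n P \<phi>) (glued_dist n P \<phi>)"


section \<open>Complete hyperbolic 3-manifolds and their fundamental groups\<close>

definition curve_length :: "('m \<Rightarrow> 'm \<Rightarrow> real) \<Rightarrow> (real \<Rightarrow> 'm) \<Rightarrow> ereal" where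
  "curve_length d c =
     (SUP ts\<in>{ts. ts \<noteq> [] \<and> sorted ts \<and> set ts \<subseteq> {0..1}}.
        ereal (\<Sum>k<length ts - 1. d (c (ts ! k)) (c (ts ! Suc k))))"

text \<open>
  A (connected) hyperbolic 3-manifold is regarded as a metric space with its Riemannian distance:
  it is locally isometric to hyperbolic space, and distance is the infimum of lengths of curves.
\<close>

definition complete_hyperbolic_3_manifold :: "'m set \<Rightarrow> ('m \<Rightarrow> 'm \<Rightarrow> real) \<Rightarrow> bool" where
  "complete_hyperbolic_3_manifold M d \<longleftrightarrow>
     Metric_space M d \<and> M \<noteq> {} \<and>
     connected_space (Metric_space.mtopology M d) \<and>
     Metric_space.mcomplete M d \<and>
     (\<forall>p\<in>M. \<exists>r>0. \<exists>o3::hyp3. isometric (Metric_space.mball M d p r) d (ball o3 r) dist) \<and>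
     (\<forall>x\<in>M. \<forall>y\<in>M. ereal (d x y) =
        (INF c\<in>{c. pathin (Metric_space.mtopology M d) c \<and> c 0 = x \<and> c 1 = y}. curve_length d c))"

definition orbit_of :: "(hyp3 \<Rightarrow> hyp3) set \<Rightarrow> hyp3 \<Rightarrow> hyp3 set" where
  "orbit_of \<Delta> x = (\<lambda>g. g x) ` \<Delta>"

definition orbit_dist :: "hyp3 set \<Rightarrow> hyp3 set \<Rightarrow> real" where
  "orbit_dist A B = Inf {dist a b | a b. a \<in> A \<and> b \<in> B}"

text \<open>
  An identification of the fundamental group of \<open>(M, d)\<close> with a discrete group \<open>\<Delta>\<close> of isometries
  with quotient \<open>M\<close>.  The action is required to be free, so that the quotient map is the universal
  covering of \<open>M\<close> and \<open>\<Delta>\<close> its group of covering transformations.  Discreteness refers to the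
  topology of pointwise convergence, which on isometries agrees with the compact-open topology.
\<close>

definition holonomy_group :: "(hyp3 \<Rightarrow> hyp3) set \<Rightarrow> 'm set \<Rightarrow> ('m \<Rightarrow> 'm \<Rightarrow> real) \<Rightarrow> bool" where
  "holonomy_group \<Delta> M d \<longleftrightarrow>
     subgroup \<Delta> IsomH3 \<and> discrete \<Delta> \<and>
     (\<forall>g\<in>\<Delta>. g \<noteq> id \<longrightarrow> (\<forall>x. g x \<noteq> x)) \<and>
     isometric (range (orbit_of \<Delta>)) orbit_dist M d"

definition conjugate :: "(hyp3 \<Rightarrow> hyp3) \<Rightarrow> (hyp3 \<Rightarrow> hyp3) set \<Rightarrow> (hyp3 \<Rightarrow> hyp3) set" where
  "conjugate g \<Delta> = (\<lambda>h. g \<otimes>\<^bsub>IsomH3\<^esub> h \<otimes>\<^bsub>IsomH3\<^esub> inv\<^bsub>IsomH3\<^esub> g) ` \<Delta>"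

definition internal_semidirect_product ::
  "('a, 'b) monoid_scheme \<Rightarrow> 'a set \<Rightarrow> 'a set \<Rightarrow> 'a set \<Rightarrow> bool" where
  "internal_semidirect_product G S N K \<longleftrightarrow>
     subgroup S G \<and> N \<lhd> G\<lparr>carrier := S\<rparr> \<and> subgroup K (G\<lparr>carrier := S\<rparr>) \<and>
     N \<inter> K = {\<one>\<^bsub>G\<^esub>} \<and> S = N <#>\<^bsub>G\<^esub> K"

end

theory Submission
  imports Defs
begin

text \<open>
  Let \<open>\<Gamma>\<close> be the group generated by the reflections in the faces of \<open>P 1\<close>.  Two facts make the theorem
  true: the \<open>\<Gamma>\<close>-images of \<open>P 1\<close> cover hyperbolic space, and all of them appear as tiles when the
  decomposition of \<open>M\<close> is unrolled into hyperbolic space.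

  The second fact comes from the hypothesis on the pairing.  Call an isometry \<open>g\<close> a development of \<open>P i\<close> if
  following \<open>g\<close> by the covering projection is the inclusion of \<open>P i\<close> into \<open>M\<close>.  If \<open>g\<close> develops \<open>P i\<close>, and
  \<open>f\<close> is a face of \<open>P i\<close> paired with a face of \<open>P j\<close>, then \<open>g\<close> composed with the inverse of \<open>\<phi> f\<close> develops
  \<open>P j\<close> (\<open>develops_step\<close>): it places \<open>P j\<close> on the other side of \<open>g f\<close>.  Since \<open>\<phi> f\<close> after the reflection
  in \<open>f\<close> maps \<open>P i\<close> onto \<open>P j\<close>, this new tile is the mirror image of the old one in their common face.
  So, starting from a development \<open>g0\<close> of \<open>P 1\<close>, every \<open>g0 (w (P 1))\<close> with \<open>w\<close> in \<open>\<Gamma>\<close> is a developed tile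
  (\<open>develops_reflected_tiles\<close>).  Now let \<open>\<delta>\<close> be a covering transformation and \<open>p\<close> an interior point of
  \<open>P 1\<close>.  By the first fact \<open>\<delta> (g0 p)\<close> lies in some tile \<open>g0 (w (P 1)) = g (P i)\<close>.  It lies over \<open>p\<close>, and
  an interior point is glued to no other, so \<open>i = 1\<close> and \<open>g p = \<delta> (g0 p)\<close>; as developments with a common
  value at an interior point agree, \<open>g = \<delta> \<circ> g0\<close>.  Hence \<open>\<delta> \<circ> g0\<close> and \<open>g0 \<circ> w\<close> carry \<open>P 1\<close> to the same tile,
  and after conjugation by \<open>g0\<close> the transformation \<open>\<delta>\<close> differs from \<open>w\<close> by a symmetry of \<open>P 1\<close>.

  The first fact, and the splitting of the semidirect product, concern \<open>P 1\<close> alone.  In the hyperboloid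
  model a polyhedron is cut out by unit space-like outward normals.  Finite volume forces the
  polyhedral cone over \<open>P 1\<close> to lie in the closed future light cone (\<open>dual_cone_causal\<close>).  With Farkas'
  lemma and the right angles this gives the Coxeter condition that any two distinct normals are
  orthogonal or have product at most \<open>-1\<close> (\<open>right_angled_gram\<close>).  Tits' argument on word length (\<open>tits\<close>)
  then shows that a nontrivial element of \<open>\<Gamma>\<close> moves \<open>P 1\<close> off its own interior.  Therefore \<open>\<Gamma>\<close> meets the
  symmetry group trivially and has discrete orbits, and reflecting a point ever closer to an
  interior point of \<open>P 1\<close> brings it into \<open>P 1\<close> after finitely many steps (\<open>W_covers\<close>).
\<close>

section \<open>Lorentzian geometry of the hyperboloid\<close>

lemma lor_eq_inner: "lor u v = (- fst u, snd u) \<bullet> v"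
  by (simp add: lor_def inner_prod_def)

lemma lor_zero [simp]: "lor 0 v = 0" "lor v 0 = 0"
  by (simp_all add: lor_def)

lemma lor_minus [simp]: "lor (- u) v = - lor u v" "lor u (- v) = - lor u v"
  by (simp_all add: lor_def)

lemma lor_sum_right: "lor v (\<Sum>i\<in>A. f i) = (\<Sum>i\<in>A. lor v (f i))"
  by (induction A rule: infinite_finite_induct) (simp_all add: lor_add_right)

lemma lor_nondegenerate:
  assumes "\<And>v. lor u v = 0"
  shows "u = 0"
proof -
  have "(- fst u, snd u) \<bullet> (- fst u, snd u) = 0"
    using assms[of "(- fst u, snd u)"] by (simp add: lor_eq_inner)
  then have "(- fst u, snd u) = 0" by (simp only: inner_eq_zero_iff)
  then show ?thesis by (simp add: prod_eq_iff)
qed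

lemma continuous_on_lor [continuous_intros]:
  "continuous_on A f \<Longrightarrow> continuous_on A g \<Longrightarrow> continuous_on A (\<lambda>x. lor (f x) (g x))"
  unfolding lor_def by (intro continuous_intros)

lemma unit_spacelike_nonzero: "unit_spacelike n \<Longrightarrow> n \<noteq> 0"
  by (auto simp: unit_spacelike_def)

text \<open>The closed cone of future-directed causal vectors; its interior \<open>timelike\<close> is the open cone over
  the hyperboloid.\<close>

definition causal :: "(real \<times> (real^3)) set" where
  "causal = {p. norm (snd p) \<le> fst p}"

definition timelike :: "(real \<times> (real^3)) set" where
  "timelike = {p. norm (snd p) < fst p}"

lemma timelike_imp_causal: "p \<in> timelike \<Longrightarrow> p \<in> causal"
  by (simp add: causal_def timelike_def)

lemma timelike_iff: "p \<in> timelike \<longleftrightarrow> lor p p < 0 \<and> fst p > 0"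
proof -
  have "lor p p = (norm (snd p))\<^sup>2 - (fst p)\<^sup>2"
    by (simp add: lor_def dot_square_norm power2_eq_square)
  then show ?thesis
    unfolding timelike_def using norm_ge_zero[of "snd p"]
    by (auto simp: power_strict_mono intro: power2_less_imp_less le_less_trans[OF norm_ge_zero])
qed

lemma causal_imp_lor_nonpos: "p \<in> causal \<Longrightarrow> lor p p \<le> 0"
  by (auto simp: causal_def lor_def dot_square_norm simp flip: power2_eq_square
      intro!: power_mono)

lemma vec_of_timelike [simp]: "vec_of x \<in> timelike"
  by (simp add: timelike_iff)

lemma open_timelike: "open timelike"
  unfolding timelike_def by (intro open_Collect_less continuous_intros)

lemma timelike_scale: "p \<in> timelike \<Longrightarrow> c > 0 \<Longrightarrow> c *\<^sub>R p \<in> timelike"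
  by (simp add: timelike_def)

lemma causal_scale: "p \<in> causal \<Longrightarrow> c \<ge> 0 \<Longrightarrow> c *\<^sub>R p \<in> causal"
  by (simp add: causal_def mult_left_mono)

lemma timelike_add_causal: "p \<in> timelike \<Longrightarrow> q \<in> causal \<Longrightarrow> p + q \<in> timelike"
  using norm_triangle_ineq[of "snd p" "snd q"] by (simp add: timelike_def causal_def)

lemma lor_timelike_causal_neg:
  assumes "p \<in> timelike" "q \<in> causal" "q \<noteq> 0"
  shows "lor p q < 0"
proof -
  have q: "norm (snd q) \<le> fst q" and p: "norm (snd p) < fst p"
    using assms by (auto simp: causal_def timelike_def)
  have "fst q > 0"
  proof (rule ccontr)
    assume "\<not> fst q > 0"
    then have "norm (snd q) = 0 \<and> fst q = 0" using q norm_ge_zero[of "snd q"] by linarith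
    then show False using assms(3) by (simp add: prod_eq_iff)
  qed
  have "snd p \<bullet> snd q \<le> norm (snd p) * norm (snd q)" by (rule norm_cauchy_schwarz)
  also have "\<dots> \<le> norm (snd p) * fst q" by (rule mult_left_mono[OF q]) simp
  also have "\<dots> < fst p * fst q" using p \<open>fst q > 0\<close> by simp
  finally show ?thesis by (simp add: lor_def)
qed

lemma timelike_segment:
  assumes "p \<in> timelike" "q \<in> timelike" "0 \<le> t" "t \<le> 1"
  shows "(1 - t) *\<^sub>R p + t *\<^sub>R q \<in> timelike"
proof (cases "t = 1")
  case False
  then show ?thesis using assms
    by (intro timelike_add_causal timelike_scale causal_scale timelike_imp_causal) auto
qed (use assms in simp)

text \<open>A line that touches the closed light cone at a light-like point \<open>x\<close> and stays inside on both sides of \<open>x\<close>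
  must be orthogonal to \<open>x\<close>, and a causal direction orthogonal to a light-like vector is
  parallel to it.  This rules out that a relative interior point of a face of a cone inside the
  light cone is light-like.\<close>

lemma causal_line_imp_timelike:
  assumes "e > 0" and line: "\<And>t. \<bar>t\<bar> < e \<Longrightarrow> x + t *\<^sub>R w \<in> causal"
    and x: "x \<noteq> 0" and w: "\<And>c. w \<noteq> c *\<^sub>R x"
  shows "x \<in> timelike"
proof (rule ccontr)
  assume not: "x \<notin> timelike"
  have xc: "x \<in> causal" using line[of 0] \<open>e > 0\<close> by simp
  then have null: "norm (snd x) = fst x" using not by (auto simp: causal_def timelike_def)
  have xx: "lor x x = 0" by (simp add: lor_def null[symmetric] dot_square_norm power2_eq_square)
  have fx: "fst x \<noteq> 0" using null x by (auto simp: prod_eq_iff)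
  have q: "2 * t * lor x w + t\<^sup>2 * lor w w \<le> 0" if "\<bar>t\<bar> < e" for t
    using causal_imp_lor_nonpos[OF line[OF that]]
    by (simp add: lor_simps xx lor_commute[of w x] power2_eq_square algebra_simps)
  have ww: "lor w w \<le> 0"
  proof -
    have "(e/2)\<^sup>2 * lor w w \<le> 0" using q[of "e/2"] q[of "-e/2"] \<open>e > 0\<close> by simp
    then show ?thesis using \<open>e > 0\<close> by (simp add: mult_le_0_iff)
  qed
  have xw: "lor x w = 0"
  proof (rule ccontr)
    assume nz: "lor x w \<noteq> 0"
    define s where "s = sgn (lor x w)"
    have s: "s * lor x w = \<bar>lor x w\<bar>" "s\<^sup>2 = 1" "\<bar>s\<bar> = 1"
      using nz by (auto simp: s_def sgn_if)
    define t where "t = min (e/2) (\<bar>lor x w\<bar> / (1 + \<bar>lor w w\<bar>))"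
    have t: "t > 0" "t < e" "t * (1 + \<bar>lor w w\<bar>) \<le> \<bar>lor x w\<bar>"
    proof -
      have "1 + \<bar>lor w w\<bar> > 0" by linarith
      moreover have "t \<le> \<bar>lor x w\<bar> / (1 + \<bar>lor w w\<bar>)" by (simp add: t_def)
      ultimately show "t * (1 + \<bar>lor w w\<bar>) \<le> \<bar>lor x w\<bar>" by (simp only: pos_le_divide_eq)
      show "t > 0" using \<open>e > 0\<close> nz \<open>1 + \<bar>lor w w\<bar> > 0\<close> by (simp add: t_def)
      show "t < e" using \<open>e > 0\<close> by (simp add: t_def min_less_iff_disj)
    qed
    have "2 * (s * t) * lor x w + (s * t)\<^sup>2 * lor w w \<le> 0"
      using q[of "s * t"] t s(3) by (simp add: abs_mult)
    also have "2 * (s * t) * lor x w + (s * t)\<^sup>2 * lor w w = t * (2 * \<bar>lor x w\<bar> + t * lor w w)"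
    proof -
      have "2 * (s * t) * lor x w + (s * t)\<^sup>2 * lor w w = 2 * t * (s * lor x w) + s\<^sup>2 * (t\<^sup>2 * lor w w)"
        by (simp add: power_mult_distrib algebra_simps)
      also have "\<dots> = t * (2 * \<bar>lor x w\<bar> + t * lor w w)"
        unfolding s(1,2) by (simp add: power2_eq_square algebra_simps)
      finally show ?thesis .
    qed
    finally have "2 * \<bar>lor x w\<bar> + t * lor w w \<le> 0" using t(1) by (simp add: mult_le_0_iff)
    moreover have "- (t * lor w w) \<le> t * (1 + \<bar>lor w w\<bar>)" using t(1)
      by (smt (verit) mult_le_cancel_left_pos mult_minus_right)
    ultimately show False using t(3) nz by linarith
  qed
  \<comment> \<open>\<open>w\<close> is causal and orthogonal to the light-like vector \<open>x\<close>, hence parallel to it\<close>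
  define z where "z = fst w *\<^sub>R x - fst x *\<^sub>R w"
  have "lor z z = (fst x)\<^sup>2 * lor w w"
    by (simp add: z_def lor_simps xx xw lor_commute[of w x] power2_eq_square algebra_simps)
  then have "lor z z \<le> 0" using ww by (simp add: mult_le_0_iff)
  moreover have "fst z = 0" by (simp add: z_def)
  ultimately have "z = 0" by (simp add: lor_def prod_eq_iff dot_square_norm)
  then have "fst w *\<^sub>R x = fst x *\<^sub>R w" by (simp add: z_def)
  then have "(1 / fst x) *\<^sub>R fst w *\<^sub>R x = (1 / fst x) *\<^sub>R fst x *\<^sub>R w" by (rule arg_cong)
  then have "w = (fst w / fst x) *\<^sub>R x" using fx by simp
  then show False using w by blast
qed

text \<open>Radial projection of the time-like cone to the hyperboloid.\<close>

definition hproj :: "real \<times> (real^3) \<Rightarrow> hyp3" where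
  "hproj v = Hyp ((1 / sqrt (- lor v v)) *\<^sub>R v)"

lemma vec_of_hproj:
  assumes "v \<in> timelike"
  shows "vec_of (hproj v) = (1 / sqrt (- lor v v)) *\<^sub>R v"
proof -
  have "lor v v < 0" "fst v > 0" using assms by (auto simp: timelike_iff)
  then show ?thesis unfolding hproj_def
    by (intro Hyp_inverse) (auto simp: lor_simps)
qed

lemma vec_of_hproj_pos:
  assumes "v \<in> timelike"
  obtains c where "c > 0" "vec_of (hproj v) = c *\<^sub>R v"
  using assms by (intro that[OF _ vec_of_hproj[OF assms]]) (auto simp: timelike_iff)

lemma hproj_vec_of [simp]: "hproj (vec_of x) = x"
  by (simp add: hproj_def vec_of_inverse)

lemma lor_hproj_nonpos_iff:
  assumes "v \<in> timelike"
  shows "lor (vec_of (hproj v)) n \<le> 0 \<longleftrightarrow> lor v n \<le> 0"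
    and "lor (vec_of (hproj v)) n < 0 \<longleftrightarrow> lor v n < 0"
    and "lor (vec_of (hproj v)) n = 0 \<longleftrightarrow> lor v n = 0"
proof -
  obtain c where "c > 0" "vec_of (hproj v) = c *\<^sub>R v" using vec_of_hproj_pos[OF assms] .
  then show "lor (vec_of (hproj v)) n \<le> 0 \<longleftrightarrow> lor v n \<le> 0"
    "lor (vec_of (hproj v)) n < 0 \<longleftrightarrow> lor v n < 0"
    "lor (vec_of (hproj v)) n = 0 \<longleftrightarrow> lor v n = 0"
    by (simp_all add: lor_simps mult_le_0_iff mult_less_0_iff)
qed

lemma cosh_dist: "cosh (dist x y) = - lor (vec_of x) (vec_of y)"
  unfolding dist_hyp3_def using lor_vec_le[of x y] by simp

lemma dist_eq_iff_lor:
  "dist x y = dist u v \<longleftrightarrow> lor (vec_of x) (vec_of y) = lor (vec_of u) (vec_of v)"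
proof -
  have "dist x y = dist u v \<longleftrightarrow> cosh (dist x y) = cosh (dist u v)"
    by (auto dest!: arg_cong[where f = arcosh] simp: arcosh_cosh_real)
  then show ?thesis by (simp add: cosh_dist)
qed

text \<open>The topology of hyperbolic space comes from its metric, so the embedding is continuous because
  the ambient coordinates are combinations of hyperbolic cosines of distances to four fixed points.\<close>

lemma continuous_on_vec_of: "continuous_on UNIV vec_of"
proof -
  define o3 where "o3 = hproj (1, 0)"
  define q where "q i = hproj (sqrt 2, axis i 1 :: real^3)" for i
  have o3: "vec_of o3 = (1, 0)" unfolding o3_def
    by (subst vec_of_hproj) (auto simp: timelike_def lor_def)
  have q: "vec_of (q i) = (sqrt 2, axis i 1)" for i unfolding q_def
    by (subst vec_of_hproj) (auto simp: timelike_def lor_def inner_axis_axis)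
  have 1: "fst (vec_of x) = cosh (dist x o3)" for x
    by (simp add: cosh_dist o3 lor_def)
  have 2: "snd (vec_of x) $ i = sqrt 2 * cosh (dist x o3) - cosh (dist x (q i))" for x i
    by (simp add: cosh_dist o3 q lor_def inner_axis)
  have eq: "vec_of = (\<lambda>x. (cosh (dist x o3), \<chi> i. sqrt 2 * cosh (dist x o3) - cosh (dist x (q i))))"
    by (auto simp: fun_eq_iff prod_eq_iff vec_eq_iff 1 2)
  show ?thesis by (subst eq) (intro continuous_intros)
qed

lemmas continuous_on_vec_of' [continuous_intros] =
  continuous_on_compose2[OF continuous_on_vec_of _ subset_UNIV]

lemma continuous_on_hproj: "continuous_on timelike hproj"
  unfolding continuous_on_def
proof
  fix v assume v: "v \<in> timelike"
  let ?F = "\<lambda>w. - (lor w v) / (sqrt (- lor w w) * sqrt (- lor v v))"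
  have F: "- lor (vec_of (hproj w)) (vec_of (hproj v)) = ?F w" if "w \<in> timelike" for w
    using that v by (simp add: vec_of_hproj lor_simps)
  have "continuous_on timelike ?F" using v by (intro continuous_intros) (auto simp: timelike_iff)
  then have "continuous_on timelike (\<lambda>w. - lor (vec_of (hproj w)) (vec_of (hproj v)))"
    by (simp only: F cong: continuous_on_cong)
  then have "continuous_on timelike (\<lambda>w. arcosh (- lor (vec_of (hproj w)) (vec_of (hproj v))))"
    by (rule continuous_on_compose2[OF continuous_on_arcosh[OF order.refl]]) (use lor_vec_le in fastforce)
  then have "((\<lambda>w. dist (hproj w) (hproj v)) \<longlongrightarrow> dist (hproj v) (hproj v)) (at v within timelike)"
    unfolding dist_hyp3_def using v by (auto simp: continuous_on_def)
  then show "(hproj \<longlongrightarrow> hproj v) (at v within timelike)"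
    by (subst tendsto_dist_iff) simp
qed

lemma open_hproj_vimage: "open U \<Longrightarrow> open {v \<in> timelike. hproj v \<in> U}"
  using continuous_open_preimage[OF continuous_on_hproj open_timelike, of U]
  by (simp add: Int_def vimage_def)

text \<open>Nearby points of hyperbolic space are reached along straight lines of the ambient space, so that
  local statements become statements of linear algebra.\<close>

lemma hproj_line_in_open:
  assumes "open U" "v \<in> timelike" "hproj v \<in> U"
  obtains e where "e > 0" "\<And>t. \<bar>t\<bar> < e \<Longrightarrow> v + t *\<^sub>R w \<in> timelike \<and> hproj (v + t *\<^sub>R w) \<in> U"
proof -
  let ?V = "(\<lambda>t::real. v + t *\<^sub>R w) -` {v \<in> timelike. hproj v \<in> U}"
  have "open ?V"
    by (rule open_vimage[OF open_hproj_vimage[OF assms(1)]]) (intro continuous_intros)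
  moreover have "0 \<in> ?V" using assms by simp
  ultimately obtain e where "e > 0" "ball 0 e \<subseteq> ?V" by (rule openE)
  then show ?thesis by (intro that[of e]) (auto simp: subset_eq dist_norm)
qed

lemma open_hyp3_lor_less: "open {x. lor (vec_of x) n < 0}"
  by (intro open_Collect_less continuous_intros continuous_on_vec_of)

text \<open>A ball is the projection of a set of causal vectors that is bounded because a time-like vector
  pairs with a causal one at least as strongly as a multiple of the latter's time coordinate.\<close>

lemma compact_hyp3_cball: "compact (cball (x::hyp3) r)"
proof -
  define K where "K = {v. lor v v = -1 \<and> lor (vec_of x) v \<ge> - cosh r \<and> norm (snd v) \<le> fst v}"
  have "closed K" unfolding K_def
    by (intro closed_Collect_conj closed_Collect_eq closed_Collect_le continuous_intros)
  moreover have "bounded K"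
  proof -
    define a where "a = fst (vec_of x) - norm (snd (vec_of x))"
    have a: "a > 0" using vec_of_timelike[of x] by (simp add: a_def timelike_def)
    have "norm v \<le> cosh r / a + cosh r / a" if "v \<in> K" for v
    proof -
      have v: "norm (snd v) \<le> fst v" "lor (vec_of x) v \<ge> - cosh r" using that by (auto simp: K_def)
      have "fst (vec_of x) * fst v \<le> cosh r + snd (vec_of x) \<bullet> snd v" using v(2) by (simp add: lor_def)
      also have "snd (vec_of x) \<bullet> snd v \<le> norm (snd (vec_of x)) * norm (snd v)" by (rule norm_cauchy_schwarz)
      also have "\<dots> \<le> norm (snd (vec_of x)) * fst v" using v(1) by (intro mult_left_mono) auto
      finally have "a * fst v \<le> cosh r" by (simp add: a_def algebra_simps)
      then have "fst v \<le> cosh r / a" using a by (simp add: field_simps)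
      moreover have "norm v \<le> norm (fst v) + norm (snd v)" by (metis norm_Pair_le prod.collapse)
      moreover have "norm (fst v) = fst v" using order.trans[OF norm_ge_zero v(1)] by simp
      ultimately show ?thesis using v(1) by linarith
    qed
    then show ?thesis unfolding bounded_iff by blast
  qed
  ultimately have "compact K" by (simp add: compact_eq_bounded_closed)
  have tl: "K \<subseteq> timelike"
  proof
    fix v assume v: "v \<in> K"
    then have "fst v \<ge> 0" by (auto simp: K_def intro: order.trans[OF norm_ge_zero])
    moreover have "fst v \<noteq> 0" using v inner_ge_zero[of "snd v"] by (auto simp: K_def lor_def simp del: inner_ge_zero)
    ultimately show "v \<in> timelike" using v by (simp add: timelike_iff K_def)
  qed
  have "compact (hproj ` K)"
    using \<open>compact K\<close> continuous_on_subset[OF continuous_on_hproj tl] by (rule compact_continuous_image[rotated])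
  moreover have "cball x r \<subseteq> hproj ` K"
  proof
    fix y assume "y \<in> cball x r"
    then have "cosh (dist x y) \<le> cosh r"
      by (subst cosh_real_nonneg_le_iff) (auto intro: order.trans[OF zero_le_dist[of x y]])
    then have "vec_of y \<in> K" using vec_of_timelike[of y] 
      by (auto simp: K_def cosh_dist timelike_def)
    then show "y \<in> hproj ` K" by (metis hproj_vec_of imageI)
  qed
  ultimately show ?thesis using compact_Int_closed[of "hproj ` K" "cball x r"] by (simp add: inf.absorb2)
qed

section \<open>Isometries are Lorentz transformations\<close>

lemma span_scaleR_cancel: "c *\<^sub>R x \<in> span S \<Longrightarrow> c \<noteq> 0 \<Longrightarrow> x \<in> span S"
  for x :: "'a::real_vector"
  using span_scale[of "c *\<^sub>R x" S "1 / c"] by simp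

text \<open>If moving slightly from \<open>x\<close> in the direction \<open>w\<close> stays inside the given set, then \<open>w\<close> is a difference
  of multiples of its points.\<close>

lemma span_of_open_along:
  assumes U: "open U" "x \<in> U" and S: "x \<in> S"
    and along: "\<And>t. vec_of x + t *\<^sub>R w \<in> timelike \<Longrightarrow> hproj (vec_of x + t *\<^sub>R w) \<in> S"
  shows "w \<in> span (vec_of ` (U \<inter> S))"
proof -
  obtain e where e: "e > 0" "\<And>t. \<bar>t\<bar> < e \<Longrightarrow> vec_of x + t *\<^sub>R w \<in> timelike \<and> hproj (vec_of x + t *\<^sub>R w) \<in> U"
    using hproj_line_in_open[of U "vec_of x" w] U by auto
  define p where "p = vec_of x + (e/2) *\<^sub>R w"
  have p: "p \<in> timelike" "hproj p \<in> U \<inter> S" using e(2)[of "e/2"] e(1) along[of "e/2"] by (auto simp: p_def)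
  obtain c where c: "c > 0" "vec_of (hproj p) = c *\<^sub>R p" using vec_of_hproj_pos[OF p(1)] .
  have "vec_of (hproj p) \<in> span (vec_of ` (U \<inter> S))" by (rule span_base[OF imageI[OF p(2)]])
  then have "p \<in> span (vec_of ` (U \<inter> S))" unfolding c(2) using c(1) by (auto dest: span_scaleR_cancel)
  moreover have "vec_of x \<in> span (vec_of ` (U \<inter> S))" using U S by (simp add: span_base)
  ultimately have "(e/2) *\<^sub>R w \<in> span (vec_of ` (U \<inter> S))" by (simp add: p_def span_add_eq)
  then show ?thesis using e(1) by (auto dest: span_scaleR_cancel)
qed

lemma span_UNIV_of_open:
  assumes "open U" "x \<in> U"
  shows "span (vec_of ` U) = UNIV"
proof -
  have "w \<in> span (vec_of ` (U \<inter> UNIV))" for w by (rule span_of_open_along[OF assms]) simp_all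
  then show ?thesis by auto
qed

lemma span_of_open_in_hplane:
  assumes "open U" "x \<in> U" "x \<in> hplane n" and w: "lor w n = 0"
  shows "w \<in> span (vec_of ` (U \<inter> hplane n))"
proof (rule span_of_open_along[OF assms(1-3)])
  fix t assume "vec_of x + t *\<^sub>R w \<in> timelike"
  then show "hproj (vec_of x + t *\<^sub>R w) \<in> hplane n"
    using assms(3) w by (simp add: hplane_def lor_hproj_nonpos_iff lor_simps)
qed

definition lorentz_map :: "(real \<times> (real^3) \<Rightarrow> real \<times> (real^3)) \<Rightarrow> bool" where
  "lorentz_map L \<longleftrightarrow> linear L \<and> (\<forall>u v. lor (L u) (L v) = lor u v) \<and> L ` timelike \<subseteq> timelike"

lemma lorentz_mapD:
  assumes "lorentz_map L"
  shows "linear L" "lor (L u) (L v) = lor u v" "p \<in> timelike \<Longrightarrow> L p \<in> timelike"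
  using assms unfolding lorentz_map_def by blast+

lemma lor_preserving_bij:
  assumes L: "linear L" "\<And>u v. lor (L u) (L v) = lor u v"
  shows "bij L"
proof -
  have "inj L"
  proof (rule linear_injective_0[THEN iffD2, rule_format, OF L(1)])
    fix u assume "L u = 0"
    then have "lor u v = 0" for v using L(2)[of u v] by simp
    then show "u = 0" by (rule lor_nondegenerate)
  qed
  moreover have "surj L" by (rule linear_inj_imp_surj[OF L(1) \<open>inj L\<close>])
  ultimately show ?thesis by (simp add: bij_def)
qed

lemma lorentz_map_bij: "lorentz_map L \<Longrightarrow> bij L"
  by (rule lor_preserving_bij) (simp_all add: lorentz_mapD)

text \<open>Otherwise \<open>- p\<close> would lie in the future cone and pair negatively with the point \<open>y\<close>.\<close>

lemma timelike_if_lor_neg: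
  assumes "lor p p < 0" "lor p (vec_of y) < 0"
  shows "p \<in> timelike"
proof (rule ccontr)
  assume "p \<notin> timelike"
  then have "fst p \<le> 0" using assms(1) by (simp add: timelike_iff)
  moreover have "fst p \<noteq> 0" using assms(1) inner_ge_zero[of "snd p"] by (auto simp: lor_def simp del: inner_ge_zero)
  ultimately have "- p \<in> timelike" using assms(1) by (simp add: timelike_iff)
  then have "lor (- p) (vec_of y) < 0"
    by (intro lor_timelike_causal_neg timelike_imp_causal) (auto dest: arg_cong[where f = fst] simp: less_imp_neq[OF fst_vec_pos, symmetric])
  then show False using assms(2) by simp
qed

text \<open>A distance-preserving map of a spanning set preserves the Lorentzian Gram matrix of a basis chosen
  from it.  Its linear extension from the basis preserves the form, and by nondegeneracy it has the right value at the
  other points of the set.\<close>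

lemma partial_isometry_lorentz:
  assumes span: "span (vec_of ` S) = UNIV"
    and h: "\<And>x y. x \<in> S \<Longrightarrow> y \<in> S \<Longrightarrow> dist (h x) (h y) = dist x y"
  obtains L where "lorentz_map L" "\<And>x. x \<in> S \<Longrightarrow> vec_of (h x) = L (vec_of x)"
proof -
  obtain B where B: "B \<subseteq> vec_of ` S" "independent B" "vec_of ` S \<subseteq> span B"
    using basis_exists[of "vec_of ` S"] by metis
  have spB: "span B = UNIV" using span span_minimal[OF B(3) subspace_span] by (simp add: top.extremum_unique)
  obtain L where L: "linear L" "\<And>b. b \<in> B \<Longrightarrow> L b = vec_of (h (hproj b))"
    using linear_independent_extend[OF B(2), of "\<lambda>b. vec_of (h (hproj b))"] by auto
  have hl: "lor (vec_of (h x)) (vec_of (h y)) = lor (vec_of x) (vec_of y)" if "x \<in> S" "y \<in> S" for x y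
    using h[OF that] by (simp add: dist_eq_iff_lor)
  have linl: "linear (\<lambda>u. lor u b)" "linear (\<lambda>u. lor (L u) b)" for b
    by (rule linearI; simp only: lor_simps linear_add[OF L(1)] linear_scale[OF L(1)] real_scaleR_def)+
  have linr: "linear (\<lambda>u. lor b u)" "linear (\<lambda>u. lor b (L u))" for b
    by (rule linearI; simp only: lor_simps linear_add[OF L(1)] linear_scale[OF L(1)] real_scaleR_def)+
  have b1: "lor (L u) (L b) = lor u b" if "b \<in> B" for u b
  proof (rule linear_eq_on_span[OF linl(2) linl(1), of B])
    fix c assume "c \<in> B"
    then obtain x y where "c = vec_of x" "b = vec_of y" "x \<in> S" "y \<in> S" using B(1) \<open>b \<in> B\<close> by blast
    then show "lor (L c) (L b) = lor c b" using L(2) \<open>c \<in> B\<close> \<open>b \<in> B\<close> hl by simp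
  qed (simp add: spB)
  have b2: "lor (L u) (L v) = lor u v" for u v
    by (rule linear_eq_on_span[OF linr(2) linr(1), of B]) (simp_all add: b1 spB)
  have Lx: "vec_of (h x) = L (vec_of x)" if x: "x \<in> S" for x
  proof -
    have *: "lor (L (vec_of x) - vec_of (h x)) (L v) = 0" for v
    proof (rule linear_eq_on_span[OF linr(2), of "\<lambda>_. 0" B])
      fix c assume "c \<in> B"
      then obtain y where "c = vec_of y" "y \<in> S" using B(1) by blast
      then show "lor (L (vec_of x) - vec_of (h x)) (L c) = 0"
        using b2[of "vec_of x" c] L(2)[OF \<open>c \<in> B\<close>] hl[OF x] by (simp add: lor_simps)
    qed (simp_all add: spB linear_zero)
    have "surj L" using lor_preserving_bij[OF L(1) b2] by (simp add: bij_is_surj)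
    then have "lor (L (vec_of x) - vec_of (h x)) w = 0" for w
      using *[of "inv_into UNIV L w"] by (simp add: surj_f_inv_f)
    then have "L (vec_of x) - vec_of (h x) = 0" by (rule lor_nondegenerate)
    then show ?thesis by simp
  qed
  have "S \<noteq> {}"
  proof
    assume "S = {}"
    then have "(UNIV :: (real \<times> (real^3)) set) = {0}" using span by simp
    then have "((1,0) :: real \<times> (real^3)) \<in> {0}" by blast
    then show False by (simp add: zero_prod_def)
  qed
  then obtain s where s: "s \<in> S" by blast
  have "L p \<in> timelike" if p: "p \<in> timelike" for p
  proof (rule timelike_if_lor_neg)
    show "lor (L p) (L p) < 0" using p by (simp add: b2 timelike_iff)
    have "lor p (vec_of s) < 0"
      by (intro lor_timelike_causal_neg timelike_imp_causal p) (auto dest: arg_cong[where f = fst] simp: less_imp_neq[OF fst_vec_pos, symmetric])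
    then show "lor (L p) (vec_of (h s)) < 0" by (simp add: Lx[OF s] b2)
  qed
  then have "lorentz_map L" using L(1) b2 unfolding lorentz_map_def by blast
  then show ?thesis using Lx that by blast
qed

lemma vec_of_lorentz_hproj:
  assumes "lorentz_map L"
  shows "vec_of (hproj (L (vec_of x))) = L (vec_of x)"
proof -
  have "L (vec_of x) \<in> timelike" "lor (L (vec_of x)) (L (vec_of x)) = -1"
    using assms by (simp_all add: lorentz_mapD)
  then show ?thesis by (simp add: vec_of_hproj)
qed

lemma lorentz_map_isometry:
  assumes L: "lorentz_map L"
  shows "hyp_isometry (\<lambda>x. hproj (L (vec_of x)))" (is "hyp_isometry ?g")
  unfolding hyp_isometry_def
proof
  have pres: "dist (?g x) (?g y) = dist x y" for x y
    using L by (simp add: dist_eq_iff_lor vec_of_lorentz_hproj lorentz_mapD)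
  then show "\<forall>x y. dist (?g x) (?g y) = dist x y" by blast
  have "inj ?g" by (rule injI) (metis pres dist_eq_0_iff)
  moreover have "surj ?g"
  proof (rule surjI)
    fix y
    let ?v = "inv_into UNIV L (vec_of y)"
    have Lv: "L ?v = vec_of y" using lorentz_map_bij[OF L] by (simp add: bij_is_surj surj_f_inv_f)
    have vv: "lor ?v ?v = -1" using lorentz_mapD(2)[OF L, of ?v ?v] Lv by simp
    have "fst ?v \<noteq> 0" using vv inner_ge_zero[of "snd ?v"] by (auto simp: lor_def simp del: inner_ge_zero)
    have "?v \<in> timelike"
    proof (rule ccontr)
      assume "?v \<notin> timelike"
      then have "- ?v \<in> timelike" using vv \<open>fst ?v \<noteq> 0\<close> by (simp add: timelike_iff)
      then have "L (- ?v) \<in> timelike" using L by (simp add: lorentz_mapD)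
      then have "- vec_of y \<in> timelike" using L Lv by (simp add: linear_neg lorentz_mapD)
      then show False using fst_vec_pos[of y] by (simp add: timelike_iff)
    qed
    then have "vec_of (hproj ?v) = ?v" using vv by (simp add: vec_of_hproj)
    then show "?g (hproj ?v) = y" by (simp add: Lv)
  qed
  ultimately show "bij ?g" by (simp add: bij_def)
qed

text \<open>This turns an isometry between small balls into a global isometry, which is how developments
  arise from local lifts.\<close>

lemma partial_isometry_extends:
  assumes "span (vec_of ` S) = UNIV"
    and "\<And>x y. x \<in> S \<Longrightarrow> y \<in> S \<Longrightarrow> dist (h x) (h y) = dist x y"
  obtains g where "hyp_isometry g" "\<forall>x\<in>S. g x = h x"
proof -
  obtain L where L: "lorentz_map L" "\<And>x. x \<in> S \<Longrightarrow> vec_of (h x) = L (vec_of x)"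
    using partial_isometry_lorentz[OF assms] by metis
  show ?thesis
    by (rule that[OF lorentz_map_isometry[OF L(1)]]) (simp add: L(2)[symmetric])
qed

text \<open>The linear extension of an isometry, meaningful only for isometries.  It transports normal
  vectors.\<close>

definition lmap :: "(hyp3 \<Rightarrow> hyp3) \<Rightarrow> real \<times> (real^3) \<Rightarrow> real \<times> (real^3)" where
  "lmap g = (SOME L. lorentz_map L \<and> (\<forall>x. vec_of (g x) = L (vec_of x)))"

lemma span_range_vec_of: "span (range vec_of) = UNIV"
  using span_UNIV_of_open[of UNIV] by simp

lemma lmap_isometry:
  assumes "hyp_isometry g"
  shows "lorentz_map (lmap g)" "vec_of (g x) = lmap g (vec_of x)"
proof -
  have "\<exists>L. lorentz_map L \<and> (\<forall>x. vec_of (g x) = L (vec_of x))"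
    by (rule partial_isometry_lorentz[OF span_range_vec_of, of g])
      (use assms in \<open>auto simp: hyp_isometry_def\<close>)
  from someI_ex[OF this] show "lorentz_map (lmap g)" "vec_of (g x) = lmap g (vec_of x)"
    unfolding lmap_def by blast+
qed

lemma linear_lmap: "hyp_isometry g \<Longrightarrow> linear (lmap g)"
  and lor_lmap: "hyp_isometry g \<Longrightarrow> lor (lmap g u) (lmap g v) = lor u v"
  using lorentz_mapD[OF lmap_isometry(1)] by auto

lemma isometry_eqI:
  assumes g: "hyp_isometry g" "hyp_isometry h" and "span (vec_of ` S) = UNIV"
    and "\<And>x. x \<in> S \<Longrightarrow> g x = h x"
  shows "g = h"
proof
  fix x
  have "lmap g (vec_of x) = lmap h (vec_of x)"
    by (rule linear_eq_on_span[OF linear_lmap[OF g(1)] linear_lmap[OF g(2)], of "vec_of ` S"])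
       (use assms in \<open>auto simp flip: lmap_isometry(2)\<close>)
  then show "g x = h x" using g by (simp flip: lmap_isometry(2) add: vec_of_inject)
qed

lemma isometry_eq_on_open:
  assumes "hyp_isometry g" "hyp_isometry h" "open U" "p \<in> U" "\<And>x. x \<in> U \<Longrightarrow> g x = h x"
  shows "g = h"
  by (rule isometry_eqI[OF assms(1,2) span_UNIV_of_open[OF assms(3,4)] assms(5)])

lemma lmap_eqI:
  assumes "hyp_isometry g" "linear L" "\<And>x. vec_of (g x) = L (vec_of x)"
  shows "lmap g v = L v"
  by (rule linear_eq_on_span[OF linear_lmap[OF assms(1)] assms(2), of "range vec_of"])
     (use assms lmap_isometry(2) in \<open>auto simp: span_range_vec_of\<close>)

lemma hyp_isometry_id: "hyp_isometry id"
  by (simp add: hyp_isometry_def)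

lemma hyp_isometry_comp: "hyp_isometry g \<Longrightarrow> hyp_isometry h \<Longrightarrow> hyp_isometry (g \<circ> h)"
  by (auto simp: hyp_isometry_def bij_comp)

lemma hyp_isometry_inv_apply:
  assumes "hyp_isometry g"
  shows "g (inv_into UNIV g x) = x" "inv_into UNIV g (g x) = x"
  using assms by (auto simp: hyp_isometry_def bij_is_surj surj_f_inv_f bij_is_inj)

lemma hyp_isometry_dist: "hyp_isometry g \<Longrightarrow> dist (g x) (g y) = dist x y"
  by (simp add: hyp_isometry_def)

lemma hyp_isometry_inj: "hyp_isometry g \<Longrightarrow> g x = g y \<longleftrightarrow> x = y"
  by (metis hyp_isometry_inv_apply(2))

lemma hyp_isometry_inv:
  assumes "hyp_isometry g"
  shows "hyp_isometry (inv_into UNIV g)"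
  unfolding hyp_isometry_def
  by (metis assms bij_imp_bij_inv hyp_isometry_def hyp_isometry_inv_apply(1))

lemma lmap_comp:
  assumes "hyp_isometry g" "hyp_isometry h"
  shows "lmap (g \<circ> h) v = lmap g (lmap h v)"
proof -
  have "linear (lmap g \<circ> lmap h)" using assms by (intro linear_compose linear_lmap)
  moreover have "vec_of ((g \<circ> h) x) = (lmap g \<circ> lmap h) (vec_of x)" for x
    by (simp add: lmap_isometry(2) assms)
  ultimately have "lmap (g \<circ> h) v = (lmap g \<circ> lmap h) v"
    using lmap_eqI[OF hyp_isometry_comp[OF assms]] by blast
  then show ?thesis by simp
qed

lemma lmap_id: "lmap id v = v"
  using lmap_eqI[OF hyp_isometry_id linear_id, of v] by simp

lemma lmap_inv:
  assumes "hyp_isometry g"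
  shows "lmap g (lmap (inv_into UNIV g) v) = v" "lmap (inv_into UNIV g) (lmap g v) = v"
proof -
  have "g \<circ> inv_into UNIV g = id" "inv_into UNIV g \<circ> g = id"
    using hyp_isometry_inv_apply[OF assms] by auto
  note comp = this
  show "lmap g (lmap (inv_into UNIV g) v) = v" "lmap (inv_into UNIV g) (lmap g v) = v"
    using lmap_comp[OF assms hyp_isometry_inv[OF assms], of v]
      lmap_comp[OF hyp_isometry_inv[OF assms] assms, of v] by (simp_all add: comp lmap_id)
qed

lemma isometry_image_ball:
  assumes "hyp_isometry g"
  shows "g ` ball x r = ball (g x) r"
proof
  show "g ` ball x r \<subseteq> ball (g x) r" using assms by (auto simp: hyp_isometry_dist)
  show "ball (g x) r \<subseteq> g ` ball x r"
  proof
    fix y assume "y \<in> ball (g x) r"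
    then have "inv_into UNIV g y \<in> ball x r"
      using hyp_isometry_dist[OF assms, of x "inv_into UNIV g y"] assms
      by (simp add: hyp_isometry_inv_apply)
    then have "g (inv_into UNIV g y) \<in> g ` ball x r" by (rule imageI)
    then show "y \<in> g ` ball x r" by (simp only: hyp_isometry_inv_apply(1)[OF assms])
  qed
qed

lemma isometry_open_image:
  assumes "hyp_isometry g" "open U"
  shows "open (g ` U)"
  unfolding open_contains_ball
proof
  fix y assume "y \<in> g ` U"
  then obtain x where x: "y = g x" "x \<in> U" by blast
  obtain e where e: "e > 0" "ball x e \<subseteq> U" using openE[OF \<open>open U\<close> x(2)] .
  have "ball y e \<subseteq> g ` U"
    using image_mono[OF e(2), of g] by (simp only: isometry_image_ball[OF assms(1)] x)
  then show "\<exists>e>0. ball y e \<subseteq> g ` U" using e(1) by blast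
qed

lemma isometry_continuous_on: "hyp_isometry g \<Longrightarrow> continuous_on A g"
  by (auto simp: continuous_on_iff hyp_isometry_dist)

lemma isometry_interior_image:
  assumes g: "hyp_isometry g"
  shows "interior (g ` S) = g ` interior S"
proof
  show "g ` interior S \<subseteq> interior (g ` S)"
    by (intro interior_maximal image_mono interior_subset isometry_open_image g open_interior)
  show "interior (g ` S) \<subseteq> g ` interior S"
  proof
    fix y assume y: "y \<in> interior (g ` S)"
    have "inv_into UNIV g ` interior (g ` S) \<subseteq> interior S"
      by (intro interior_maximal isometry_open_image hyp_isometry_inv g open_interior)
         (use interior_subset[of "g ` S"] in \<open>auto simp: hyp_isometry_inv_apply[OF g]\<close>)
    then have "g (inv_into UNIV g y) \<in> g ` interior S" using y by (blast intro: imageI)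
    then show "y \<in> g ` interior S" by (simp only: hyp_isometry_inv_apply(1)[OF g])
  qed
qed

lemma isometry_image_eq_vimage:
  assumes "hyp_isometry g"
  shows "y \<in> g ` S \<longleftrightarrow> inv_into UNIV g y \<in> S"
  using assms by (metis hyp_isometry_inv_apply imageE imageI)

lemma lor_isometry_inv:
  assumes "hyp_isometry g"
  shows "lor (vec_of (inv_into UNIV g y)) n = lor (vec_of y) (lmap g n)"
  using assms lor_lmap[OF assms, of "vec_of (inv_into UNIV g y)" n]
  by (simp flip: lmap_isometry(2) add: hyp_isometry_inv_apply)

lemma isometry_halfspace: "hyp_isometry g \<Longrightarrow> g ` halfspace n = halfspace (lmap g n)"
  by (simp add: set_eq_iff isometry_image_eq_vimage) (simp add: halfspace_def lor_isometry_inv)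

lemma isometry_hplane: "hyp_isometry g \<Longrightarrow> g ` hplane n = hplane (lmap g n)"
  by (simp add: set_eq_iff isometry_image_eq_vimage) (simp add: hplane_def lor_isometry_inv)

lemma unit_spacelike_lmap: "hyp_isometry g \<Longrightarrow> unit_spacelike (lmap g n) \<longleftrightarrow> unit_spacelike n"
  by (simp add: unit_spacelike_def lor_lmap)

lemma reflection_involution:
  assumes "unit_spacelike n"
  shows "reflection n (reflection n x) = x"
proof -
  have "vec_of (reflection n (reflection n x)) = vec_of x"
    using assms by (simp add: vec_of_reflection lor_simps) (simp add: unit_spacelike_def)
  then show ?thesis by (simp add: vec_of_inject)
qed

lemma reflection_isometry:
  assumes "unit_spacelike n"
  shows "hyp_isometry (reflection n)"
  unfolding hyp_isometry_def
proof
  show "bij (reflection n)" by (rule involuntory_imp_bij) (rule reflection_involution[OF assms])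
  show "\<forall>x y. dist (reflection n x) (reflection n y) = dist x y"
  proof (intro allI)
    fix x y
    have nn: "lor n n = 1" using assms by (simp add: unit_spacelike_def)
    show "dist (reflection n x) (reflection n y) = dist x y"
      by (simp add: dist_eq_iff_lor vec_of_reflection[OF assms] lor_simps nn
          lor_commute[of n "vec_of y"])
  qed
qed

lemma isometry_reflection:
  assumes "hyp_isometry g" "unit_spacelike n"
  shows "g (reflection n x) = reflection (lmap g n) (g x)"
proof -
  have "vec_of (g (reflection n x)) = vec_of (reflection (lmap g n) (g x))"
    using assms by (simp add: lmap_isometry(2)[OF assms(1)] vec_of_reflection unit_spacelike_lmap
        linear_diff[OF linear_lmap] linear_scale[OF linear_lmap] lor_lmap)
  then show ?thesis by (simp add: vec_of_inject)
qed

text \<open>Subtracting from \<open>w\<close> its component along \<open>n\<close> shows that the functional of \<open>k\<close> is a multiple of that of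
  \<open>n\<close>, and the unit length leaves only the sign open.\<close>

lemma unit_normal_unique:
  assumes n: "unit_spacelike n" "unit_spacelike k" and orth: "\<And>w. lor w n = 0 \<Longrightarrow> lor w k = 0"
  shows "k = n \<or> k = - n"
proof -
  have nn: "lor n n = 1" "lor k k = 1" using n by (auto simp: unit_spacelike_def)
  have *: "lor w k = lor w n * lor n k" for w
  proof -
    have "lor (w - lor w n *\<^sub>R n) n = 0" by (simp only: lor_diff_left lor_scaleR_left nn)
    from orth[OF this] show ?thesis by (simp only: lor_diff_left lor_scaleR_left)
  qed
  have "lor (k - lor n k *\<^sub>R n) w = 0" for w
    using *[of w] by (simp add: lor_diff_left lor_scaleR_left lor_commute[of k w] lor_commute[of n w])
  then have "k - lor n k *\<^sub>R n = 0" by (rule lor_nondegenerate)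
  then have k: "k = lor n k *\<^sub>R n" by simp
  have "lor n k * lor n k = 1" using *[of k] nn by (simp add: lor_commute[of k n])
  then have "lor n k = 1 \<or> lor n k = -1" by (simp add: square_eq_1_iff)
  then show ?thesis using k by auto
qed

text \<open>On the hyperplane itself the two linear extensions agree, so they can differ only in the sign
  of the image of the normal vector.\<close>

lemma isometry_eq_on_hplane:
  assumes g: "hyp_isometry g" "hyp_isometry h" and n: "unit_spacelike n"
    and U: "open U" "p \<in> U" "p \<in> hplane n"
    and eq: "\<And>x. x \<in> U \<inter> hplane n \<Longrightarrow> g x = h x"
  shows "g = h \<or> g = h \<circ> reflection n"
proof -
  have nn: "lor n n = 1" using n by (simp add: unit_spacelike_def)
  note lin = linear_lmap[OF g(1)] linear_lmap[OF g(2)]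
  have on_plane: "lmap g w = lmap h w" if "lor w n = 0" for w
    by (rule linear_eq_on_span[OF lin, OF _ span_of_open_in_hplane[OF U that]])
       (use eq g in \<open>auto simp flip: lmap_isometry(2)\<close>)
  define m where "m = lmap (inv_into UNIV h) (lmap g n)"
  have hm: "lmap h m = lmap g n" by (simp add: m_def lmap_inv g)
  have orth: "lor w m = 0" if "lor w n = 0" for w
    using that on_plane[OF that] hm lor_lmap[OF g(2), of w m] lor_lmap[OF g(1), of w n] by simp
  have "lor m m = 1" using lor_lmap[OF g(2), of m m] lor_lmap[OF g(1), of n n] hm nn by simp
  then have "m = n \<or> m = - n" by (intro unit_normal_unique[OF n _ orth]) (simp_all add: unit_spacelike_def)
  then show ?thesis
  proof
    assume "m = n"
    then have "lmap g n = lmap h n" using hm by simp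
    have "g x = h x" for x
    proof -
      have "lmap g (vec_of x - lor (vec_of x) n *\<^sub>R n) = lmap h (vec_of x - lor (vec_of x) n *\<^sub>R n)"
        by (rule on_plane) (simp add: lor_simps nn)
      then have "lmap g (vec_of x) = lmap h (vec_of x)" using \<open>lmap g n = lmap h n\<close>
        by (simp add: linear_diff[OF lin(1)] linear_diff[OF lin(2)] linear_scale[OF lin(1)] linear_scale[OF lin(2)])
      then show ?thesis using g by (simp flip: lmap_isometry(2) add: vec_of_inject)
    qed
    then show ?thesis by auto
  next
    assume "m = - n"
    then have neg: "lmap g n = - lmap h n" using hm by (simp add: linear_neg[OF lin(2)])
    have "g x = h (reflection n x)" for x
    proof -
      have "lmap g (vec_of x - lor (vec_of x) n *\<^sub>R n) = lmap h (vec_of x - lor (vec_of x) n *\<^sub>R n)"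
        by (rule on_plane) (simp add: lor_simps nn)
      then have "lmap g (vec_of x) = lmap h (vec_of x - (2 * lor (vec_of x) n) *\<^sub>R n)" using neg
        by (simp add: linear_diff[OF lin(1)] linear_diff[OF lin(2)] linear_scale[OF lin(1)] linear_scale[OF lin(2)]
           eq_diff_eq scaleR_2[symmetric] diff_eq_eq)
           (simp add: algebra_simps flip: scaleR_left_distrib)
      then have "vec_of (g x) = vec_of (h (reflection n x))"
        using g by (simp add: lmap_isometry(2) vec_of_reflection n)
      then show ?thesis by (simp add: vec_of_inject)
    qed
    then show ?thesis by auto
  qed
qed

section \<open>Polyhedral cones\<close>

text \<open>Quantified vectors should not be split into their time and space components.\<close>

declare split_paired_All [simp del] split_paired_Ex [simp del]

text \<open>Adjoining \<open>n\<close> and \<open>- n\<close> to the generators lets one statement serve both for cones in the whole space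
  (\<open>n = 0\<close>) and for cones in the orthogonal complement of \<open>n\<close>.\<close>

lemma convex_cone_hull_finite:
  fixes A :: "'a::real_vector set"
  assumes "finite A" "x \<in> convex_cone hull ({n, - n} \<union> A)"
  shows "\<exists>\<beta> c. (\<forall>a\<in>A. 0 \<le> c a) \<and> x = \<beta> *\<^sub>R n + (\<Sum>a\<in>A. c a *\<^sub>R a)"
proof -
  let ?K = "{x. \<exists>\<beta> c. (\<forall>a\<in>A. 0 \<le> c a) \<and> x = \<beta> *\<^sub>R n + (\<Sum>a\<in>A. c a *\<^sub>R a)}"
  have "convex_cone ?K" unfolding convex_cone_iff
  proof (intro conjI allI impI ballI)
    show "0 \<in> ?K" by (auto intro!: exI[of _ "0::real"] exI[of _ "\<lambda>_. 0::real"])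
  next
    fix x y assume "x \<in> ?K" "y \<in> ?K"
    then obtain \<beta> c \<beta>' c' where c: "\<forall>a\<in>A. 0 \<le> c a" "x = \<beta> *\<^sub>R n + (\<Sum>a\<in>A. c a *\<^sub>R a)"
      "\<forall>a\<in>A. 0 \<le> c' a" "y = \<beta>' *\<^sub>R n + (\<Sum>a\<in>A. c' a *\<^sub>R a)" by blast
    have "x + y = (\<beta> + \<beta>') *\<^sub>R n + (\<Sum>a\<in>A. (c a + c' a) *\<^sub>R a)"
      by (simp add: c scaleR_left_distrib sum.distrib)
    moreover have "\<forall>a\<in>A. 0 \<le> c a + c' a" using c by simp
    ultimately show "x + y \<in> ?K"
      unfolding mem_Collect_eq by (intro exI[of _ "\<beta> + \<beta>'"] exI[of _ "\<lambda>a. c a + c' a"] conjI)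
  next
    fix x and r :: real assume "x \<in> ?K" "0 \<le> r"
    then obtain \<beta> c where c: "\<forall>a\<in>A. 0 \<le> c a" "x = \<beta> *\<^sub>R n + (\<Sum>a\<in>A. c a *\<^sub>R a)" by blast
    have "r *\<^sub>R x = (r * \<beta>) *\<^sub>R n + (\<Sum>a\<in>A. (r * c a) *\<^sub>R a)"
      by (simp add: c scaleR_right_distrib scaleR_sum_right)
    moreover have "\<forall>a\<in>A. 0 \<le> r * c a" using c \<open>0 \<le> r\<close> by simp
    ultimately show "r *\<^sub>R x \<in> ?K" unfolding mem_Collect_eq
      by (intro exI[of _ "r * \<beta>"] exI[of _ "\<lambda>a. r * c a"] conjI)
  qed
  moreover have "{n, - n} \<union> A \<subseteq> ?K"
  proof -
    have "n \<in> ?K" by (auto intro!: exI[of _ 1] exI[of _ "\<lambda>_. 0"])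
    moreover have "- n \<in> ?K" by (auto intro!: exI[of _ "-1"] exI[of _ "\<lambda>_. 0"])
    moreover have "b \<in> ?K" if "b \<in> A" for b
    proof -
      have "(\<Sum>a\<in>A. (if a = b then 1 else 0) *\<^sub>R a) = b"
        using \<open>finite A\<close> that by (simp add: if_distrib[of "\<lambda>c. c *\<^sub>R _"] sum.delta' cong: if_cong)
      then show ?thesis by (auto intro!: exI[of _ 0] exI[of _ "\<lambda>a. if a = b then 1 else 0"])
    qed
    ultimately show ?thesis by blast
  qed
  ultimately have "convex_cone hull ({n, - n} \<union> A) \<subseteq> ?K" by (intro hull_minimal)
  then show ?thesis using assms(2) by blast
qed

text \<open>Farkas' lemma inside the hyperplane orthogonal to \<open>n\<close>: a functional that is nonpositive on the cone cut
  out there by \<open>A\<close> is a nonnegative combination of \<open>A\<close> modulo \<open>n\<close>.  Finitely generated cones are closed, so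
  a functional outside the cone can be separated from it.\<close>

lemma farkas_lor:
  assumes "finite A" and dual: "\<And>v. lor v n = 0 \<Longrightarrow> (\<And>a. a \<in> A \<Longrightarrow> lor v a \<le> 0) \<Longrightarrow> lor v b \<le> 0"
  shows "\<exists>\<beta> c. (\<forall>a\<in>A. 0 \<le> c a) \<and> b = \<beta> *\<^sub>R n + (\<Sum>a\<in>A. c a *\<^sub>R a)"
proof -
  let ?K = "convex_cone hull ({n, - n} \<union> A)"
  have "b \<in> ?K"
  proof (rule ccontr)
    assume "b \<notin> ?K"
    moreover have "closed ?K" by (rule closed_convex_cone_hull) (use assms in simp)
    ultimately obtain a c where ac: "a \<bullet> b < c" "\<And>x. x \<in> ?K \<Longrightarrow> a \<bullet> x > c"
      using separating_hyperplane_closed_point[OF convex_convex_cone_hull, of "{n, - n} \<union> A" b] by blast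
    define v where "v = (fst a, - snd a)"
    have v: "lor v x = - (a \<bullet> x)" for x by (simp add: v_def lor_def inner_prod_def)
    have "c < 0" using ac(2)[OF convex_cone_hull_contains_0] by simp
    have pos: "a \<bullet> x \<ge> 0" if "x \<in> ?K" for x
    proof (rule ccontr)
      assume "\<not> a \<bullet> x \<ge> 0"
      then have neg: "a \<bullet> x < 0" by simp
      have "c / (a \<bullet> x) \<ge> 0" using neg \<open>c < 0\<close> by (simp add: divide_nonpos_neg)
      from ac(2)[OF convex_cone_hull_mul[OF that this]] neg show False by simp
    qed
    have in_K: "n \<in> ?K" "- n \<in> ?K" "\<And>y. y \<in> A \<Longrightarrow> y \<in> ?K" by (auto intro: hull_inc)
    have "lor v b \<le> 0"
      by (rule dual) (use pos[OF in_K(1)] pos[OF in_K(2)] pos[OF in_K(3)] in \<open>auto simp: v\<close>)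
    then show False using ac(1) \<open>c < 0\<close> by (simp add: v)
  qed
  then show ?thesis by (rule convex_cone_hull_finite[OF assms(1)])
qed

text \<open>A subset of least cardinality that still describes the cone has no redundant member.  The set \<open>V\<close> is the
  whole space when facets are sought, and the orthogonal complement of a normal when edges of a
  facet are sought.\<close>

lemma irredundant_subset:
  assumes "finite N"
  obtains A where "A \<subseteq> N"
    "\<forall>v\<in>V. (\<forall>n\<in>A. lor v n \<le> 0) \<longrightarrow> (\<forall>n\<in>N. lor v n \<le> 0)"
    "\<forall>h\<in>A. \<exists>v\<in>V. lor v h > 0 \<and> (\<forall>k\<in>A - {h}. lor v k \<le> 0)"
proof -
  let ?Q = "\<lambda>A. A \<subseteq> N \<and> (\<forall>v\<in>V. (\<forall>n\<in>A. lor v n \<le> 0) \<longrightarrow> (\<forall>n\<in>N. lor v n \<le> 0))"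
  have "?Q N" by blast
  from ex_has_least_nat[of ?Q, OF this, of card]
  obtain A where A: "?Q A" "\<And>B. ?Q B \<Longrightarrow> card A \<le> card B" by blast
  have "\<exists>v\<in>V. lor v h > 0 \<and> (\<forall>k\<in>A - {h}. lor v k \<le> 0)" if h: "h \<in> A" for h
  proof -
    have "card (A - {h}) < card A"
      using h A(1) assms by (meson card_Diff1_less finite_subset)
    then have "\<not> ?Q (A - {h})" using A(2)[of "A - {h}"] by linarith
    then obtain v where v: "v \<in> V" "\<forall>n\<in>A - {h}. lor v n \<le> 0" "\<not> (\<forall>n\<in>N. lor v n \<le> 0)" using A(1) by blast
    then have "lor v h > 0" using A(1) h by (metis DiffI not_le singletonD)
    then show ?thesis using v by blast
  qed
  then show ?thesis using A(1) by (intro that[of A]) blast+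
qed

definition dual_cone :: "(real \<times> (real^3)) set \<Rightarrow> (real \<times> (real^3)) set" where
  "dual_cone N = {v. \<forall>n\<in>N. lor v n \<le> 0}"

text \<open>At an interior point one can still move outwards, along the Euclidean gradient of the
  functional of \<open>n\<close>.\<close>

lemma interior_lor_neg:
  assumes "x \<in> interior P" "P \<subseteq> halfspace n" "n \<noteq> 0"
  shows "lor (vec_of x) n < 0"
proof -
  define w where "w = (- fst n, snd n)"
  have "lor w n = n \<bullet> n" by (simp add: w_def lor_def inner_prod_def)
  then have wn: "lor w n > 0" using assms(3) by simp
  obtain e where e: "e > 0" "\<And>t. \<bar>t\<bar> < e \<Longrightarrow> vec_of x + t *\<^sub>R w \<in> timelike \<and> hproj (vec_of x + t *\<^sub>R w) \<in> interior P"
    using hproj_line_in_open[of "interior P" "vec_of x" w] assms(1) by auto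
  then have *: "vec_of x + (e/2) *\<^sub>R w \<in> timelike" "hproj (vec_of x + (e/2) *\<^sub>R w) \<in> halfspace n"
    using e(2)[of "e/2"] e(1) interior_subset[of P] assms(2) by (auto simp: subset_iff)
  then have "lor (vec_of x + (e/2) *\<^sub>R w) n \<le> 0" by (simp add: halfspace_def lor_hproj_nonpos_iff)
  then show ?thesis using wn e(1) by (simp add: lor_simps) (smt (verit) mult_pos_pos divide_pos_pos)
qed

text \<open>If a light-like direction lies strictly inside all half-spaces, then so does a round
  neighbourhood of it.  In graph coordinates the polyhedron then contains the Euclidean balls of radius
  \<open>k \<eta>\<close> around \<open>k v0\<close> for all large \<open>k\<close>, and the volume density there is at least of order \<open>1 / k\<close>,
  so that these balls have volume of order \<open>k\<^sup>2\<close>.\<close>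

lemma infinite_volume_of_null_interior:
  assumes "finite N" and q: "lor q q = 0" "fst q > 0" and neg: "\<And>n. n \<in> N \<Longrightarrow> lor q n < 0"
  shows "hyp_volume (\<Inter>n\<in>N. halfspace n) = \<infinity>"
proof -
  define S where "S = (\<Inter>n\<in>N. halfspace n)"
  define a v0 where "a = fst q" and "v0 = snd q"
  have a: "a = norm v0"
  proof -
    have "(norm v0)\<^sup>2 = a\<^sup>2" using q(1) by (simp add: a_def v0_def lor_def dot_square_norm power2_eq_square)
    then show ?thesis using q(2) by (metis a_def less_imp_le norm_ge_zero power2_eq_iff_nonneg)
  qed
  have "open (\<Inter>n\<in>N. {p. lor p n < 0})"
    by (intro open_INT assms(1) ballI open_Collect_less continuous_intros)
  moreover have "q \<in> (\<Inter>n\<in>N. {p. lor p n < 0})" using neg by blast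
  ultimately obtain \<delta> where \<delta>: "\<delta> > 0" "ball q \<delta> \<subseteq> (\<Inter>n\<in>N. {p. lor p n < 0})" by (rule openE)
  define \<eta> where "\<eta> = \<delta> / 4"
  have \<eta>: "\<eta> > 0" using \<delta> by (simp add: \<eta>_def)
  define M where "M = 1 + norm v0 + \<eta>"
  have M: "M > 0" using \<eta> norm_ge_zero[of v0] unfolding M_def by linarith
  define c where "c = unit_ball_vol 3 * \<eta> ^ 3 / M"
  have c: "c > 0" using \<eta> M by (simp add: c_def unit_ball_vol_pos)
  \<comment> \<open>the contribution of the ball around \<open>k v0\<close>, on which the density is at least \<open>1 / (k M)\<close>\<close>
  have big: "ennreal (c * k\<^sup>2) \<le> hyp_volume S" if k: "k > 2 / \<delta>" "k \<ge> 1" for k :: real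
  proof -
    have k0: "k > 0" using k by simp
    have k1: "1 / k < \<delta> / 2" using k(1) k0 \<delta>(1) by (simp add: field_simps)
    have in_ball: "graph_point v \<in> S \<and> sqrt (1 + v \<bullet> v) \<le> k * M" if v: "v \<in> ball (k *\<^sub>R v0) (k * \<eta>)" for v
    proof -
      define u where "u = (1/k) *\<^sub>R v"
      have vu: "v = k *\<^sub>R u" using k0 by (simp add: u_def)
      have "norm (k *\<^sub>R (v0 - u)) < k * \<eta>" using v by (simp add: dist_norm vu scaleR_diff_right)
      then have u: "norm (v0 - u) < \<eta>" using k0 by simp
      then have nu: "\<bar>norm v0 - norm u\<bar> < \<eta>" using norm_triangle_ineq3[of v0 u] by linarith
      have s1: "norm v \<le> sqrt (1 + v \<bullet> v)" "sqrt (1 + v \<bullet> v) \<le> 1 + norm v"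
        by (auto intro!: real_le_rsqrt real_le_lsqrt simp: power2_norm_eq_inner[symmetric] power2_sum)
      have nv: "norm v = k * norm u" using k0 by (simp add: vu)
      define p where "p = (sqrt (1 + v \<bullet> v) / k, u)"
      have "norm u \<le> fst p" "fst p \<le> norm u + 1 / k"
        using s1 k0 unfolding nv p_def by (simp_all add: field_simps)
      then have "\<bar>a - fst p\<bar> < \<eta> + 1 / k" using nu a k0 by (smt (verit) divide_pos_pos)
      moreover have "dist q p \<le> \<bar>a - fst p\<bar> + norm (v0 - u)"
        using norm_Pair_le[of "a - fst p" "v0 - u"] by (simp add: dist_norm a_def v0_def p_def minus_prod_def)
      ultimately have "p \<in> ball q \<delta>" using u k1 by (simp add: \<eta>_def)
      then have p: "\<And>n. n \<in> N \<Longrightarrow> lor p n < 0" using \<delta>(2) by blast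
      have "vec_of (graph_point v) = k *\<^sub>R p" using k0 by (simp add: p_def vu)
      then have "lor (vec_of (graph_point v)) n \<le> 0" if "n \<in> N" for n
        using p[OF that] k0 by (simp add: lor_scaleR_left mult_le_0_iff)
      then have "graph_point v \<in> S" by (auto simp: S_def halfspace_def)
      moreover have "sqrt (1 + v \<bullet> v) \<le> k * M"
      proof -
        have "1 + norm v \<le> k * 1 + k * (norm v0 + \<eta>)"
          unfolding nv using k k0 nu by (intro add_mono mult_left_mono) auto
        then show ?thesis using s1(2) by (simp add: M_def algebra_simps)
      qed
      ultimately show ?thesis by blast
    qed
    let ?B = "ball (k *\<^sub>R v0) (k * \<eta>)"
    have "ennreal (c * k\<^sup>2) = ennreal (1 / (k * M)) * emeasure lborel ?B"
    proof -
      have "emeasure lborel ?B = ennreal (unit_ball_vol 3 * (k * \<eta>) ^ 3)"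
        using k0 \<eta> by (subst emeasure_ball) auto
      then show ?thesis using k0 M \<eta>
        by (simp add: ennreal_mult[symmetric] c_def field_simps power2_eq_square power3_eq_cube)
    qed
    also have "\<dots> = (\<integral>\<^sup>+v. ennreal (1 / (k * M)) * indicator ?B v \<partial>lborel)"
      by (subst nn_integral_cmult_indicator) auto
    also have "\<dots> \<le> hyp_volume S" unfolding hyp_volume_def
    proof (rule nn_integral_mono)
      fix v
      show "ennreal (1 / (k * M)) * indicator ?B v \<le> ennreal (indicator S (graph_point v) / sqrt (1 + v \<bullet> v))"
      proof (cases "v \<in> ?B")
        case True
        have "sqrt (1 + v \<bullet> v) > 0" by (simp add: add_pos_nonneg)
        then have "1 / (k * M) \<le> 1 / sqrt (1 + v \<bullet> v)"
          using in_ball[OF True] by (intro divide_left_mono) (auto intro!: mult_pos_pos k0 M)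
        then show ?thesis using True in_ball[OF True] by (simp add: ennreal_leI)
      qed simp
    qed
    finally show ?thesis .
  qed
  show ?thesis
  proof (rule ccontr)
    assume "hyp_volume (\<Inter>n\<in>N. halfspace n) \<noteq> \<infinity>"
    then obtain r where r: "hyp_volume S = ennreal r" "r \<ge> 0"
      unfolding S_def by (metis ennreal_cases infinity_ennreal_def)
    define k where "k = max (2 / \<delta> + 1) (1 + r / c)"
    have k: "k > 2 / \<delta>" "k \<ge> 1 + r / c" by (auto simp: k_def)
    have "r / c \<ge> 0" using r c by simp
    then have k1: "k \<ge> 1" using k by linarith
    have "c * k\<^sup>2 \<le> r" using big[OF k(1) k1] r by (simp add: ennreal_le_iff)
    moreover have "c * k \<le> c * k\<^sup>2" using k1 c by (simp add: power2_eq_square)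
    moreover have "c * k \<ge> c * (1 + r / c)" using k c by (intro mult_left_mono) auto
    moreover have "c * (1 + r / c) = c + r" using c by (simp add: field_simps)
    ultimately show False using c by linarith
  qed
qed

text \<open>Otherwise the segment from an interior point to a vector of the cone outside the light
  cone crosses the light cone at a point strictly inside all half-spaces.\<close>

lemma dual_cone_causal:
  assumes N: "finite N" "\<And>n. n \<in> N \<Longrightarrow> n \<noteq> 0" and P: "P = (\<Inter>n\<in>N. halfspace n)"
    and vol: "hyp_volume P < \<infinity>" and x0: "x0 \<in> interior P"
  shows "dual_cone N \<subseteq> causal"
proof
  fix p assume p: "p \<in> dual_cone N"
  have x0n: "lor (vec_of x0) n < 0" if "n \<in> N" for n
    by (rule interior_lor_neg[OF x0 _ N(2)[OF that]]) (use that P in blast)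
  have ne: "N \<noteq> {}"
  proof
    assume "N = {}"
    then show False
      using infinite_volume_of_null_interior[of "{}" "(1, axis 1 1)"] vol
      by (simp add: P lor_def inner_axis_axis)
  qed
  show "p \<in> causal"
  proof (rule ccontr)
    assume "p \<notin> causal"
    define Q where "Q t = (1 - t) *\<^sub>R vec_of x0 + t *\<^sub>R p" for t
    define F where "F t = fst (Q t) - norm (snd (Q t))" for t
    have F: "F 0 > 0" "F 1 < 0"
      using vec_of_timelike[of x0] \<open>p \<notin> causal\<close> by (auto simp: F_def Q_def timelike_def causal_def)
    have "continuous_on {0..1} F" unfolding F_def Q_def by (intro continuous_intros)
    then obtain t where t: "0 \<le> t" "t \<le> 1" "F t = 0"
      using IVT2'[of F 1 0 0] F by (auto simp: less_imp_le)
    have "t < 1" using t F by (metis less_eq_real_def less_irrefl)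
    have neg: "lor (Q t) n < 0" if "n \<in> N" for n
    proof -
      have "(1 - t) * lor (vec_of x0) n < 0" using x0n[OF that] \<open>t < 1\<close> by (simp add: mult_pos_neg)
      moreover have "t * lor p n \<le> 0" using p that t by (auto simp: dual_cone_def mult_nonneg_nonpos)
      ultimately show ?thesis by (simp add: Q_def lor_simps)
    qed
    have null: "fst (Q t) = norm (snd (Q t))" using t by (simp add: F_def)
    then have "lor (Q t) (Q t) = 0" by (simp add: lor_def dot_square_norm power2_eq_square)
    moreover have "fst (Q t) > 0"
    proof (rule ccontr)
      assume "\<not> fst (Q t) > 0"
      then have "norm (snd (Q t)) = 0 \<and> fst (Q t) = 0" using null norm_ge_zero[of "snd (Q t)"] by linarith
      then have "Q t = 0" by (simp add: prod_eq_iff)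
      then show False using neg ne by force
    qed
    ultimately have "hyp_volume P = \<infinity>"
      unfolding P using infinite_volume_of_null_interior[OF N(1) _ _ neg] by blast
    then show False using vol by simp
  qed
qed

text \<open>Three linear conditions on a space of dimension four.\<close>

lemma exists_orthogonal_vector:
  fixes n h x :: "real \<times> (real^3)"
  shows "\<exists>w. lor w n = 0 \<and> lor w h = 0 \<and> (\<forall>c. w \<noteq> c *\<^sub>R x)"
proof -
  define fl where "fl v = (- fst v, snd v)" for v :: "real \<times> (real^3)"
  let ?S = "{fl n, fl h, x}"
  have "dim ?S \<le> card ?S" by (rule dim_le_card[OF span_superset]) simp
  also have "\<dots> \<le> 3" by (simp add: card_insert_if)
  also have "\<dots> < DIM(real \<times> (real^3))" by simp
  finally obtain w where w: "w \<noteq> 0" "\<And>y. y \<in> span ?S \<Longrightarrow> orthogonal w y"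
    using orthogonal_to_subspace_exists by blast
  have o: "w \<bullet> fl n = 0" "w \<bullet> fl h = 0" "w \<bullet> x = 0"
    using w(2) by (auto simp: orthogonal_def span_base)
  have "w \<noteq> c *\<^sub>R x" for c
  proof
    assume "w = c *\<^sub>R x"
    then have "w \<bullet> w = 0" using o(3) by (metis inner_scaleR_right mult_zero_right)
    then show False using w(1) by simp
  qed
  then show ?thesis using o by (intro exI[of _ w]) (simp add: fl_def lor_def inner_prod_def)
qed


section \<open>Outward normals of finite-volume polyhedra\<close>

text \<open>The half-spaces of an ideal polyhedron.  Finite volume enters only through the inclusion of the cone
  over the polyhedron in the light cone; the last clause excludes redundant normals.\<close>

definition polyhedral_normals :: "hyp3 set \<Rightarrow> (real \<times> (real^3)) set \<Rightarrow> bool" where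
  "polyhedral_normals P N \<longleftrightarrow>
     finite N \<and> (\<forall>n\<in>N. unit_spacelike n) \<and> P = (\<Inter>n\<in>N. halfspace n) \<and> interior P \<noteq> {} \<and>
     dual_cone N \<subseteq> causal \<and> (\<forall>h\<in>N. \<exists>x\<in>hplane h. \<forall>k\<in>N - {h}. lor (vec_of x) k < 0)"

lemma polyhedral_normalsD:
  assumes "polyhedral_normals P N"
  shows "finite N" "n \<in> N \<Longrightarrow> unit_spacelike n" "interior P \<noteq> {}" "dual_cone N \<subseteq> causal"
    "x \<in> P \<longleftrightarrow> (\<forall>n\<in>N. lor (vec_of x) n \<le> 0)"
    "n \<in> N \<Longrightarrow> P \<subseteq> halfspace n"
    "n \<in> N \<Longrightarrow> \<exists>x\<in>hplane n. \<forall>k\<in>N - {n}. lor (vec_of x) k < 0"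
proof -
  show "x \<in> P \<longleftrightarrow> (\<forall>n\<in>N. lor (vec_of x) n \<le> 0)"
    using assms by (auto simp: polyhedral_normals_def halfspace_def)
qed (use assms in \<open>unfold polyhedral_normals_def, blast+\<close>)

lemma small_line_lor_neg:
  assumes "finite A" "\<And>k. k \<in> A \<Longrightarrow> lor x k < 0"
  obtains e where "e > 0" "\<And>t k. \<bar>t\<bar> < e \<Longrightarrow> k \<in> A \<Longrightarrow> lor (x + t *\<^sub>R w) k < 0"
proof -
  have "open (\<Inter>k\<in>A. {t. lor (x + t *\<^sub>R w) k < 0})"
    by (intro open_INT assms(1) ballI open_Collect_less continuous_intros)
  moreover have "0 \<in> (\<Inter>k\<in>A. {t. lor (x + t *\<^sub>R w) k < 0})" using assms(2) by simp
  ultimately obtain e where "e > 0" "ball 0 e \<subseteq> (\<Inter>k\<in>A. {t. lor (x + t *\<^sub>R w) k < 0})" by (rule openE)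
  then show ?thesis by (intro that[of e]) (auto simp: subset_eq dist_norm)
qed

text \<open>Irredundancy of \<open>h\<close> provides a vector \<open>v\<close> that violates only \<open>h\<close>.  On the way from the interior
  point \<open>x0\<close> to \<open>v\<close> one leaves the cone through the facet of \<open>h\<close> and no other, at a point where the facet is
  locally a full neighbourhood in its hyperplane; inside the light cone such a point is time-like.
  The assumption on dimensions says that the facet is at least two-dimensional, so that lines through
  the point exist.\<close>

lemma timelike_facet_point:
  assumes V: "subspace V" and dims: "\<And>x. \<exists>w\<in>V. lor w h = 0 \<and> (\<forall>c. w \<noteq> c *\<^sub>R x)"
    and A: "finite A" "h \<in> A" and causal: "V \<inter> dual_cone A \<subseteq> causal"
    and x0: "x0 \<in> V" "\<And>k. k \<in> A \<Longrightarrow> lor x0 k < 0"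
    and v: "v \<in> V" "lor v h > 0" "\<And>k. k \<in> A - {h} \<Longrightarrow> lor v k \<le> 0"
  obtains x where "x \<in> V" "x \<in> timelike" "lor x h = 0" "\<forall>k\<in>A - {h}. lor x k < 0"
proof -
  have x0h: "lor x0 h < 0" using x0 A by blast
  define x where "x = lor v h *\<^sub>R x0 + (- lor x0 h) *\<^sub>R v"
  have xV: "x \<in> V" unfolding x_def using V x0 v by (intro subspace_add subspace_scale)
  have xh: "lor x h = 0" by (simp only: x_def lor_simps) simp
  have xk: "lor x k < 0" if k: "k \<in> A - {h}" for k
  proof -
    have "lor v h * lor x0 k < 0" using x0(2) v(2) k by (simp add: mult_pos_neg)
    moreover have "- lor x0 h * lor v k \<le> 0" using x0h v(3)[OF k] by (simp add: mult_nonneg_nonpos mult_nonpos_nonpos)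
    ultimately show ?thesis by (simp only: x_def lor_simps)
  qed
  obtain w where w: "w \<in> V" "lor w h = 0" "\<And>c. w \<noteq> c *\<^sub>R x" using dims by blast
  obtain e where e: "e > 0" "\<And>t k. \<bar>t\<bar> < e \<Longrightarrow> k \<in> A - {h} \<Longrightarrow> lor (x + t *\<^sub>R w) k < 0"
    by (rule small_line_lor_neg[of "A - {h}" x w]) (use A(1) xk in auto)
  have line: "x + t *\<^sub>R w \<in> causal" if "\<bar>t\<bar> < e" for t
  proof -
    have "lor (x + t *\<^sub>R w) k \<le> 0" if "k \<in> A" for k
    proof (cases "k = h")
      case True
      then show ?thesis using xh w by (simp add: lor_simps)
    next
      case False
      then show ?thesis using e(2)[OF \<open>\<bar>t\<bar> < e\<close>, of k] that by auto
    qed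
    then have "x + t *\<^sub>R w \<in> dual_cone A" by (simp add: dual_cone_def)
    moreover have "x + t *\<^sub>R w \<in> V" using V xV w(1) by (intro subspace_add subspace_scale)
    ultimately show ?thesis using causal by blast
  qed
  have "x \<noteq> 0"
  proof
    assume x: "x = 0"
    have "w \<noteq> 0" using w(3)[of 0] by simp
    have "fst ((e/2) *\<^sub>R w) \<ge> norm (snd ((e/2) *\<^sub>R w))" "fst ((- (e/2)) *\<^sub>R w) \<ge> norm (snd ((- (e/2)) *\<^sub>R w))"
      using line[of "e/2"] line[of "- (e/2)"] e(1) by (auto simp: x causal_def)
    then have "e * norm (snd w) \<le> e * fst w" "e * norm (snd w) \<le> e * (- fst w)" using e(1) by simp_all
    then have "norm (snd w) \<le> fst w" "norm (snd w) \<le> - fst w"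
      using e(1) by (simp_all only: mult_le_cancel_left_pos)
    then have "norm (snd w) = 0 \<and> fst w = 0" using norm_ge_zero[of "snd w"] by linarith
    then show False using \<open>w \<noteq> 0\<close> by (simp add: prod_eq_iff)
  qed
  have "x \<in> timelike" by (rule causal_line_imp_timelike[OF e(1) line \<open>x \<noteq> 0\<close> w(3)])
  then show ?thesis using that[of x] xV xh xk by simp
qed

lemma ideal_polyhedron_normals:
  assumes "ideal_polyhedron P"
  obtains N where "polyhedral_normals P N"
proof -
  obtain M where M: "finite M" "\<And>n. n \<in> M \<Longrightarrow> unit_spacelike n" "P = (\<Inter>n\<in>M. halfspace n)"
    and int: "interior P \<noteq> {}" and vol: "hyp_volume P < \<infinity>"
    using assms unfolding ideal_polyhedron_def convex_polyhedron_def by blast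
  obtain N where N: "N \<subseteq> M"
    "\<forall>v\<in>UNIV. (\<forall>n\<in>N. lor v n \<le> 0) \<longrightarrow> (\<forall>n\<in>M. lor v n \<le> 0)"
    "\<forall>h\<in>N. \<exists>v\<in>UNIV. lor v h > 0 \<and> (\<forall>k\<in>N - {h}. lor v k \<le> 0)"
    using irredundant_subset[OF M(1)] .
  have fin: "finite N" using N(1) M(1) finite_subset by blast
  have unit: "unit_spacelike n" if "n \<in> N" for n using that N(1) M(2) by blast
  have P: "P = (\<Inter>n\<in>N. halfspace n)"
  proof
    show "P \<subseteq> (\<Inter>n\<in>N. halfspace n)" using N(1) M(3) by blast
    show "(\<Inter>n\<in>N. halfspace n) \<subseteq> P"
    proof
      fix x assume "x \<in> (\<Inter>n\<in>N. halfspace n)"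
      then have "\<forall>n\<in>N. lor (vec_of x) n \<le> 0" by (simp add: halfspace_def)
      then have "\<forall>n\<in>M. lor (vec_of x) n \<le> 0" using N(2) by simp
      then show "x \<in> P" by (simp add: M(3) halfspace_def)
    qed
  qed
  obtain x0 where x0: "x0 \<in> interior P" using int by blast
  have causal: "dual_cone N \<subseteq> causal"
    by (rule dual_cone_causal[OF fin _ P vol x0]) (rule unit_spacelike_nonzero[OF unit])
  have x0n: "lor (vec_of x0) n < 0" if "n \<in> N" for n
    by (rule interior_lor_neg[OF x0 _ unit_spacelike_nonzero[OF unit[OF that]]]) (use that P in blast)
  have "\<exists>x\<in>hplane h. \<forall>k\<in>N - {h}. lor (vec_of x) k < 0" if h: "h \<in> N" for h
  proof -
    obtain v where v: "lor v h > 0" "\<And>k. k \<in> N - {h} \<Longrightarrow> lor v k \<le> 0" using N(3) h by blast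
    have dims: "\<exists>w\<in>UNIV. lor w h = 0 \<and> (\<forall>c. w \<noteq> c *\<^sub>R x)" for x
      using exists_orthogonal_vector[of h h x] by simp
    have "UNIV \<inter> dual_cone N \<subseteq> causal" using causal by simp
    from timelike_facet_point[OF subspace_UNIV dims fin h this UNIV_I x0n UNIV_I v]
    obtain x where x: "x \<in> timelike" "lor x h = 0" "\<forall>k\<in>N - {h}. lor x k < 0" by blast
    then have "hproj x \<in> hplane h" "\<forall>k\<in>N - {h}. lor (vec_of (hproj x)) k < 0"
      by (simp_all add: hplane_def lor_hproj_nonpos_iff)
    then show ?thesis by blast
  qed
  then have "polyhedral_normals P N"
    unfolding polyhedral_normals_def using fin unit P int causal by blast
  then show ?thesis by (rule that)
qed

lemma hplane_piece_unique:
  assumes n: "unit_spacelike n" "unit_spacelike k"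
    and U: "open U" "x \<in> U" "x \<in> hplane n" "U \<inter> hplane n \<subseteq> hplane k"
  shows "k = n \<or> k = - n"
proof (rule unit_normal_unique[OF n])
  have lin: "linear (\<lambda>w. lor w k)" by (rule linearI) (simp_all add: lor_simps)
  fix w assume w: "lor w n = 0"
  show "lor w k = 0"
    by (rule linear_eq_on_span[OF lin linear_zero _ span_of_open_in_hplane[OF U(1-3) w]])
       (use U(4) in \<open>auto simp: hplane_def\<close>)
qed

lemma hplane_piece_unique_halfspace:
  assumes n: "unit_spacelike n" "unit_spacelike k"
    and U: "open U" "x \<in> U" "x \<in> hplane n" "U \<inter> hplane n \<subseteq> hplane k"
    and P: "interior P \<noteq> {}" "P \<subseteq> halfspace n" "P \<subseteq> halfspace k"
  shows "k = n"
proof -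
  obtain y where y: "y \<in> interior P" using P by blast
  have "lor (vec_of y) n < 0" "lor (vec_of y) k < 0"
    using interior_lor_neg[OF y] P n unit_spacelike_nonzero by blast+
  then have "k \<noteq> - n" by auto
  then show ?thesis using hplane_piece_unique[OF n U] by blast
qed

text \<open>A vector of the cone over the polyhedron need not be time-like, but becomes so after adding a small
  multiple of a point of the polyhedron.\<close>

lemma halfspace_imp_dual_cone:
  assumes PN: "polyhedral_normals P N" and m: "P \<subseteq> halfspace m" and v: "v \<in> dual_cone N"
  shows "lor v m \<le> 0"
proof -
  obtain x0 where x0: "x0 \<in> P" using polyhedral_normalsD(3)[OF PN] interior_subset by blast
  have "lor v m + t * lor (vec_of x0) m \<le> 0" if t: "t > 0" for t
  proof -
    let ?p = "t *\<^sub>R vec_of x0 + v"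
    have p: "?p \<in> timelike"
      by (intro timelike_add_causal timelike_scale vec_of_timelike t)
         (use polyhedral_normalsD(4)[OF PN] v in blast)
    have "lor ?p n \<le> 0" if "n \<in> N" for n
    proof -
      have "lor (vec_of x0) n \<le> 0" using x0 that by (simp add: polyhedral_normalsD(5)[OF PN])
      then have "t * lor (vec_of x0) n \<le> 0" using t by (simp add: mult_nonneg_nonpos)
      moreover have "lor v n \<le> 0" using v that by (simp add: dual_cone_def)
      ultimately show ?thesis by (simp add: lor_simps)
    qed
    then have "hproj ?p \<in> P" using p by (simp add: polyhedral_normalsD(5)[OF PN] lor_hproj_nonpos_iff)
    then have "lor ?p m \<le> 0" using m p by (auto simp: halfspace_def lor_hproj_nonpos_iff)
    then show ?thesis by (simp add: lor_simps)
  qed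
  note * = this
  show ?thesis
  proof (rule ccontr)
    assume "\<not> lor v m \<le> 0"
    then have pos: "lor v m > 0" by simp
    define t where "t = lor v m / (1 + \<bar>lor (vec_of x0) m\<bar>)"
    have d: "1 + \<bar>lor (vec_of x0) m\<bar> > 0" by linarith
    have t: "t > 0" using pos d by (simp add: t_def)
    have "t * (1 + \<bar>lor (vec_of x0) m\<bar>) = lor v m" using d by (simp add: t_def)
    then have "lor v m = t + t * \<bar>lor (vec_of x0) m\<bar>" by (simp add: algebra_simps)
    moreover have "- (t * lor (vec_of x0) m) \<le> t * \<bar>lor (vec_of x0) m\<bar>"
      using t by (metis abs_ge_minus_self mult_le_cancel_left_pos mult_minus_right)
    ultimately show False using *[OF t] t by linarith
  qed
qed

lemma normal_facet:
  assumes PN: "polyhedral_normals P N" and h: "h \<in> N"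
  obtains U x where "open U" "x \<in> U" "x \<in> hplane h" "U \<inter> hplane h \<subseteq> P"
    "\<And>y k. y \<in> U \<Longrightarrow> k \<in> N - {h} \<Longrightarrow> lor (vec_of y) k < 0"
proof -
  obtain x where x: "x \<in> hplane h" "\<And>k. k \<in> N - {h} \<Longrightarrow> lor (vec_of x) k < 0"
    using polyhedral_normalsD(7)[OF PN h] by blast
  let ?U = "\<Inter>k\<in>N - {h}. {y. lor (vec_of y) k < 0}"
  have "open ?U" using PN by (intro open_INT ballI open_hyp3_lor_less) (simp add: polyhedral_normalsD(1)[OF PN])
  moreover have "?U \<inter> hplane h \<subseteq> P"
  proof
    fix y assume y: "y \<in> ?U \<inter> hplane h"
    have "lor (vec_of y) n \<le> 0" if "n \<in> N" for n
      using y that by (cases "n = h") (force simp: hplane_def)+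
    then show "y \<in> P" by (simp add: polyhedral_normalsD(5)[OF PN])
  qed
  ultimately show ?thesis using x by (intro that[of ?U x]) auto
qed

lemma faceE:
  assumes "f \<in> faces P"
  obtains m U x where "outward_normal P f m" "open U" "x \<in> U" "x \<in> hplane m" "U \<inter> hplane m \<subseteq> f"
proof -
  obtain m x where m: "outward_normal P f m" "x \<in> top_of_set (hplane m) interior_of f"
    using assms unfolding faces_def by blast
  then obtain T where T: "openin (top_of_set (hplane m)) T" "T \<subseteq> f" "x \<in> T"
    unfolding interior_of_def by blast
  then obtain U where "open U" "T = hplane m \<inter> U" unfolding openin_open by blast
  then show ?thesis using m T by (intro that[of m U x]) auto
qed

lemma faceI:
  assumes "outward_normal P f m" "open U" "x \<in> U" "x \<in> hplane m" "U \<inter> hplane m \<subseteq> f"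
  shows "f \<in> faces P"
proof -
  have "openin (top_of_set (hplane m)) (hplane m \<inter> U)" using assms(2) by (rule openin_open_Int)
  then have "x \<in> top_of_set (hplane m) interior_of f"
    unfolding interior_of_def using assms by blast
  then show ?thesis using assms(1) unfolding faces_def by blast
qed

lemma face_normal_eqI:
  assumes "interior P \<noteq> {}" "outward_normal P f m" "open U" "x \<in> U" "x \<in> hplane m" "U \<inter> hplane m \<subseteq> f"
  shows "face_normal P f = m"
  unfolding face_normal_def
proof (rule the_equality)
  show "outward_normal P f m" by fact
  fix k assume "outward_normal P f k"
  then show "k = m" using assms
    by (intro hplane_piece_unique_halfspace[of m k U x P]) (auto simp: outward_normal_def)
qed

lemma normal_face:
  assumes PN: "polyhedral_normals P N" and h: "h \<in> N"
  shows "P \<inter> hplane h \<in> faces P" "face_normal P (P \<inter> hplane h) = h"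
proof -
  have "outward_normal P (P \<inter> hplane h) h"
    using polyhedral_normalsD(2,6)[OF PN h] by (simp add: outward_normal_def)
  moreover obtain U x where "open U" "x \<in> U" "x \<in> hplane h" "U \<inter> hplane h \<subseteq> P"
    using normal_facet[OF PN h] by metis
  moreover have "interior P \<noteq> {}" by (rule polyhedral_normalsD(3)[OF PN])
  ultimately show "P \<inter> hplane h \<in> faces P" "face_normal P (P \<inter> hplane h) = h"
    using faceI[of P "P \<inter> hplane h" h U x] face_normal_eqI[of P "P \<inter> hplane h" h U x] by blast+
qed

text \<open>By Farkas' lemma the outward normal \<open>m\<close> of a face is a nonnegative combination of the irredundant normals.
  Every normal that occurs in it vanishes on the face, and since the face is an open piece of
  its hyperplane, such a normal equals \<open>m\<close>.\<close>

lemma face_has_normal: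
  assumes PN: "polyhedral_normals P N" and f: "f \<in> faces P"
  obtains h where "h \<in> N" "f = P \<inter> hplane h" "face_normal P f = h"
proof -
  obtain m U x where m: "outward_normal P f m" and U: "open U" "x \<in> U" "x \<in> hplane m" "U \<inter> hplane m \<subseteq> f"
    using faceE[OF f] .
  have um: "unit_spacelike m" and Pm: "P \<subseteq> halfspace m" and fm: "f = P \<inter> hplane m"
    using m by (auto simp: outward_normal_def)
  have fin: "finite N" by (rule polyhedral_normalsD(1)[OF PN])
  have "\<exists>\<beta> c. (\<forall>a\<in>N. 0 \<le> c a) \<and> m = \<beta> *\<^sub>R 0 + (\<Sum>a\<in>N. c a *\<^sub>R a)"
  proof (rule farkas_lor[OF fin])
    fix v assume "\<And>a. a \<in> N \<Longrightarrow> lor v a \<le> 0"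
    then show "lor v m \<le> 0" by (intro halfspace_imp_dual_cone[OF PN Pm]) (simp add: dual_cone_def)
  qed
  then obtain \<beta> c where c: "\<And>a. a \<in> N \<Longrightarrow> 0 \<le> c a" "m = \<beta> *\<^sub>R 0 + (\<Sum>a\<in>N. c a *\<^sub>R a)" by blast
  have "\<exists>k\<in>N. c k \<noteq> 0"
  proof (rule ccontr)
    assume "\<not> (\<exists>k\<in>N. c k \<noteq> 0)"
    then have "m = 0" using c(2) by simp
    then show False using um unit_spacelike_nonzero by blast
  qed
  then obtain k where k: "k \<in> N" "c k > 0" using c(1) by (metis less_eq_real_def)
  have "f \<subseteq> hplane k"
  proof
    fix y assume y: "y \<in> f"
    have "0 = lor (vec_of y) m" using y fm by (simp add: hplane_def)
    also have "\<dots> = (\<Sum>a\<in>N. c a * lor (vec_of y) a)"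
      by (subst c(2)) (simp add: lor_sum_right lor_simps)
    finally have sum0: "(\<Sum>a\<in>N. - (c a * lor (vec_of y) a)) = 0" by (simp add: sum_negf)
    have "\<forall>a\<in>N. - (c a * lor (vec_of y) a) = 0"
    proof (subst sum_nonneg_eq_0_iff[OF fin, symmetric])
      fix a assume a: "a \<in> N"
      then have "lor (vec_of y) a \<le> 0" using y fm by (simp add: polyhedral_normalsD(5)[OF PN])
      then show "0 \<le> - (c a * lor (vec_of y) a)" using c(1)[OF a] by (simp add: mult_nonneg_nonpos)
    qed (rule sum0)
    then show "y \<in> hplane k" using k by (auto simp: hplane_def)
  qed
  moreover have "unit_spacelike k" "P \<subseteq> halfspace k" "interior P \<noteq> {}"
    using polyhedral_normalsD(2,3,6)[OF PN] k(1) by blast+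
  ultimately have "k = m" using U um Pm by (intro hplane_piece_unique_halfspace[of m k U x P]) auto
  then show ?thesis using that[of m] k fm normal_face(2)[OF PN, of m] by simp
qed

section \<open>The Gram matrix of a right-angled polyhedron\<close>

lemma adjacent_lor_le_1:
  assumes n: "unit_spacelike n" "unit_spacelike m" and x: "x \<in> hplane n" "x \<in> hplane m"
  shows "\<bar>lor n m\<bar> \<le> 1"
proof -
  have "(lor n m)\<^sup>2 \<le> lor n n * lor m m"
    using x by (intro lor_orthogonal_Cauchy_Schwarz[of _ x]) (auto simp: hplane_def lor_commute)
  then show ?thesis using n by (simp add: unit_spacelike_def abs_square_le_1)
qed

lemma right_angled_adjacent:
  assumes PN: "polyhedral_normals P N" and ra: "right_angled P" and n: "n \<in> N" "m \<in> N" "n \<noteq> m"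
    and xy: "x \<in> P \<inter> hplane n \<inter> hplane m" "y \<in> P \<inter> hplane n \<inter> hplane m" "x \<noteq> y"
  shows "lor n m = 0"
proof -
  have u: "unit_spacelike n" "unit_spacelike m" using polyhedral_normalsD(2)[OF PN] n by blast+
  have "P \<inter> hplane n \<noteq> P \<inter> hplane m" using n normal_face(2)[OF PN] by metis
  then have "adjacent_faces (P \<inter> hplane n) (P \<inter> hplane m)"
    unfolding adjacent_faces_def using xy by blast
  then have "dihedral_angle P (P \<inter> hplane n) (P \<inter> hplane m) = pi / 2"
    using ra normal_face(1)[OF PN] n unfolding right_angled_def by blast
  then have "arccos (lor n m) = pi / 2"
    using normal_face(2)[OF PN] n by (simp add: dihedral_angle_def)
  moreover have "\<bar>lor n m\<bar> \<le> 1" using adjacent_lor_le_1[OF u] xy by blast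
  ultimately have "lor n m = cos (pi / 2)" by (metis abs_le_iff cos_arccos minus_le_iff)
  then show ?thesis by simp
qed

text \<open>The face of \<open>f\<close> is a polygon, and its irredundant sides \<open>A\<close> are honest edges: each contains a time-like
  point, hence two points of hyperbolic space, so it is shared with an adjacent face and
  that face is perpendicular to \<open>f\<close>.  All other normals are nonpositive on the polygon, and Farkas' lemma
  expresses them by \<open>f\<close> and the normals in \<open>A\<close>.\<close>

lemma normal_in_adjacent_cone:
  assumes PN: "polyhedral_normals P N" and ra: "right_angled P" and f: "f \<in> N"
  obtains A where "A \<subseteq> N - {f}" "\<forall>h\<in>A. lor f h = 0"
    "\<forall>g\<in>N - {f}. \<exists>\<beta> c. (\<forall>a\<in>A. 0 \<le> c a) \<and> g = \<beta> *\<^sub>R f + (\<Sum>a\<in>A. c a *\<^sub>R a)"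
proof -
  define V where "V = {v. lor v f = 0}"
  have V: "subspace V" unfolding V_def subspace_def by (simp add: lor_simps)
  have fin: "finite N" and causal: "dual_cone N \<subseteq> causal" using polyhedral_normalsD(1,4)[OF PN] by auto
  obtain A where A: "A \<subseteq> N - {f}"
    "\<forall>v\<in>V. (\<forall>n\<in>A. lor v n \<le> 0) \<longrightarrow> (\<forall>n\<in>N - {f}. lor v n \<le> 0)"
    "\<forall>h\<in>A. \<exists>v\<in>V. lor v h > 0 \<and> (\<forall>k\<in>A - {h}. lor v k \<le> 0)"
    using irredundant_subset[of "N - {f}" V] fin by blast
  have finA: "finite A" using A(1) fin finite_subset by blast
  have V_cone: "v \<in> dual_cone N" if "v \<in> V" "v \<in> dual_cone A" for v
    unfolding dual_cone_def
  proof (intro CollectI ballI)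
    fix n assume "n \<in> N"
    then show "lor v n \<le> 0" using that A(2) by (cases "n = f") (auto simp: V_def dual_cone_def)
  qed
  obtain x0 where x0: "x0 \<in> hplane f" "\<And>k. k \<in> N - {f} \<Longrightarrow> lor (vec_of x0) k < 0"
    using polyhedral_normalsD(7)[OF PN f] by blast
  have adj: "lor f h = 0" if h: "h \<in> A" for h
  proof -
    obtain v where v: "v \<in> V" "lor v h > 0" "\<And>k. k \<in> A - {h} \<Longrightarrow> lor v k \<le> 0" using A(3) h by blast
    have dims: "\<exists>w\<in>V. lor w h = 0 \<and> (\<forall>c. w \<noteq> c *\<^sub>R x)" for x
      using exists_orthogonal_vector[of f h x] by (simp add: V_def)
    have VA: "V \<inter> dual_cone A \<subseteq> causal" using V_cone causal by blast
    have x0V: "vec_of x0 \<in> V" using x0 by (simp add: V_def hplane_def)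
    have x0A: "lor (vec_of x0) k < 0" if "k \<in> A" for k using x0 A(1) that by blast
    from timelike_facet_point[OF V dims finA h VA x0V x0A v]
    obtain x where x: "x \<in> V" "x \<in> timelike" "lor x h = 0" "\<forall>k\<in>A - {h}. lor x k < 0" by blast
    \<comment> \<open>a second point of the edge, by moving along it\<close>
    obtain w where w: "w \<in> V" "lor w h = 0" "\<And>c. w \<noteq> c *\<^sub>R x" using dims by blast
    obtain e1 where e1: "e1 > 0" "\<And>t k. \<bar>t\<bar> < e1 \<Longrightarrow> k \<in> A - {h} \<Longrightarrow> lor (x + t *\<^sub>R w) k < 0"
      by (rule small_line_lor_neg[of "A - {h}" x w]) (use finA x(4) in auto)
    obtain e2 where e2: "e2 > 0" "\<And>t. \<bar>t\<bar> < e2 \<Longrightarrow> x + t *\<^sub>R w \<in> timelike"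
      using hproj_line_in_open[of UNIV x w] x(2) by auto
    define t where "t = min e1 e2 / 2"
    have t: "t > 0" "\<bar>t\<bar> < e1" "\<bar>t\<bar> < e2" using e1(1) e2(1) by (auto simp: t_def)
    define y where "y = x + t *\<^sub>R w"
    have y: "y \<in> V" "y \<in> timelike" "lor y h = 0" "\<forall>k\<in>A - {h}. lor y k < 0"
      using V x w e1(2)[OF t(2)] e2(2)[OF t(3)] by (auto simp: y_def subspace_add subspace_scale lor_simps)
    have in_P: "hproj z \<in> P \<inter> hplane f \<inter> hplane h"
      if z: "z \<in> V" "z \<in> timelike" "lor z h = 0" "\<forall>k\<in>A - {h}. lor z k < 0" for z
    proof -
      have "lor z k \<le> 0" if "k \<in> A" for k using z(3,4) that by (cases "k = h") (auto simp: less_imp_le)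
      then have "z \<in> dual_cone N" using V_cone[OF z(1)] by (simp add: dual_cone_def)
      then show ?thesis using z
        by (simp add: polyhedral_normalsD(5)[OF PN] dual_cone_def hplane_def V_def lor_hproj_nonpos_iff)
    qed
    have "hproj x \<noteq> hproj y"
    proof
      assume eq: "hproj x = hproj y"
      obtain c1 where c1: "c1 > 0" "vec_of (hproj x) = c1 *\<^sub>R x" using vec_of_hproj_pos[OF x(2)] .
      obtain c2 where c2: "c2 > 0" "vec_of (hproj y) = c2 *\<^sub>R y" using vec_of_hproj_pos[OF y(2)] .
      have "c1 *\<^sub>R x = c2 *\<^sub>R x + (c2 * t) *\<^sub>R w" using eq c1 c2 by (simp add: y_def scaleR_right_distrib)
      then have "(c2 * t) *\<^sub>R w = (c1 - c2) *\<^sub>R x" by (simp add: scaleR_left_diff_distrib)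
      then have "(1 / (c2 * t)) *\<^sub>R (c2 * t) *\<^sub>R w = (1 / (c2 * t)) *\<^sub>R (c1 - c2) *\<^sub>R x" by (rule arg_cong)
      then have "w = ((c1 - c2) / (c2 * t)) *\<^sub>R x" using c2(1) t(1) by simp
      then show False using w(3) by blast
    qed
    then show ?thesis
      using right_angled_adjacent[OF PN ra f _ _ in_P[OF x] in_P[OF y]] h A(1) by blast
  qed
  have "\<exists>\<beta> c. (\<forall>a\<in>A. 0 \<le> c a) \<and> g = \<beta> *\<^sub>R f + (\<Sum>a\<in>A. c a *\<^sub>R a)" if g: "g \<in> N - {f}" for g
  proof -
    have "lor v g \<le> 0" if "lor v f = 0" "\<And>a. a \<in> A \<Longrightarrow> lor v a \<le> 0" for v
      using A(2) that g by (simp add: V_def)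
    then show ?thesis by (rule farkas_lor[OF finA])
  qed
  then show ?thesis using A(1) adj by (intro that[of A]) auto
qed

text \<open>Write \<open>g = \<beta> f + \<Sum> c a \<sqdot> a\<close> over the edges \<open>a\<close> of the face of \<open>f\<close>, all orthogonal to \<open>f\<close>; then
  \<open>\<beta> = lor f g\<close>.  A positive product is impossible, because then all coefficients are nonnegative, and at a point of the facet of \<open>g\<close>
  strictly inside the other half-spaces the left side vanishes while the right side is negative.  So all products
  of distinct normals are at most \<open>0\<close>.  Pairing the equation with \<open>g\<close> yields \<open>1 - \<beta>\<^sup>2 = \<Sum> c a \<sqdot> lor g a\<close>.
  Either \<open>g\<close> is itself one of the edges and \<open>\<beta> = 0\<close>, or the right side is nonpositive and
  \<open>\<beta> \<le> -1\<close>.\<close>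

lemma right_angled_gram:
  assumes PN: "polyhedral_normals P N" and ra: "right_angled P" and fg: "f \<in> N" "g \<in> N" "f \<noteq> g"
  shows "lor f g = 0 \<or> lor f g \<le> -1"
proof -
  have unit: "unit_spacelike n" "lor n n = 1" if "n \<in> N" for n
    using polyhedral_normalsD(2)[OF PN that] by (auto simp: unit_spacelike_def)
  have facet: "\<exists>x. x \<in> hplane n \<and> (\<forall>k\<in>N - {n}. lor (vec_of x) k < 0)" if "n \<in> N" for n
    using polyhedral_normalsD(7)[OF PN that] by blast
  \<comment> \<open>at a point of the facet of \<open>m\<close> off the facet of \<open>n\<close> the expansion of \<open>m\<close> would be negative\<close>
  have not_pos: "\<not> lor n m > 0" if nm: "n \<in> N" "m \<in> N" "n \<noteq> m" for n m
  proof
    assume pos: "lor n m > 0"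
    obtain A where A: "A \<subseteq> N - {n}" "\<forall>h\<in>A. lor n h = 0"
      "\<forall>g\<in>N - {n}. \<exists>\<beta> c. (\<forall>a\<in>A. 0 \<le> c a) \<and> g = \<beta> *\<^sub>R n + (\<Sum>a\<in>A. c a *\<^sub>R a)"
      using normal_in_adjacent_cone[OF PN ra nm(1)] .
    obtain \<beta> c where c: "\<And>a. a \<in> A \<Longrightarrow> 0 \<le> c a" "m = \<beta> *\<^sub>R n + (\<Sum>a\<in>A. c a *\<^sub>R a)" using A(3) nm by blast
    have "lor n m = \<beta>"
      by (subst c(2)) (simp add: lor_simps lor_sum_right A(2) unit(2)[OF nm(1)])
    then have "\<beta> > 0" using pos by simp
    obtain x where x: "x \<in> hplane m" "\<And>k. k \<in> N - {m} \<Longrightarrow> lor (vec_of x) k < 0" using facet[OF nm(2)] by blast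
    have xk: "lor (vec_of x) k \<le> 0" if "k \<in> N" for k
      using x that by (cases "k = m") (auto simp: hplane_def less_imp_le)
    have "0 = lor (vec_of x) m" using x by (simp add: hplane_def)
    also have "\<dots> = \<beta> * lor (vec_of x) n + (\<Sum>a\<in>A. c a * lor (vec_of x) a)"
      by (subst c(2)) (simp add: lor_simps lor_sum_right)
    also have "(\<Sum>a\<in>A. c a * lor (vec_of x) a) \<le> 0"
      using A(1) by (intro sum_nonpos mult_nonneg_nonpos c(1) xk) auto
    also have "\<beta> * lor (vec_of x) n < 0" using \<open>\<beta> > 0\<close> x(2)[of n] nm by (simp add: mult_pos_neg)
    finally show False by simp
  qed
  show ?thesis
  proof (rule ccontr)
    assume "\<not> ?thesis"
    then have b: "lor f g \<noteq> 0" "lor f g > -1" by auto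
    obtain A where A: "A \<subseteq> N - {f}" "\<forall>h\<in>A. lor f h = 0"
      "\<forall>g\<in>N - {f}. \<exists>\<beta> c. (\<forall>a\<in>A. 0 \<le> c a) \<and> g = \<beta> *\<^sub>R f + (\<Sum>a\<in>A. c a *\<^sub>R a)"
      using normal_in_adjacent_cone[OF PN ra fg(1)] .
    obtain \<beta> c where c: "\<And>a. a \<in> A \<Longrightarrow> 0 \<le> c a" "g = \<beta> *\<^sub>R f + (\<Sum>a\<in>A. c a *\<^sub>R a)" using A(3) fg by blast
    have \<beta>: "lor f g = \<beta>"
      by (subst c(2)) (simp add: lor_simps lor_sum_right A(2) unit(2)[OF fg(1)])
    have "lor g g = \<beta> * lor g f + (\<Sum>a\<in>A. c a * lor g a)"
      by (subst (2) c(2)) (simp add: lor_simps lor_sum_right)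
    then have "(\<Sum>a\<in>A. c a * lor g a) = 1 - \<beta>\<^sup>2"
      using unit(2)[OF fg(2)] \<beta> by (simp add: lor_commute[of g f] power2_eq_square)
    moreover have "(\<Sum>a\<in>A. c a * lor g a) \<le> 0"
    proof (intro sum_nonpos mult_nonneg_nonpos c(1))
      fix a assume a: "a \<in> A"
      then have "a \<noteq> g" using A(2) b by blast
      then show "lor g a \<le> 0" using not_pos[of g a] fg a A(1) by force
    qed
    moreover have "\<bar>\<beta>\<bar> < 1" using b not_pos[OF fg] \<beta> by (simp add: abs_less_iff)
    ultimately show False by (simp add: abs_square_less_1[symmetric])
  qed
qed

section \<open>The reflection group of a right-angled polyhedron\<close>

lemma separated_subset_of_compact_finite:
  fixes S :: "'a::metric_space set"
  assumes "compact K" "S \<subseteq> K" "r > 0" and sep: "\<And>x y. x \<in> S \<Longrightarrow> y \<in> S \<Longrightarrow> x \<noteq> y \<Longrightarrow> dist x y \<ge> r"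
  shows "finite S"
proof -
  obtain k where k: "finite k" "K \<subseteq> (\<Union>x\<in>k. ball x (r / 2))"
    using assms(1,3) unfolding compact_eq_totally_bounded by (meson half_gt_zero)
  have "\<exists>c\<in>k. x \<in> ball c (r / 2)" if "x \<in> S" for x using that k(2) assms(2) by blast
  then obtain c where c: "\<And>x. x \<in> S \<Longrightarrow> c x \<in> k \<and> x \<in> ball (c x) (r / 2)" by metis
  have "inj_on c S"
  proof (rule inj_onI, rule ccontr)
    fix x y assume xy: "x \<in> S" "y \<in> S" "c x = c y" "x \<noteq> y"
    have "dist x y < r" using c[OF xy(1)] c[OF xy(2)] xy(3) by (intro dist_triangle_half_r[of "c x" x r y]) auto
    then show False using sep[OF xy(1,2,4)] by simp
  qed
  moreover have "c ` S \<subseteq> k" using c by blast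
  ultimately show ?thesis using k(1) by (metis finite_imageD finite_subset)
qed

lemma lor_reflection:
  assumes "unit_spacelike n"
  shows "lor (vec_of (reflection n x)) m = lor (vec_of x) m - 2 * lor (vec_of x) n * lor n m"
  by (simp add: vec_of_reflection[OF assms] lor_simps)

lemma reflection_comp_self: "unit_spacelike n \<Longrightarrow> reflection n \<circ> (reflection n \<circ> w) = w"
  by (simp add: fun_eq_iff reflection_involution)

lemma IsomH3_simps:
  "carrier IsomH3 = {g. hyp_isometry g}" "\<one>\<^bsub>IsomH3\<^esub> = id" "g \<otimes>\<^bsub>IsomH3\<^esub> h = g \<circ> h"
  by (simp_all add: IsomH3_def)

definition refl_word :: "(real \<times> (real^3)) list \<Rightarrow> hyp3 \<Rightarrow> hyp3" where
  "refl_word ns = foldr (\<lambda>n g. reflection n \<circ> g) ns id"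

lemma refl_word_simps [simp]:
  "refl_word [] = id" "refl_word (n # ns) = reflection n \<circ> refl_word ns"
  by (simp_all add: refl_word_def)

lemma refl_word_append: "refl_word (ns @ ms) = refl_word ns \<circ> refl_word ms"
  by (induction ns) (auto simp: o_assoc)

lemma refl_word_isometry: "\<forall>n\<in>set ns. unit_spacelike n \<Longrightarrow> hyp_isometry (refl_word ns)"
proof (induction ns)
  case (Cons n ns)
  then show ?case unfolding refl_word_simps by (intro hyp_isometry_comp reflection_isometry) auto
qed (simp only: refl_word_simps hyp_isometry_id)

text \<open>The fundamental chamber of a reflection group, with exactly the condition on the Gram matrix that makes the group a
  right-angled Coxeter group.\<close>

locale coxeter_chamber =
  fixes P :: "hyp3 set" and N :: "(real \<times> (real^3)) set"
  assumes PN: "polyhedral_normals P N"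
    and gram: "\<And>f g. f \<in> N \<Longrightarrow> g \<in> N \<Longrightarrow> f \<noteq> g \<Longrightarrow> lor f g = 0 \<or> lor f g \<le> -1"
begin

lemma unit: "n \<in> N \<Longrightarrow> unit_spacelike n"
  by (rule polyhedral_normalsD(2)[OF PN])

definition W :: "(hyp3 \<Rightarrow> hyp3) set" where
  "W = refl_word ` lists N"

definition len :: "(hyp3 \<Rightarrow> hyp3) \<Rightarrow> nat" where
  "len w = (LEAST k. \<exists>ns\<in>lists N. length ns = k \<and> refl_word ns = w)"

lemma len_le: "ns \<in> lists N \<Longrightarrow> len (refl_word ns) \<le> length ns"
  unfolding len_def by (rule Least_le) blast

lemma len_word:
  assumes "w \<in> W"
  obtains ns where "ns \<in> lists N" "length ns = len w" "refl_word ns = w"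
proof -
  have "\<exists>k. \<exists>ns\<in>lists N. length ns = k \<and> refl_word ns = w" using assms by (auto simp: W_def)
  from LeastI_ex[OF this] show ?thesis using that unfolding len_def by blast
qed

lemma W_id: "id \<in> W"
  unfolding W_def by (metis imageI lists.Nil refl_word_simps(1))

lemma W_comp: "v \<in> W \<Longrightarrow> w \<in> W \<Longrightarrow> v \<circ> w \<in> W"
  unfolding W_def by (auto simp flip: refl_word_append intro!: imageI)

lemma W_reflection: "n \<in> N \<Longrightarrow> reflection n \<in> W"
  unfolding W_def by (rule image_eqI[of _ _ "[n]"]) auto

lemma W_reflection_comp: "n \<in> N \<Longrightarrow> w \<in> W \<Longrightarrow> reflection n \<circ> w \<in> W"
  by (intro W_comp W_reflection)

lemma len_reflection_comp:
  assumes "n \<in> N" "w \<in> W"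
  shows "len (reflection n \<circ> w) \<le> len w + 1"
proof -
  obtain ns where ns: "ns \<in> lists N" "length ns = len w" "refl_word ns = w" using len_word[OF assms(2)] .
  then show ?thesis using len_le[of "n # ns"] assms(1) by simp
qed

lemma descent_exists:
  assumes "w \<in> W" "w \<noteq> id"
  obtains t where "t \<in> N" "len (reflection t \<circ> w) < len w"
proof -
  obtain ns where ns: "ns \<in> lists N" "length ns = len w" "refl_word ns = w" using len_word[OF assms(1)] .
  then obtain t ms where tm: "ns = t # ms" using assms(2) by (cases ns) auto
  have t: "t \<in> N" "ms \<in> lists N" using ns tm by auto
  have "reflection t \<circ> w = refl_word ms"
    using ns(3) tm reflection_comp_self[OF unit[OF t(1)], of "refl_word ms"] by simp
  then have "len (reflection t \<circ> w) < len w" using len_le[OF t(2)] ns(2) tm by simp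
  then show ?thesis using that t by blast
qed

lemma W_isometry:
  assumes "w \<in> W"
  shows "hyp_isometry w"
proof -
  obtain ns where "ns \<in> lists N" "w = refl_word ns" using assms unfolding W_def by blast
  moreover have "\<forall>n\<in>set ns. unit_spacelike n" using calculation(1) unit by blast
  ultimately show ?thesis using refl_word_isometry by blast
qed

lemma refl_word_rev: "ns \<in> lists N \<Longrightarrow> refl_word (rev ns) (refl_word ns x) = x"
  by (induction ns arbitrary: x) (auto simp: refl_word_append reflection_involution unit)

lemma W_inverse:
  assumes "w \<in> W"
  obtains v where "v \<in> W" "\<forall>x. v (w x) = x" "\<forall>x. w (v x) = x"
proof -
  obtain ns where ns: "ns \<in> lists N" "w = refl_word ns" using assms unfolding W_def by blast
  have rev: "rev ns \<in> lists N" using ns(1) by (simp add: lists_eq_set)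
  show ?thesis
    using refl_word_rev[OF ns(1)] refl_word_rev[OF rev] rev
    by (intro that[of "refl_word (rev ns)"]) (simp_all add: W_def ns(2))
qed

lemma W_inv_into:
  assumes "w \<in> W"
  shows "inv_into UNIV w \<in> W"
proof -
  obtain v where v: "v \<in> W" "\<forall>x. v (w x) = x" "\<forall>x. w (v x) = x" using W_inverse[OF assms] .
  have "inv_into UNIV w x = v x" for x
    using hyp_isometry_inv_apply(2)[OF W_isometry[OF assms], of "v x"] by (simp add: v(3))
  then have "inv_into UNIV w = v" by (rule ext)
  then show ?thesis using \<open>v \<in> W\<close> by simp
qed

text \<open>Tits' lemma: if multiplication by a generator \<open>s\<close> does not shorten \<open>w\<close>, then \<open>w P\<close> lies on the same side of the mirror
  of \<open>s\<close> as \<open>P\<close>.  The induction on length writes \<open>w = t v\<close> with \<open>v\<close> shorter.  If \<open>s\<close> and \<open>t\<close> commute,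
  the claim for \<open>v\<close> passes to \<open>w\<close>.  If the mirrors of \<open>s\<close> and \<open>t\<close> do not meet, the reduced words
  in \<open>s\<close> and \<open>t\<close> alternate, and the second conjunct is an invariant that survives each further letter:
  a point that \<open>t\<close>, the last letter applied, has moved beyond its own mirror lies at least as deep on the
  side of \<open>P\<close> of the mirror of \<open>s\<close>.\<close>

lemma tits:
  assumes "w \<in> W"
  shows "(\<forall>s\<in>N. len w \<le> len (reflection s \<circ> w) \<longrightarrow> w ` P \<subseteq> halfspace s) \<and>
    (\<forall>s\<in>N. \<forall>t\<in>N. lor s t \<le> -1 \<longrightarrow> len (reflection t \<circ> w) < len w \<longrightarrow>
      (\<forall>y\<in>w ` P. lor (vec_of y) t \<ge> 0 \<and> lor (vec_of y) s + lor (vec_of y) t \<le> 0))"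
  using assms
proof (induction "len w" arbitrary: w rule: less_induct)
  case less
  have first: "\<And>v s. v \<in> W \<Longrightarrow> len v < len w \<Longrightarrow> s \<in> N \<Longrightarrow> len v \<le> len (reflection s \<circ> v) \<Longrightarrow> v ` P \<subseteq> halfspace s"
    and second: "\<And>v s t z. v \<in> W \<Longrightarrow> len v < len w \<Longrightarrow> s \<in> N \<Longrightarrow> t \<in> N \<Longrightarrow> lor s t \<le> -1 \<Longrightarrow>
      len (reflection t \<circ> v) < len v \<Longrightarrow> z \<in> v ` P \<Longrightarrow> lor (vec_of z) t \<ge> 0 \<and> lor (vec_of z) s + lor (vec_of z) t \<le> 0"
    using less(1) by blast+
  have two: "lor (vec_of y) t \<ge> 0 \<and> lor (vec_of y) s + lor (vec_of y) t \<le> 0"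
    if st: "s \<in> N" "t \<in> N" "lor s t \<le> -1" "len (reflection t \<circ> w) < len w" and y: "y \<in> w ` P" for s t y
  proof -
    define v where "v = reflection t \<circ> w"
    have v: "v \<in> W" "len v < len w" using st less(2) by (auto simp: v_def W_reflection_comp)
    have w: "w = reflection t \<circ> v" using reflection_comp_self[OF unit[OF st(2)], of w] by (simp add: v_def)
    obtain z where z: "z \<in> v ` P" "y = reflection t z" using y by (auto simp: w)
    have "v ` P \<subseteq> halfspace t" using v st(2) w by (intro first) auto
    then have zt: "lor (vec_of z) t \<le> 0" using z(1) by (auto simp: halfspace_def)
    have tt: "lor t t = 1" using unit[OF st(2)] by (simp add: unit_spacelike_def)
    have yt: "lor (vec_of y) t = - lor (vec_of z) t"
      and ys: "lor (vec_of y) s = lor (vec_of z) s - 2 * lor (vec_of z) t * lor s t"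
      by (simp_all add: z(2) lor_reflection[OF unit[OF st(2)]] tt lor_commute[of t s])
    have sum: "lor (vec_of z) s + lor (vec_of z) t \<le> 0"
    proof (cases "len v \<le> len (reflection s \<circ> v)")
      case True
      then have "v ` P \<subseteq> halfspace s" using v st by (intro first)
      then show ?thesis using z(1) zt by (auto simp: halfspace_def)
    next
      case False
      then show ?thesis using second[OF v st(2,1) _ _ z(1)] st(3) by (simp add: lor_commute[of t s])
    qed
    have "lor (vec_of y) s + lor (vec_of y) t = (lor (vec_of z) s + lor (vec_of z) t) + lor (vec_of z) t * (- 2 * lor s t - 2)"
      by (simp add: ys yt algebra_simps)
    moreover have "lor (vec_of z) t * (- 2 * lor s t - 2) \<le> 0" using zt st(3) by (simp add: mult_nonpos_nonneg)
    ultimately show ?thesis using yt zt sum by linarith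
  qed
  have "w ` P \<subseteq> halfspace s" if s: "s \<in> N" "len w \<le> len (reflection s \<circ> w)" for s
  proof (cases "w = id")
    case True
    then show ?thesis using polyhedral_normalsD(6)[OF PN s(1)] by simp
  next
    case False
    obtain t where t: "t \<in> N" "len (reflection t \<circ> w) < len w" using descent_exists[OF less(2) False] .
    have "t \<noteq> s" using t s by auto
    then consider "lor s t = 0" | "lor s t \<le> -1" using gram[OF s(1) t(1)] by blast
    then show ?thesis
    proof cases
      case 1
      define v where "v = reflection t \<circ> w"
      have v: "v \<in> W" "len v < len w" using t less(2) by (auto simp: v_def W_reflection_comp)
      have w: "w = reflection t \<circ> v" using reflection_comp_self[OF unit[OF t(1)], of w] by (simp add: v_def)
      have comm: "reflection s (reflection t x) = reflection t (reflection s x)" for x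
      proof -
        have "vec_of (reflection s (reflection t x)) = vec_of (reflection t (reflection s x))"
          using 1 by (simp add: vec_of_reflection unit s t lor_simps lor_commute[of t s])
        then show ?thesis by (simp add: vec_of_inject)
      qed
      have "len v \<le> len (reflection s \<circ> v)"
      proof (rule ccontr)
        assume *: "\<not> len v \<le> len (reflection s \<circ> v)"
        have "reflection s \<circ> w = reflection t \<circ> (reflection s \<circ> v)" by (simp add: w fun_eq_iff comm)
        then have "len (reflection s \<circ> w) \<le> len (reflection s \<circ> v) + 1"
          using len_reflection_comp[OF t(1) W_reflection_comp[OF s(1) v(1)]] by simp
        then show False using * v(2) s(2) by linarith
      qed
      then have "v ` P \<subseteq> halfspace s" using v s by (intro first)
      then show ?thesis using 1 by (auto simp: w halfspace_def lor_reflection[OF unit[OF t(1)]] lor_commute[of t s])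
    next
      case 2
      show ?thesis
      proof
        fix y assume "y \<in> w ` P"
        from two[OF s(1) t(1) 2 t(2) this] show "y \<in> halfspace s" by (simp add: halfspace_def)
      qed
    qed
  qed
  then show ?case using two by blast
qed

lemma nontrivial_separated:
  assumes "w \<in> W" "w \<noteq> id"
  obtains t where "t \<in> N" "\<forall>y\<in>w ` P. lor (vec_of y) t \<ge> 0"
proof -
  obtain t where t: "t \<in> N" "len (reflection t \<circ> w) < len w" using descent_exists[OF assms] .
  define v where "v = reflection t \<circ> w"
  have w: "w = reflection t \<circ> v" using reflection_comp_self[OF unit[OF t(1)], of w] by (simp add: v_def)
  have v: "v \<in> W" "len v < len w" using t assms by (auto simp: v_def W_reflection_comp)
  have "v ` P \<subseteq> halfspace t" using tits[OF v(1)] t(1) v(2) w by auto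
  moreover have "lor t t = 1" using unit[OF t(1)] by (simp add: unit_spacelike_def)
  ultimately have "lor (vec_of y) t \<ge> 0" if "y \<in> w ` P" for y
    using that by (auto simp: w halfspace_def lor_reflection[OF unit[OF t(1)]])
  then show ?thesis using that t(1) by blast
qed

lemma interior_neg: "x \<in> interior P \<Longrightarrow> n \<in> N \<Longrightarrow> lor (vec_of x) n < 0"
  by (rule interior_lor_neg[OF _ polyhedral_normalsD(6)[OF PN] unit_spacelike_nonzero[OF unit]])

lemma W_disjoint_interior:
  assumes "w \<in> W" "w \<noteq> id"
  shows "w ` P \<inter> interior P = {}"
proof -
  obtain t where "t \<in> N" "\<forall>y\<in>w ` P. lor (vec_of y) t \<ge> 0" using nontrivial_separated[OF assms] .
  then show ?thesis using interior_neg by (meson disjoint_iff not_le)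
qed

lemma W_stabilizer:
  assumes "w \<in> W" "w ` P = P"
  shows "w = id"
  using W_disjoint_interior[OF assms(1)] assms(2) polyhedral_normalsD(3)[OF PN] interior_subset[of P] by blast

text \<open>The orbit of an interior point \<open>p\<close> is uniformly separated, hence meets balls in finite sets, and some \<open>w p\<close> is
  closest to \<open>x\<close>.  If the preimage of \<open>x\<close> under \<open>w\<close> lay beyond a mirror of \<open>P\<close>, reflecting \<open>p\<close> in it would give an orbit
  point closer to \<open>x\<close>.\<close>

lemma W_covers: "\<exists>w\<in>W. x \<in> w ` P"
proof -
  obtain p where p: "p \<in> interior P" using polyhedral_normalsD(3)[OF PN] by blast
  obtain r where r: "r > 0" "ball p r \<subseteq> interior P" using openE[OF open_interior p] .
  have pP: "p \<in> P" using p interior_subset by blast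
  have sep0: "dist (w p) p \<ge> r" if w: "w \<in> W" "w \<noteq> id" for w
  proof (rule ccontr)
    assume "\<not> dist (w p) p \<ge> r"
    then have "w p \<in> interior P" using r(2) by (auto simp: dist_commute)
    moreover have "w p \<in> w ` P" using pP by blast
    ultimately show False using W_disjoint_interior[OF w] by blast
  qed
  have sep: "dist (v p) (w p) \<ge> r" if vw: "v \<in> W" "w \<in> W" "v \<noteq> w" for v w
  proof -
    obtain u where u: "u \<in> W" "\<forall>x. u (w x) = x" "\<forall>x. w (u x) = x" using W_inverse[OF vw(2)] .
    have "u \<circ> v \<noteq> id"
    proof
      assume "u \<circ> v = id"
      then have "u (v x) = x" for x by (metis comp_apply id_apply)
      then have "v x = w x" for x by (metis u(3))
      then show False using vw(3) by blast
    qed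
    then have "r \<le> dist ((u \<circ> v) p) p" by (intro sep0 W_comp u vw)
    also have "\<dots> = dist (u (v p)) (u (w p))" by (simp add: u(2))
    also have "\<dots> = dist (v p) (w p)" by (rule hyp_isometry_dist[OF W_isometry[OF u(1)]])
    finally show ?thesis .
  qed
  let ?A = "{w \<in> W. dist x (w p) \<le> dist x p}"
  have "finite ((\<lambda>w. w p) ` ?A)"
    by (rule separated_subset_of_compact_finite[OF compact_hyp3_cball[of x "dist x p"] _ r(1)]) (use sep in auto)
  moreover have "inj_on (\<lambda>w. w p) ?A"
    by (rule inj_onI, rule ccontr) (use sep r(1) in fastforce)
  ultimately have "finite ?A" by (rule finite_imageD)
  moreover have "id \<in> ?A" using W_id by simp
  ultimately obtain w where w: "w \<in> ?A" "\<And>v. v \<in> ?A \<Longrightarrow> dist x (w p) \<le> dist x (v p)"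
    using ex_min_if_finite[of "(\<lambda>w. dist x (w p)) ` ?A"] by (metis (mono_tags, lifting) arg_min_if_finite(1) arg_min_least empty_iff)
  have wW: "w \<in> W" using w by simp
  have least: "dist x (w p) \<le> dist x (v p)" if "v \<in> W" for v
    using w(2)[of v] w(2)[OF \<open>id \<in> ?A\<close>] that by (cases "dist x (v p) \<le> dist x p") auto
  define y where "y = inv_into UNIV w x"
  have y: "x = w y" using hyp_isometry_inv_apply(1)[OF W_isometry[OF wW], of x] by (simp add: y_def)
  have "y \<in> P"
  proof (rule ccontr)
    assume "y \<notin> P"
    then obtain n where n: "n \<in> N" "lor (vec_of y) n > 0" using polyhedral_normalsD(5)[OF PN] by force
    have "lor (vec_of y) n * lor (vec_of p) n < 0" using n interior_neg[OF p n(1)] by (simp add: mult_pos_neg)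
    then have "- lor (vec_of (reflection n p)) (vec_of y) < - lor (vec_of p) (vec_of y)"
      by (simp add: lor_reflection[OF unit[OF n(1)]] lor_commute[of n "vec_of y"] mult.commute)
    then have "cosh (dist (reflection n p) y) < cosh (dist p y)" by (simp add: cosh_dist)
    then have "dist (reflection n p) y < dist p y" by (simp add: cosh_real_nonneg_less_iff)
    then have "dist x ((w \<circ> reflection n) p) < dist x (w p)"
      using hyp_isometry_dist[OF W_isometry[OF wW]] by (simp add: y dist_commute)
    moreover have "w \<circ> reflection n \<in> W" using wW n by (intro W_comp W_reflection)
    ultimately show False using least by fastforce
  qed
  then show ?thesis using wW y by blast
qed

lemma face_reflections: "face_reflection P ` faces P = reflection ` N"
proof
  show "face_reflection P ` faces P \<subseteq> reflection ` N"
  proof (rule image_subsetI)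
    fix f assume "f \<in> faces P"
    from face_has_normal[OF PN this] obtain h where "h \<in> N" "face_normal P f = h" by blast
    then show "face_reflection P f \<in> reflection ` N" by (simp add: face_reflection_def)
  qed
  show "reflection ` N \<subseteq> face_reflection P ` faces P"
  proof (rule image_subsetI)
    fix h assume h: "h \<in> N"
    show "reflection h \<in> face_reflection P ` faces P"
      using normal_face[OF PN h] by (intro image_eqI[of _ _ "P \<inter> hplane h"]) (simp_all add: face_reflection_def)
  qed
qed

lemma reflection_group_eq: "reflection_group P = W"
proof
  have gens: "n \<in> N \<Longrightarrow> reflection n \<in> face_reflection P ` faces P" for n by (simp add: face_reflections)
  have "refl_word ns \<in> reflection_group P" if "ns \<in> lists N" for ns
    using that
  proof (induction ns)
    case Nil
    show ?case
      unfolding refl_word_simps reflection_group_def IsomH3_simps(2)[symmetric] by (rule generate.one)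
  next
    case (Cons n ns)
    then have "n \<in> N" "refl_word ns \<in> reflection_group P" by simp_all
    then have "reflection n \<otimes>\<^bsub>IsomH3\<^esub> refl_word ns \<in> reflection_group P"
      unfolding reflection_group_def by (rule generate.eng[OF generate.incl[OF gens]])
    then show ?case unfolding IsomH3_simps refl_word_simps .
  qed
  then show "W \<subseteq> reflection_group P" by (auto simp: W_def)
  show "reflection_group P \<subseteq> W"
  proof
    fix g assume "g \<in> reflection_group P"
    then show "g \<in> W" unfolding reflection_group_def
    proof (induction rule: generate.induct)
      case one
      show ?case unfolding IsomH3_simps by (rule W_id)
    next
      case (incl h)
      then show ?case using W_reflection by (auto simp: face_reflections)
    next
      case (inv h)
      then obtain n where n: "n \<in> N" "h = reflection n" unfolding face_reflections by blast
      have "h \<circ> h = id"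
        using reflection_comp_self[OF unit[OF n(1)], of id] unfolding n(2) comp_id .
      then have "inv\<^bsub>IsomH3\<^esub> h = h"
        using reflection_isometry[OF unit[OF n(1)]] n(2)
        by (intro group.inv_equality[OF group_IsomH3]) (simp_all only: IsomH3_simps mem_Collect_eq)
      then show ?case using W_reflection n by simp
    next
      case (eng h1 h2)
      then show ?case unfolding IsomH3_simps by (intro W_comp)
    qed
  qed
qed

end

lemma right_angled_ideal_chamber:
  assumes "ideal_polyhedron P" "right_angled P"
  obtains N where "coxeter_chamber P N"
proof -
  obtain N where N: "polyhedral_normals P N" using ideal_polyhedron_normals[OF assms(1)] .
  have "coxeter_chamber P N"
    by standard (use N right_angled_gram[OF N assms(2)] in auto)
  then show ?thesis by (rule that)
qed

section \<open>Local structure of polyhedra and their faces\<close>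

lemma polyhedral_interior:
  assumes PN: "polyhedral_normals P N"
  shows "interior P = {x. \<forall>n\<in>N. lor (vec_of x) n < 0}"
proof
  show "interior P \<subseteq> {x. \<forall>n\<in>N. lor (vec_of x) n < 0}"
    using interior_lor_neg[OF _ polyhedral_normalsD(6)[OF PN] unit_spacelike_nonzero[OF polyhedral_normalsD(2)[OF PN]]]
    by blast
  have "open (\<Inter>n\<in>N. {x. lor (vec_of x) n < 0})"
    by (intro open_INT polyhedral_normalsD(1)[OF PN] ballI open_hyp3_lor_less)
  moreover have "(\<Inter>n\<in>N. {x. lor (vec_of x) n < 0}) \<subseteq> P"
    by (auto simp: polyhedral_normalsD(5)[OF PN] less_imp_le)
  ultimately have "(\<Inter>n\<in>N. {x. lor (vec_of x) n < 0}) \<subseteq> interior P" by (intro interior_maximal)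
  then show "{x. \<forall>n\<in>N. lor (vec_of x) n < 0} \<subseteq> interior P" by blast
qed

lemma interior_iff_no_face:
  assumes PN: "polyhedral_normals P N" and x: "x \<in> P"
  shows "x \<in> interior P \<longleftrightarrow> (\<forall>f\<in>faces P. x \<notin> f)"
proof
  assume int: "x \<in> interior P"
  show "\<forall>f\<in>faces P. x \<notin> f"
  proof
    fix f assume "f \<in> faces P"
    then obtain h where h: "h \<in> N" "f = P \<inter> hplane h" using face_has_normal[OF PN] by metis
    then have "lor (vec_of x) h < 0" using int polyhedral_interior[OF PN] by blast
    then show "x \<notin> f" by (simp add: h(2) hplane_def)
  qed
next
  assume no: "\<forall>f\<in>faces P. x \<notin> f"
  have "lor (vec_of x) h < 0" if h: "h \<in> N" for h
  proof -
    have "x \<notin> P \<inter> hplane h" using no normal_face(1)[OF PN h] by blast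
    then have "lor (vec_of x) h \<noteq> 0" using x by (simp add: hplane_def)
    moreover have "lor (vec_of x) h \<le> 0" using x h polyhedral_normalsD(5)[OF PN] by blast
    ultimately show ?thesis by simp
  qed
  then show "x \<in> interior P" by (simp add: polyhedral_interior[OF PN])
qed

lemma connected_polyhedral_interior:
  assumes PN: "polyhedral_normals P N"
  shows "connected (interior P)"
proof -
  let ?C = "{v \<in> timelike. \<forall>n\<in>N. lor v n < 0}"
  have "convex ?C"
  proof (rule convexI)
    fix v w and s t :: real assume *: "v \<in> ?C" "w \<in> ?C" "0 \<le> s" "0 \<le> t" "s + t = 1"
    have s: "s = 1 - t" using *(5) by simp
    have "s *\<^sub>R v + t *\<^sub>R w \<in> timelike"
      unfolding s by (rule timelike_segment) (use * in auto)
    moreover have "lor (s *\<^sub>R v + t *\<^sub>R w) n < 0" if n: "n \<in> N" for n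
    proof (cases "t = 0")
      case True
      then show ?thesis using * n by (simp add: s)
    next
      case False
      have "s * lor v n \<le> 0" using *(1,3) n by (simp add: mult_nonneg_nonpos less_imp_le)
      moreover have "t * lor w n < 0" using *(2,4) n False by (simp add: mult_pos_neg)
      ultimately show ?thesis by (simp add: lor_simps)
    qed
    ultimately show "s *\<^sub>R v + t *\<^sub>R w \<in> ?C" by simp
  qed
  then have "connected (hproj ` ?C)"
    by (intro connected_continuous_image convex_connected continuous_on_subset[OF continuous_on_hproj]) auto
  moreover have "hproj ` ?C = interior P"
  proof
    show "hproj ` ?C \<subseteq> interior P"
      by (auto simp: polyhedral_interior[OF PN] lor_hproj_nonpos_iff)
    show "interior P \<subseteq> hproj ` ?C"
    proof
      fix x assume "x \<in> interior P"
      then have "vec_of x \<in> ?C" by (simp add: polyhedral_interior[OF PN])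
      then have "hproj (vec_of x) \<in> hproj ` ?C" by (rule imageI)
      then show "x \<in> hproj ` ?C" by (simp only: hproj_vec_of)
    qed
  qed
  ultimately show ?thesis by simp
qed

lemma polyhedron_subset_closure_interior:
  assumes PN: "polyhedral_normals P N"
  shows "P \<subseteq> closure (interior P)"
proof
  fix x assume x: "x \<in> P"
  obtain p where p: "p \<in> interior P" using polyhedral_normalsD(3)[OF PN] by blast
  show "x \<in> closure (interior P)"
    unfolding closure_approachable
  proof (intro allI impI)
    fix e :: real assume "e > 0"
    obtain d where d: "d > 0" "\<And>t. \<bar>t\<bar> < d \<Longrightarrow>
        vec_of x + t *\<^sub>R (vec_of p - vec_of x) \<in> timelike \<and> hproj (vec_of x + t *\<^sub>R (vec_of p - vec_of x)) \<in> ball x e"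
      using hproj_line_in_open[of "ball x e" "vec_of x" "vec_of p - vec_of x"] \<open>e > 0\<close> by auto
    define t where "t = min 1 d / 2"
    have t: "0 < t" "t < 1" "\<bar>t\<bar> < d" using d(1) by (auto simp: t_def)
    define v where "v = vec_of x + t *\<^sub>R (vec_of p - vec_of x)"
    have v: "v \<in> timelike" "hproj v \<in> ball x e" using d(2)[OF t(3)] by (auto simp: v_def)
    have "lor v n < 0" if n: "n \<in> N" for n
    proof -
      have "(1 - t) * lor (vec_of x) n \<le> 0"
        using x n t polyhedral_normalsD(5)[OF PN] by (simp add: mult_nonneg_nonpos)
      moreover have "t * lor (vec_of p) n < 0" using p n t polyhedral_interior[OF PN] by (simp add: mult_pos_neg)
      moreover have "lor v n = (1 - t) * lor (vec_of x) n + t * lor (vec_of p) n"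
        by (simp add: v_def lor_simps algebra_simps)
      ultimately show ?thesis by simp
    qed
    then have "hproj v \<in> interior P" using v(1) by (simp add: polyhedral_interior[OF PN] lor_hproj_nonpos_iff)
    then show "\<exists>y\<in>interior P. dist y x < e" using v(2) by (auto simp: dist_commute)
  qed
qed

definition face_interior :: "hyp3 set \<Rightarrow> hyp3 set \<Rightarrow> hyp3 set" where
  "face_interior P f = {z \<in> hplane (face_normal P f). \<exists>U. open U \<and> z \<in> U \<and> U \<inter> hplane (face_normal P f) \<subseteq> f}"

lemma face_outward_normal:
  assumes "interior P \<noteq> {}" "f \<in> faces P"
  shows "outward_normal P f (face_normal P f)" "face_interior P f \<noteq> {}"
proof -
  obtain m U x where m: "outward_normal P f m" "open U" "x \<in> U" "x \<in> hplane m" "U \<inter> hplane m \<subseteq> f"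
    using faceE[OF assms(2)] .
  have eq: "face_normal P f = m" by (rule face_normal_eqI[OF assms(1) m])
  show "outward_normal P f (face_normal P f)" using m(1) eq by simp
  have "x \<in> face_interior P f" using m eq by (auto simp: face_interior_def)
  then show "face_interior P f \<noteq> {}" by blast
qed

text \<open>On the hyperplane of \<open>f\<close> the functional of another supporting hyperplane through \<open>z\<close> has a local
  maximum at the relative interior point \<open>z\<close>, hence vanishes identically.\<close>

lemma face_interior_unique_face:
  assumes int: "interior P \<noteq> {}" and f: "f \<in> faces P" and g: "g \<in> faces P" and z: "z \<in> face_interior P f" "z \<in> g"
  shows "g = f"
proof -
  define m k where "m = face_normal P f" and "k = face_normal P g"
  have m: "unit_spacelike m" "P \<subseteq> halfspace m" "f = P \<inter> hplane m"
    using face_outward_normal(1)[OF int f] by (auto simp: outward_normal_def m_def)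
  have k: "unit_spacelike k" "P \<subseteq> halfspace k" "g = P \<inter> hplane k"
    using face_outward_normal(1)[OF int g] by (auto simp: outward_normal_def k_def)
  obtain U where U: "open U" "z \<in> U" "z \<in> hplane m" "U \<inter> hplane m \<subseteq> f"
    using z(1) by (auto simp: face_interior_def m_def)
  have zk: "lor (vec_of z) k = 0" using z(2) k(3) by (simp add: hplane_def)
  \<comment> \<open>the linear functional of \<open>k\<close> has a local maximum at \<open>z\<close> on the hyperplane of \<open>f\<close>\<close>
  have "lor w k = 0" if w: "lor w m = 0" for w
  proof -
    obtain e where e: "e > 0" "\<And>t. \<bar>t\<bar> < e \<Longrightarrow> vec_of z + t *\<^sub>R w \<in> timelike \<and> hproj (vec_of z + t *\<^sub>R w) \<in> U"
      using hproj_line_in_open[of U "vec_of z" w] U by auto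
    have "t * lor w k \<le> 0" if t: "\<bar>t\<bar> < e" for t
    proof -
      have tl: "vec_of z + t *\<^sub>R w \<in> timelike" "hproj (vec_of z + t *\<^sub>R w) \<in> U" using e(2)[OF t] by auto
      have "lor (vec_of z + t *\<^sub>R w) m = 0" using U(3) w by (simp add: hplane_def lor_simps)
      then have "hproj (vec_of z + t *\<^sub>R w) \<in> hplane m" using tl by (simp add: hplane_def lor_hproj_nonpos_iff)
      then have "hproj (vec_of z + t *\<^sub>R w) \<in> halfspace k" using tl(2) U(4) m(3) k(2) by blast
      then have "lor (vec_of z + t *\<^sub>R w) k \<le> 0" using tl(1) by (simp add: halfspace_def lor_hproj_nonpos_iff)
      then show ?thesis using zk by (simp add: lor_simps)
    qed
    from this[of "e/2"] this[of "- (e/2)"] e(1) show ?thesis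
      by (auto simp: mult_le_0_iff zero_le_mult_iff)
  qed
  then have "hplane m \<subseteq> hplane k" unfolding hplane_def by blast
  then have "k = m"
    using U by (intro hplane_piece_unique_halfspace[OF m(1) k(1) U(1-3) _ int m(2) k(2)]) blast
  then show ?thesis using m k by simp
qed

text \<open>No other face passes through the relative interior point \<open>z\<close>, so that all other normals are strictly
  negative at \<open>z\<close> and hence nearby.\<close>

lemma face_chart:
  assumes PN: "polyhedral_normals P N" and f: "f \<in> faces P" and z: "z \<in> face_interior P f"
  obtains \<rho> where "\<rho> > 0" "\<forall>y\<in>ball z \<rho>. lor (vec_of y) (face_normal P f) \<le> 0 \<longrightarrow> y \<in> P"
    "\<forall>y\<in>ball z \<rho>. \<forall>g\<in>faces P. y \<in> g \<longrightarrow> g = f"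
proof -
  have int: "interior P \<noteq> {}" by (rule polyhedral_normalsD(3)[OF PN])
  obtain h where h: "h \<in> N" "f = P \<inter> hplane h" "face_normal P f = h" using face_has_normal[OF PN f] .
  have zP: "z \<in> P" using z h by (auto simp: face_interior_def)
  let ?V = "\<Inter>k\<in>N - {h}. {y. lor (vec_of y) k < 0}"
  have "open ?V" by (intro open_INT ballI open_hyp3_lor_less) (simp add: polyhedral_normalsD(1)[OF PN])
  moreover have "z \<in> ?V"
  proof (intro INT_I CollectI)
    fix k assume k: "k \<in> N - {h}"
    have "lor (vec_of z) k \<noteq> 0"
    proof
      assume "lor (vec_of z) k = 0"
      then have "z \<in> P \<inter> hplane k" using zP by (simp add: hplane_def)
      then have "P \<inter> hplane k = f" using k
        by (intro face_interior_unique_face[OF int f normal_face(1)[OF PN] z]) auto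
      then show False using normal_face(2)[OF PN, of k] h(3) k by simp
    qed
    moreover have "lor (vec_of z) k \<le> 0" using zP k polyhedral_normalsD(5)[OF PN] by blast
    ultimately show "lor (vec_of z) k < 0" by simp
  qed
  ultimately obtain \<rho> where \<rho>: "\<rho> > 0" "ball z \<rho> \<subseteq> ?V" by (rule openE)
  have V: "lor (vec_of y) k < 0" if "y \<in> ball z \<rho>" "k \<in> N" "k \<noteq> h" for y k using \<rho>(2) that by blast
  have half: "y \<in> P" if y: "y \<in> ball z \<rho>" "lor (vec_of y) (face_normal P f) \<le> 0" for y
    unfolding polyhedral_normalsD(5)[OF PN]
  proof
    fix n assume "n \<in> N"
    then show "lor (vec_of y) n \<le> 0" using V[OF y(1), of n] y(2) h(3) by (cases "n = h") auto
  qed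
  have face: "g = f" if y: "y \<in> ball z \<rho>" "g \<in> faces P" "y \<in> g" for y g
  proof -
    obtain k where k: "k \<in> N" "g = P \<inter> hplane k" using face_has_normal[OF PN y(2)] by metis
    then have "lor (vec_of y) k = 0" using y(3) by (simp add: hplane_def)
    then have "k = h" using V[OF y(1) k(1)] by auto
    then show ?thesis using k h by simp
  qed
  show ?thesis
    by (rule that[OF \<rho>(1)]) (use half face in \<open>simp_all only: Ball_def\<close>, blast+)
qed

text \<open>Here \<open>u\<close> need not carry \<open>P\<close> onto \<open>Q\<close>; the polyhedra may lie on either side of the common face, whence the
  sign.\<close>

lemma isometry_face_to_face:
  assumes u: "hyp_isometry u" and P: "interior P \<noteq> {}" "f \<in> faces P" and Q: "interior Q \<noteq> {}" "u ` f \<in> faces Q"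
    and z: "z \<in> face_interior P f"
  shows "face_normal Q (u ` f) = lmap u (face_normal P f) \<or> face_normal Q (u ` f) = - lmap u (face_normal P f)"
    and "u z \<in> face_interior Q (u ` f)"
proof -
  define m where "m = face_normal P f"
  define k where "k = face_normal Q (u ` f)"
  have m: "unit_spacelike m" using face_outward_normal(1)[OF P] by (simp add: outward_normal_def m_def)
  have k: "unit_spacelike k" "u ` f \<subseteq> hplane k"
    using face_outward_normal(1)[OF Q] by (auto simp: outward_normal_def k_def)
  obtain U where U: "open U" "z \<in> U" "z \<in> hplane m" "U \<inter> hplane m \<subseteq> f"
    using z by (auto simp: face_interior_def m_def)
  have uz: "u z \<in> u ` U" "u z \<in> hplane (lmap u m)" using U by (auto simp flip: isometry_hplane[OF u])
  have "u ` U \<inter> hplane (lmap u m) = u ` (U \<inter> hplane m)"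
    unfolding isometry_hplane[OF u, symmetric] using u by (auto simp: hyp_isometry_inj)
  then have sub: "u ` U \<inter> hplane (lmap u m) \<subseteq> u ` f" using U(4) by auto
  have um: "unit_spacelike (lmap u m)" using m by (simp add: unit_spacelike_lmap u)
  show *: "k = lmap u m \<or> k = - lmap u m"
    by (rule hplane_piece_unique[OF um k(1) isometry_open_image[OF u U(1)] uz]) (use sub k(2) in blast)
  then have "hplane k = hplane (lmap u m)" by (auto simp: hplane_def)
  then show "u z \<in> face_interior Q (u ` f)"
    using uz sub isometry_open_image[OF u U(1)] unfolding face_interior_def k_def[symmetric] by auto
qed

lemma isometry_face_image:
  assumes u: "hyp_isometry u" and P: "interior P \<noteq> {}" and f: "f \<in> faces P"
  shows "u ` f \<in> faces (u ` P)" "face_normal (u ` P) (u ` f) = lmap u (face_normal P f)"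
    "face_reflection (u ` P) (u ` f) (u x) = u (face_reflection P f x)"
proof -
  define m where "m = face_normal P f"
  have m: "unit_spacelike m" "P \<subseteq> halfspace m" "f = P \<inter> hplane m"
    using face_outward_normal(1)[OF P f] by (auto simp: outward_normal_def m_def)
  obtain z where "z \<in> face_interior P f" using face_outward_normal(2)[OF P f] by blast
  then obtain U where U: "open U" "z \<in> U" "z \<in> hplane m" "U \<inter> hplane m \<subseteq> f"
    by (auto simp: face_interior_def m_def)
  have inj: "inj u" using u by (simp add: hyp_isometry_def bij_is_inj)
  have out: "outward_normal (u ` P) (u ` f) (lmap u m)"
    using m image_mono[OF m(2), of u] u
    by (simp add: outward_normal_def unit_spacelike_lmap isometry_halfspace image_Int[OF inj] isometry_hplane)
  have uz: "u z \<in> u ` U" "u z \<in> hplane (lmap u m)" using U by (auto simp flip: isometry_hplane[OF u])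
  have sub: "u ` U \<inter> hplane (lmap u m) \<subseteq> u ` f"
    using image_mono[OF U(4), of u] by (simp add: image_Int[OF inj] isometry_hplane[OF u])
  show "u ` f \<in> faces (u ` P)" by (rule faceI[OF out isometry_open_image[OF u U(1)] uz sub])
  have "interior (u ` P) \<noteq> {}" using P by (simp add: isometry_interior_image[OF u])
  from face_normal_eqI[OF this out isometry_open_image[OF u U(1)] uz sub]
  show eq: "face_normal (u ` P) (u ` f) = lmap u (face_normal P f)" by (simp add: m_def)
  show "face_reflection (u ` P) (u ` f) (u x) = u (face_reflection P f x)"
    unfolding face_reflection_def eq using isometry_reflection[OF u m(1)] by (simp add: m_def)
qed

section \<open>The semidirect product\<close>

lemma inv_IsomH3: "hyp_isometry g \<Longrightarrow> inv\<^bsub>IsomH3\<^esub> g = inv_into UNIV g"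
proof (rule group.inv_equality[OF group_IsomH3])
  assume g: "hyp_isometry g"
  show "inv_into UNIV g \<otimes>\<^bsub>IsomH3\<^esub> g = \<one>\<^bsub>IsomH3\<^esub>"
    using hyp_isometry_inv_apply(2)[OF g] unfolding IsomH3_simps by (intro ext) (simp only: comp_apply id_apply)
qed (simp_all add: IsomH3_simps hyp_isometry_inv)

lemma symmetry_group_inv:
  assumes "g \<in> symmetry_group P"
  shows "inv_into UNIV g \<in> symmetry_group P"
proof -
  have g: "hyp_isometry g" "g ` P = P" using assms by (auto simp: symmetry_group_def IsomH3_simps)
  have "inv_into UNIV g ` P = inv_into UNIV g ` g ` P" using g by simp
  also have "\<dots> = P" using hyp_isometry_inv_apply(2)[OF g(1)] by (simp add: image_image)
  finally show ?thesis using g by (simp add: symmetry_group_def IsomH3_simps hyp_isometry_inv)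
qed

context coxeter_chamber
begin

lemma symmetry_conj_W:
  assumes g: "g \<in> symmetry_group P" and w: "w \<in> W"
  obtains v where "v \<in> W" "g \<circ> w = v \<circ> g"
proof -
  have gi: "hyp_isometry g" and gP: "g ` P = P" using g by (auto simp: symmetry_group_def IsomH3_simps)
  have refl: "\<exists>m\<in>N. g \<circ> reflection n = reflection m \<circ> g" if n: "n \<in> N" for n
  proof -
    have int: "interior P \<noteq> {}" by (rule polyhedral_normalsD(3)[OF PN])
    have "g ` (P \<inter> hplane n) \<in> faces P" "face_normal P (g ` (P \<inter> hplane n)) = lmap g n"
      using isometry_face_image(1,2)[OF gi int normal_face(1)[OF PN n]] by (simp_all add: gP normal_face(2)[OF PN n])
    then have "lmap g n \<in> N" using face_has_normal[OF PN] by metis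
    moreover have "g \<circ> reflection n = reflection (lmap g n) \<circ> g"
      using isometry_reflection[OF gi unit[OF n]] by (intro ext) simp
    ultimately show ?thesis by blast
  qed
  have "\<exists>v\<in>W. g \<circ> refl_word ns = v \<circ> g" if "ns \<in> lists N" for ns
    using that
  proof (induction ns)
    case Nil
    show ?case unfolding refl_word_simps by (rule bexI[OF _ W_id]) (simp only: comp_id id_comp)
  next
    case (Cons n ns)
    obtain v where v: "v \<in> W" "g \<circ> refl_word ns = v \<circ> g" using Cons by blast
    obtain m where m: "m \<in> N" "g \<circ> reflection n = reflection m \<circ> g" using refl[OF Cons(1)] by blast
    have "g \<circ> refl_word (n # ns) = (g \<circ> reflection n) \<circ> refl_word ns"
      unfolding refl_word_simps by (simp only: o_assoc)
    also have "\<dots> = reflection m \<circ> (g \<circ> refl_word ns)" unfolding m(2) by (simp only: o_assoc)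
    also have "\<dots> = (reflection m \<circ> v) \<circ> g" unfolding v(2) by (simp only: o_assoc)
    finally show ?case by (intro bexI[OF _ W_reflection_comp[OF m(1) v(1)]])
  qed
  then show ?thesis using w that unfolding W_def by blast
qed

lemma semidirect:
  "internal_semidirect_product IsomH3 (W <#>\<^bsub>IsomH3\<^esub> symmetry_group P) W (symmetry_group P)"
proof -
  interpret I: group IsomH3 by (rule group_IsomH3)
  let ?K = "symmetry_group P" and ?S = "W <#>\<^bsub>IsomH3\<^esub> symmetry_group P"
  have Wsub: "subgroup W IsomH3"
  proof (rule I.subgroupI)
    show "W \<subseteq> carrier IsomH3" using W_isometry by (auto simp: IsomH3_simps)
    show "W \<noteq> {}" using W_id by blast
    show "inv\<^bsub>IsomH3\<^esub> a \<in> W" if "a \<in> W" for a using W_inv_into[OF that] by (simp add: inv_IsomH3 W_isometry that)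
    show "a \<otimes>\<^bsub>IsomH3\<^esub> b \<in> W" if "a \<in> W" "b \<in> W" for a b using W_comp[OF that] by (simp add: IsomH3_simps)
  qed
  have id_K: "id \<in> ?K"
  proof -
    have "id ` P = P" by auto
    then show ?thesis by (simp only: symmetry_group_def mem_Collect_eq IsomH3_simps hyp_isometry_id)
  qed
  have Ksub: "subgroup ?K IsomH3"
  proof (rule I.subgroupI)
    show "?K \<subseteq> carrier IsomH3" by (auto simp: symmetry_group_def)
    show "?K \<noteq> {}" using id_K by blast
    show "inv\<^bsub>IsomH3\<^esub> a \<in> ?K" if "a \<in> ?K" for a
      using symmetry_group_inv[OF that] that by (simp add: inv_IsomH3 symmetry_group_def IsomH3_simps)
    show "a \<otimes>\<^bsub>IsomH3\<^esub> b \<in> ?K" if ab: "a \<in> ?K" "b \<in> ?K" for a b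
    proof -
      have "(a \<circ> b) ` P = P" using ab unfolding image_comp[symmetric] by (simp add: symmetry_group_def)
      then show ?thesis using ab unfolding symmetry_group_def IsomH3_simps by (simp add: hyp_isometry_comp)
    qed
  qed
  have S_eq: "?S = {w \<circ> k | w k. w \<in> W \<and> k \<in> ?K}" by (auto simp: set_mult_def IsomH3_simps)
  have W_S: "w \<in> ?S" if "w \<in> W" for w
    unfolding S_eq using that id_K by (intro CollectI exI[of _ w] exI[of _ id]) simp
  have K_S: "k \<in> ?S" if "k \<in> ?K" for k
    unfolding S_eq using that W_id by (intro CollectI exI[of _ k] exI[of _ id]) simp
  have K_iso: "hyp_isometry k" if "k \<in> ?K" for k using that by (simp add: symmetry_group_def IsomH3_simps)
  have S_mult: "a \<circ> b \<in> ?S" if ab: "a \<in> ?S" "b \<in> ?S" for a b :: "hyp3 \<Rightarrow> hyp3"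
  proof -
    obtain w k v l where *: "a = w \<circ> k" "b = v \<circ> l" "w \<in> W" "k \<in> ?K" "v \<in> W" "l \<in> ?K"
      using ab unfolding S_eq by blast
    obtain u where u: "u \<in> W" "k \<circ> v = u \<circ> k" using symmetry_conj_W[OF *(4,5)] .
    have "a \<circ> b = w \<circ> (k \<circ> v) \<circ> l" unfolding * by (simp only: o_assoc)
    also have "\<dots> = (w \<circ> u) \<circ> (k \<circ> l)" unfolding u(2) by (simp only: o_assoc)
    finally show ?thesis unfolding S_eq
      using W_comp[OF *(3) u(1)] I.subgroup_self subgroup.m_closed[OF Ksub *(4,6)] by (auto simp: IsomH3_simps)
  qed
  have S_inv: "inv\<^bsub>IsomH3\<^esub> a \<in> ?S" if a: "a \<in> ?S" for a :: "hyp3 \<Rightarrow> hyp3"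
  proof -
    obtain w k where *: "a = w \<circ> k" "w \<in> W" "k \<in> ?K" using a unfolding S_eq by blast
    have "inv\<^bsub>IsomH3\<^esub> a = inv\<^bsub>IsomH3\<^esub> k \<circ> inv\<^bsub>IsomH3\<^esub> w"
      using I.inv_mult_group[of w k] * subgroup.subset[OF Wsub] subgroup.subset[OF Ksub]
      by (auto simp: IsomH3_simps subset_iff)
    then show ?thesis using * by (simp add: S_mult W_S K_S subgroup.m_inv_closed[OF Wsub] subgroup.m_inv_closed[OF Ksub])
  qed
  have Ssub: "subgroup ?S IsomH3"
  proof (rule I.subgroupI)
    show "?S \<subseteq> carrier IsomH3" unfolding S_eq using W_isometry K_iso by (auto simp: IsomH3_simps hyp_isometry_comp)
    show "?S \<noteq> {}" using W_S[OF W_id] by blast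
    show "a \<otimes>\<^bsub>IsomH3\<^esub> b \<in> ?S" if "a \<in> ?S" "b \<in> ?S" for a b using S_mult[OF that] by (simp add: IsomH3_simps)
  qed (rule S_inv)
  interpret S: group "IsomH3\<lparr>carrier := ?S\<rparr>" by (rule I.subgroup_imp_group[OF Ssub])
  have inv_S: "inv\<^bsub>IsomH3\<lparr>carrier := ?S\<rparr>\<^esub> a = inv\<^bsub>IsomH3\<^esub> a" if "a \<in> ?S" for a
    using I.m_inv_consistent[OF Ssub that] by simp
  have "W \<lhd> IsomH3\<lparr>carrier := ?S\<rparr>"
  proof (rule S.normal_invI)
    show "subgroup W (IsomH3\<lparr>carrier := ?S\<rparr>)"
      using I.subgroup_incl[OF Wsub Ssub] W_S by blast
    fix a w assume "a \<in> carrier (IsomH3\<lparr>carrier := ?S\<rparr>)" and w: "w \<in> W"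
    then have a: "a \<in> ?S" by simp
    then obtain v k where *: "a = v \<circ> k" "v \<in> W" "k \<in> ?K" unfolding S_eq by blast
    obtain u where u: "u \<in> W" "k \<circ> w = u \<circ> k" using symmetry_conj_W[OF *(3) w] .
    have "v \<circ> u \<circ> inv\<^bsub>IsomH3\<^esub> v \<in> W" using * u by (intro W_comp subgroup.m_inv_closed[OF Wsub])
    moreover have "a \<otimes>\<^bsub>IsomH3\<^esub> w \<otimes>\<^bsub>IsomH3\<^esub> inv\<^bsub>IsomH3\<^esub> a = v \<circ> u \<circ> inv\<^bsub>IsomH3\<^esub> v"
    proof -
      have c: "v \<in> carrier IsomH3" "u \<in> carrier IsomH3" "k \<in> carrier IsomH3" "w \<in> carrier IsomH3"
        using * u w W_isometry K_iso by (auto simp: IsomH3_simps)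
      have a': "a = v \<otimes>\<^bsub>IsomH3\<^esub> k" and u': "k \<otimes>\<^bsub>IsomH3\<^esub> w = u \<otimes>\<^bsub>IsomH3\<^esub> k" by (simp_all only: IsomH3_simps * u)
      have "a \<otimes>\<^bsub>IsomH3\<^esub> w = v \<otimes>\<^bsub>IsomH3\<^esub> u \<otimes>\<^bsub>IsomH3\<^esub> k" unfolding a' using c u' by (simp add: I.m_assoc)
      then have "a \<otimes>\<^bsub>IsomH3\<^esub> w \<otimes>\<^bsub>IsomH3\<^esub> inv\<^bsub>IsomH3\<^esub> a = v \<otimes>\<^bsub>IsomH3\<^esub> u \<otimes>\<^bsub>IsomH3\<^esub> inv\<^bsub>IsomH3\<^esub> v"
        unfolding a' using c by (simp add: I.inv_mult_group I.m_assoc I.inv_solve_left)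
          (simp flip: I.m_assoc)
      then show ?thesis by (simp only: IsomH3_simps)
    qed
    ultimately show "a \<otimes>\<^bsub>IsomH3\<lparr>carrier := ?S\<rparr>\<^esub> w \<otimes>\<^bsub>IsomH3\<lparr>carrier := ?S\<rparr>\<^esub> inv\<^bsub>IsomH3\<lparr>carrier := ?S\<rparr>\<^esub> a \<in> W"
      using inv_S[OF a] by simp
  qed
  moreover have "subgroup ?K (IsomH3\<lparr>carrier := ?S\<rparr>)"
    using I.subgroup_incl[OF Ksub Ssub] K_S by blast
  moreover have "W \<inter> ?K = {\<one>\<^bsub>IsomH3\<^esub>}"
  proof
    show "W \<inter> ?K \<subseteq> {\<one>\<^bsub>IsomH3\<^esub>}" using W_stabilizer unfolding IsomH3_simps symmetry_group_def by blast
    show "{\<one>\<^bsub>IsomH3\<^esub>} \<subseteq> W \<inter> ?K" using W_id id_K unfolding IsomH3_simps by blast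
  qed
  ultimately show ?thesis unfolding internal_semidirect_product_def using Ssub by blast
qed

end

section \<open>The glued space\<close>

locale gluing =
  fixes n :: nat and P :: "nat \<Rightarrow> hyp3 set" and \<phi> :: "hyp3 set \<Rightarrow> hyp3 \<Rightarrow> hyp3"
  assumes disj: "disjoint_ideal_polyhedra n P" and fp: "face_pairing n P \<phi>"
begin

abbreviation R where "R \<equiv> pairing_rel n P \<phi>"
abbreviation glue where "glue \<equiv> glue_rel n P \<phi>"

definition X :: "hyp3 set" where "X = (\<Union>i\<in>{1..n}. P i)"

definition cls :: "hyp3 \<Rightarrow> hyp3 set" where "cls x = glue `` {x}"

definition facet_normals :: "nat \<Rightarrow> (real \<times> (real^3)) set" where
  "facet_normals i = (SOME N. polyhedral_normals (P i) N)"

lemma facet_normals: "i \<in> {1..n} \<Longrightarrow> polyhedral_normals (P i) (facet_normals i)"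
  using disj ideal_polyhedron_normals unfolding facet_normals_def disjoint_ideal_polyhedra_def by (metis someI)

lemma interior_nonempty: "i \<in> {1..n} \<Longrightarrow> interior (P i) \<noteq> {}"
  by (rule polyhedral_normalsD(3)[OF facet_normals])

lemma index_unique: "i \<in> {1..n} \<Longrightarrow> j \<in> {1..n} \<Longrightarrow> x \<in> P i \<Longrightarrow> x \<in> P j \<Longrightarrow> i = j"
  using disj unfolding disjoint_ideal_polyhedra_def disjoint_family_on_def by blast

lemma face_subset: "f \<in> faces Q \<Longrightarrow> f \<subseteq> Q"
  by (auto simp: faces_def outward_normal_def)

lemma pairing:
  assumes "i \<in> {1..n}" "f \<in> faces (P i)"
  obtains j where "j \<in> {1..n}" "\<phi> f ` f \<in> faces (P j)" "\<phi> f ` P i \<inter> P j = \<phi> f ` f"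
    "\<phi> (\<phi> f ` f) = inv_into UNIV (\<phi> f)" "hyp_isometry (\<phi> f)"
  using fp assms that unfolding face_pairing_def by metis

lemma pairing_isometry: "i \<in> {1..n} \<Longrightarrow> f \<in> faces (P i) \<Longrightarrow> hyp_isometry (\<phi> f)"
  using fp unfolding face_pairing_def by blast

lemma pairing_relE:
  assumes "(x, y) \<in> R"
  obtains i f where "i \<in> {1..n}" "f \<in> faces (P i)" "x \<in> f" "y = \<phi> f x"
  using assms unfolding pairing_rel_def by blast

lemma pairing_relI: "i \<in> {1..n} \<Longrightarrow> f \<in> faces (P i) \<Longrightarrow> x \<in> f \<Longrightarrow> (x, \<phi> f x) \<in> R"
  unfolding pairing_rel_def by blast

lemma pairing_rel_sym: "(x, y) \<in> R \<Longrightarrow> (y, x) \<in> R"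
proof (elim pairing_relE)
  fix i f assume f: "i \<in> {1..n}" "f \<in> faces (P i)" "x \<in> f" "y = \<phi> f x"
  obtain j where j: "j \<in> {1..n}" "\<phi> f ` f \<in> faces (P j)" "\<phi> f ` P i \<inter> P j = \<phi> f ` f"
    "\<phi> (\<phi> f ` f) = inv_into UNIV (\<phi> f)" "hyp_isometry (\<phi> f)"
    using pairing[OF f(1,2)] .
  have "\<phi> (\<phi> f ` f) y = x" by (simp add: j(4) f(4) hyp_isometry_inv_apply[OF j(5)])
  then show "(y, x) \<in> R" using pairing_relI[OF j(1,2), of y] f by auto
qed

lemma pairing_rel_X: "(x, y) \<in> R \<Longrightarrow> x \<in> X"
  using face_subset unfolding X_def by (blast elim: pairing_relE)

lemma glue_iff: "(x, y) \<in> glue \<longleftrightarrow> x \<in> X \<and> y \<in> X \<and> (x, y) \<in> R\<^sup>*"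
proof -
  have "R \<union> R\<inverse> = R" using pairing_rel_sym by auto
  then show ?thesis unfolding glue_rel_def X_def by auto
qed

lemma glue_if_pairing: "(x, y) \<in> R \<Longrightarrow> (x, y) \<in> glue"
  using pairing_rel_X pairing_rel_sym unfolding glue_iff by blast

lemma equiv_glue: "equiv X glue"
proof (rule equivI)
  have s: "sym (R\<^sup>*)" by (intro sym_rtrancl symI) (rule pairing_rel_sym)
  show "glue \<subseteq> X \<times> X" by (auto simp: glue_iff)
  show "refl_on X glue" by (auto simp: refl_on_def glue_iff)
  show "sym glue" by (rule symI) (use s in \<open>auto simp: glue_iff dest: symD\<close>)
  show "trans glue" by (rule transI) (auto simp: glue_iff)
qed

lemma cls_eq_iff: "x \<in> X \<Longrightarrow> y \<in> X \<Longrightarrow> cls x = cls y \<longleftrightarrow> (x, y) \<in> glue"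
  unfolding cls_def by (rule eq_equiv_class_iff[OF equiv_glue])

lemma glued_space_eq: "glued_space n P \<phi> = cls ` X"
  unfolding glued_space_def quotient_def cls_def X_def[symmetric] by blast

lemma P_X: "i \<in> {1..n} \<Longrightarrow> x \<in> P i \<Longrightarrow> x \<in> X"
  unfolding X_def by blast

lemma glue_closed:
  assumes "(x, y) \<in> glue" "x \<in> T" "\<And>a b. a \<in> T \<Longrightarrow> (a, b) \<in> R \<Longrightarrow> b \<in> T"
  shows "y \<in> T"
proof -
  have "(x, y) \<in> R\<^sup>*" using assms(1) glue_iff by blast
  then show ?thesis by (induction rule: rtrancl_induct) (use assms in auto)
qed

lemma interior_glue:
  assumes i: "i \<in> {1..n}" and x: "x \<in> interior (P i)" and xy: "(x, y) \<in> glue"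
  shows "y = x"
proof -
  have "y \<in> {x}"
  proof (rule glue_closed[OF xy])
    fix a b assume "a \<in> {x}" "(a, b) \<in> R"
    then have xb: "(x, b) \<in> R" by simp
    obtain k f where f: "k \<in> {1..n}" "f \<in> faces (P k)" "x \<in> f" by (rule pairing_relE[OF xb])
    have xi: "x \<in> P i" using x interior_subset by blast
    have "k = i" using index_unique[OF f(1) i _ xi] f face_subset by blast
    then show "b \<in> {x}" using f interior_iff_no_face[OF facet_normals[OF i] xi] x by blast
  qed simp
  then show ?thesis by simp
qed

lemma face_glue:
  assumes i: "i \<in> {1..n}" and f: "f \<in> faces (P i)" "x \<in> f" "\<forall>g\<in>faces (P i). x \<in> g \<longrightarrow> g = f"
    and j: "j \<in> {1..n}" "\<phi> f ` f \<in> faces (P j)" "\<forall>g\<in>faces (P j). \<phi> f x \<in> g \<longrightarrow> g = \<phi> f ` f"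
    and xy: "(x, y) \<in> glue"
  shows "y = x \<or> y = \<phi> f x"
proof -
  have inverse: "\<phi> (\<phi> f ` f) (\<phi> f x) = x"
    by (rule pairing[OF i f(1)]) (simp add: hyp_isometry_inv_apply(2))
  have "y \<in> {x, \<phi> f x}"
  proof (rule glue_closed[OF xy])
    fix a b assume a: "a \<in> {x, \<phi> f x}" and ab: "(a, b) \<in> R"
    obtain k g where g: "k \<in> {1..n}" "g \<in> faces (P k)" "a \<in> g" "b = \<phi> g a" by (rule pairing_relE[OF ab])
    from a consider "a = x" | "a = \<phi> f x" by blast
    then show "b \<in> {x, \<phi> f x}"
    proof cases
      case 1
      then have "k = i" using index_unique[OF g(1) i, of a] g f face_subset by blast
      then have "g = f" using f(3) g 1 by blast
      then show ?thesis using g 1 by simp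
    next
      case 2
      then have "k = j" using index_unique[OF g(1) j(1), of a] g f(2) j(2) face_subset by blast
      then have "g = \<phi> f ` f" using j(3) g 2 by blast
      then show ?thesis using g 2 inverse by simp
    qed
  qed simp
  then show ?thesis by simp
qed

definition clen :: "(hyp3 \<times> hyp3) list \<Rightarrow> real" where
  "clen c = (\<Sum>(x, y)\<leftarrow>c. dist x y)"

lemma clen_simps: "clen [] = 0" "clen ((x, y) # c) = dist x y + clen c"
  by (simp_all add: clen_def)

lemma clen_nonneg: "clen c \<ge> 0"
  unfolding clen_def by (rule sum_list_nonneg) auto

text \<open>The set \<open>C\<close> of centres with their polyhedra describes the preimages of one point of the quotient: one interior
  point, or two points exchanged by a pairing.  The tracking assumption says that the gluing respects
  distances to the centres within radius \<open>\<rho>\<close>.  A chain shorter than \<open>\<rho>\<close> then never leaves the \<open>\<rho>\<close>-balls around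
  the centres, so it is no shorter than the distance that it covers from a centre.\<close>

lemma chain_tracking:
  assumes C: "\<And>c i. (c, i) \<in> C \<Longrightarrow> i \<in> {1..n}"
    and track: "\<And>c i y y'. (c, i) \<in> C \<Longrightarrow> y \<in> P i \<Longrightarrow> dist c y < \<rho> \<Longrightarrow> (y, y') \<in> glue \<Longrightarrow>
      \<exists>c' i'. (c', i') \<in> C \<and> y' \<in> P i' \<and> dist c' y' = dist c y"
    and "glue_chain n P \<phi> A B ch" "(c, i) \<in> C" "fst (hd ch) \<in> P i" "dist c (fst (hd ch)) + clen ch < \<rho>"
  shows "\<exists>c' i' y. (c', i') \<in> C \<and> y \<in> B \<and> y \<in> P i' \<and> dist c' y \<le> dist c (fst (hd ch)) + clen ch"
  using assms(3-)
proof (induction ch arbitrary: c i A)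
  case Nil
  then show ?case by (simp add: glue_chain_def)
next
  case (Cons xy ch)
  obtain x y where xy: "xy = (x, y)" by (cases xy)
  have x: "x \<in> P i" and less: "dist c x + (dist x y + clen ch) < \<rho>"
    using Cons.prems by (simp_all add: xy clen_simps)
  obtain k where "k \<in> {1..n}" "x \<in> P k" "y \<in> P k" using Cons.prems(1) by (auto simp: glue_chain_def xy)
  then have y: "y \<in> P i" using index_unique[OF _ C[OF Cons.prems(2)] _ x] by blast
  have cy: "dist c y \<le> dist c x + dist x y" by (rule dist_triangle)
  show ?case
  proof (cases ch)
    case Nil
    have "y \<in> B" using Cons.prems(1) by (simp add: glue_chain_def xy Nil)
    then show ?thesis using Cons.prems(2) y cy by (intro exI[of _ c] exI[of _ i] exI[of _ y]) (simp add: xy Nil clen_simps)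
  next
    case (Cons p ch')
    define x' where "x' = fst (hd ch)"
    have nth: "\<forall>k. Suc k < length (xy # ch) \<longrightarrow> (snd ((xy # ch) ! k), fst ((xy # ch) ! Suc k)) \<in> glue"
      using Cons.prems(1) unfolding glue_chain_def by blast
    have "(y, x') \<in> glue" using spec[OF nth, of 0] by (simp add: xy x'_def Cons)
    moreover have "dist c y < \<rho>" using cy less clen_nonneg[of ch] by linarith
    ultimately obtain c' i' where c': "(c', i') \<in> C" "x' \<in> P i'" "dist c' x' = dist c y"
      using track[OF Cons.prems(2) y] by blast
    have "glue_chain n P \<phi> {x'} B ch"
      using Cons.prems(1) nth unfolding glue_chain_def by (auto simp: x'_def Cons)
    from Cons.IH[OF this c'(1)] c'(2,3) less cy
    obtain c'' i'' z where "(c'', i'') \<in> C" "z \<in> B" "z \<in> P i''" "dist c'' z \<le> dist c' x' + clen ch"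
      unfolding x'_def[symmetric] by (metis add_le_cancel_right add.assoc order.strict_trans1)
    then show ?thesis using c'(3) cy
      by (intro exI[of _ c''] exI[of _ i''] exI[of _ z]) (simp add: xy clen_simps)
  qed
qed

lemma chain_from_class_tracking:
  assumes C: "\<And>c i. (c, i) \<in> C \<Longrightarrow> i \<in> {1..n}"
    and track: "\<And>c i y y'. (c, i) \<in> C \<Longrightarrow> y \<in> P i \<Longrightarrow> dist c y < \<rho> \<Longrightarrow> (y, y') \<in> glue \<Longrightarrow>
      \<exists>c' i'. (c', i') \<in> C \<and> y' \<in> P i' \<and> dist c' y' = dist c y"
    and c0: "(c0, i0) \<in> C" "c0 \<in> P i0" and ch: "glue_chain n P \<phi> (cls c0) B ch" "clen ch < \<rho>"
  shows "\<exists>c' i' y. (c', i') \<in> C \<and> y \<in> B \<and> y \<in> P i' \<and> dist c' y \<le> clen ch"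
proof -
  have start: "(c0, fst (hd ch)) \<in> glue" using ch(1) by (simp add: glue_chain_def cls_def)
  have "dist c0 c0 < \<rho>" using ch(2) clen_nonneg[of ch] by simp
  from track[OF c0 this start]
  obtain c1 i1 where c1: "(c1, i1) \<in> C" "fst (hd ch) \<in> P i1" "dist c1 (fst (hd ch)) = 0"
    unfolding dist_self by blast
  from chain_tracking[OF C track ch(1) c1(1,2)] show ?thesis using c1(3) ch(2) by simp
qed

lemma glued_dist_le:
  assumes "i \<in> {1..n}" "x \<in> P i" "y \<in> P i"
  shows "glued_dist n P \<phi> (cls x) (cls y) \<le> ereal (dist x y)"
proof -
  have "x \<in> cls x" "y \<in> cls y" using equiv_class_self[OF equiv_glue] P_X assms unfolding cls_def by blast+
  then have "glue_chain n P \<phi> (cls x) (cls y) [(x, y)]" using assms by (auto simp: glue_chain_def)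
  then show ?thesis unfolding glued_dist_def by (intro INF_lower2[of "[(x, y)]"]) auto
qed

lemma glued_dist_less:
  assumes C: "\<And>c i. (c, i) \<in> C \<Longrightarrow> i \<in> {1..n}"
    and track: "\<And>c i y y'. (c, i) \<in> C \<Longrightarrow> y \<in> P i \<Longrightarrow> dist c y < \<rho> \<Longrightarrow> (y, y') \<in> glue \<Longrightarrow>
      \<exists>c' i'. (c', i') \<in> C \<and> y' \<in> P i' \<and> dist c' y' = dist c y"
    and c0: "(c0, i0) \<in> C" "c0 \<in> P i0" and r: "glued_dist n P \<phi> (cls c0) B < ereal r" "r \<le> \<rho>"
  shows "\<exists>c' i' y. (c', i') \<in> C \<and> y \<in> B \<and> y \<in> P i' \<and> dist c' y < r"
proof -
  obtain ch where ch: "glue_chain n P \<phi> (cls c0) B ch" "clen ch < r"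
    using r(1) unfolding glued_dist_def INF_less_iff clen_def by auto
  have "\<exists>c' i' y. (c', i') \<in> C \<and> y \<in> B \<and> y \<in> P i' \<and> dist c' y \<le> clen ch"
  proof (rule chain_from_class_tracking)
    show "glue_chain n P \<phi> (cls c0) B ch" by (rule ch(1))
    show "clen ch < \<rho>" using ch(2) r(2) by simp
  qed (fact C track c0)+
  then show ?thesis using ch(2) by (meson le_less_trans)
qed

text \<open>Away from the faces the quotient metric is locally the hyperbolic metric: a chain that
  leaves the ball is too long, and one that stays inside runs within a single polyhedron.\<close>

lemma glued_dist_interior:
  assumes i: "i \<in> {1..n}" and ball: "ball x \<rho> \<subseteq> interior (P i)" and y: "dist x y < \<rho>"
  shows "glued_dist n P \<phi> (cls x) (cls y) = ereal (dist x y)"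
proof (rule antisym)
  have "\<rho> > 0" using y zero_le_dist[of x y] by linarith
  then have x_int: "x \<in> interior (P i)" and y_int: "y \<in> interior (P i)" using ball y by auto
  have xP: "x \<in> P i" "y \<in> P i" using x_int y_int interior_subset by blast+
  then show "glued_dist n P \<phi> (cls x) (cls y) \<le> ereal (dist x y)" by (rule glued_dist_le[OF i])
  show "ereal (dist x y) \<le> glued_dist n P \<phi> (cls x) (cls y)"
    unfolding glued_dist_def
  proof (rule INF_greatest, clarify)
    fix ch assume ch: "glue_chain n P \<phi> (cls x) (cls y) ch"
    show "ereal (dist x y) \<le> ereal (\<Sum>(x, y)\<leftarrow>ch. dist x y)"
    proof (cases "clen ch < \<rho>")
      case True
      have "\<exists>c' i' z. (c', i') \<in> {(x, i)} \<and> z \<in> cls y \<and> z \<in> P i' \<and> dist c' z \<le> clen ch"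
      proof (rule chain_from_class_tracking[OF _ _ _ xP(1) ch True])
        fix c k z z' assume *: "(c, k) \<in> {(x, i)}" "z \<in> P k" "dist c z < \<rho>" "(z, z') \<in> glue"
        then have "z \<in> interior (P i)" using ball by auto
        then have "z' = z" using interior_glue[OF i] * by blast
        then show "\<exists>c' i'. (c', i') \<in> {(x, i)} \<and> z' \<in> P i' \<and> dist c' z' = dist c z" using * by blast
      qed (use i in auto)
      then obtain z where z: "z \<in> cls y" "dist x z \<le> clen ch" by auto
      then have "z = y" using interior_glue[OF i y_int] by (simp add: cls_def)
      then show ?thesis using z by (simp add: clen_def)
    next
      case False
      then show ?thesis using y by (simp add: clen_def)
    qed
  qed
qed

end

section \<open>Free discrete actions\<close>

lemma open_fun_pointwise:
  fixes T :: "('a \<Rightarrow> 'b::metric_space) set"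
  assumes "open T" "f \<in> T"
  obtains F e where "finite F" "e > 0" "\<forall>g. (\<forall>y\<in>F. dist (g y) (f y) < e) \<longrightarrow> g \<in> T"
proof -
  have "openin (product_topology (\<lambda>i. euclidean) UNIV) T" using assms(1) by (simp add: open_fun_def)
  from product_topology_open_contains_basis[OF this assms(2)]
  obtain B where B: "f \<in> (\<Pi>\<^sub>E i\<in>UNIV. B i)" "\<forall>i. open (B i)" "finite {i. B i \<noteq> UNIV}" "(\<Pi>\<^sub>E i\<in>UNIV. B i) \<subseteq> T"
    by auto
  define F where "F = {i. B i \<noteq> UNIV}"
  have "\<exists>e>0. ball (f i) e \<subseteq> B i" for i
    using B(1,2) openE[of "B i" "f i"] by (metis PiE_mem UNIV_I)
  then obtain e where e: "\<forall>i. e i > 0 \<and> ball (f i) (e i) \<subseteq> B i" by metis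
  define d where "d = Min (insert 1 (e ` F))"
  have fin: "finite F" using B(3) by (simp add: F_def)
  have d: "d > 0" "\<forall>i\<in>F. d \<le> e i" using e fin by (auto simp: d_def)
  have "g \<in> T" if g: "\<forall>y\<in>F. dist (g y) (f y) < d" for g
  proof -
    have "g i \<in> B i" for i
    proof (cases "i \<in> F")
      case True
      then have "dist (f i) (g i) < e i" using g d(2) by (metis dist_commute less_le_trans)
      then show ?thesis using e by (auto simp: subset_iff)
    qed (simp add: F_def)
    then show ?thesis using B(4) by (auto simp: PiE_UNIV_domain)
  qed
  then show ?thesis using fin d(1) by (intro that[of F d]) auto
qed

locale free_discrete_action =
  fixes \<Delta> :: "(hyp3 \<Rightarrow> hyp3) set"
  assumes sub: "subgroup \<Delta> IsomH3" and disc: "discrete \<Delta>"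
    and free: "\<And>g x. g \<in> \<Delta> \<Longrightarrow> g \<noteq> id \<Longrightarrow> g x \<noteq> x"
begin

lemma iso: "g \<in> \<Delta> \<Longrightarrow> hyp_isometry g"
  using subgroup.subset[OF sub] by (auto simp: IsomH3_simps)

lemma id_mem: "id \<in> \<Delta>"
  using subgroup.one_closed[OF sub] unfolding IsomH3_simps .

lemma comp_mem: "g \<in> \<Delta> \<Longrightarrow> h \<in> \<Delta> \<Longrightarrow> g \<circ> h \<in> \<Delta>"
  using subgroup.m_closed[OF sub] unfolding IsomH3_simps .

lemma inv_mem: "g \<in> \<Delta> \<Longrightarrow> inv_into UNIV g \<in> \<Delta>"
  using subgroup.m_inv_closed[OF sub, of g] by (simp add: inv_IsomH3 iso)

abbreviation orb where "orb \<equiv> orbit_of \<Delta>"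

lemma orbI: "g \<in> \<Delta> \<Longrightarrow> g x \<in> orb x"
  by (auto simp: orbit_of_def)

lemma orb_apply: "g \<in> \<Delta> \<Longrightarrow> orb (g x) = orb x"
proof
  assume g: "g \<in> \<Delta>"
  show "orb (g x) \<subseteq> orb x"
  proof
    fix y assume "y \<in> orb (g x)"
    then obtain h where "h \<in> \<Delta>" "y = (h \<circ> g) x" by (auto simp: orbit_of_def)
    then show "y \<in> orb x" using orbI[OF comp_mem[OF _ g]] by blast
  qed
  show "orb x \<subseteq> orb (g x)"
  proof
    fix y assume "y \<in> orb x"
    then obtain h where "h \<in> \<Delta>" "y = (h \<circ> inv_into UNIV g) (g x)"
      by (auto simp: orbit_of_def hyp_isometry_inv_apply(2)[OF iso[OF g]])
    then show "y \<in> orb (g x)" using orbI[OF comp_mem[OF _ inv_mem[OF g]]] by blast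
  qed
qed

lemma orb_self: "x \<in> orb x"
  using orbI[OF id_mem, of x] by simp

lemma orb_eqE:
  assumes "orb x = orb y"
  obtains g where "g \<in> \<Delta>" "x = g y"
  using orb_self[of x] assms that unfolding orbit_of_def by auto

text \<open>Discreteness at the identity is witnessed by finitely many points \<open>F\<close> and a tolerance \<open>e\<close>.  Elements that move
  \<open>x\<close> by at most \<open>1\<close> map each point of \<open>F\<close> into a compact ball, which is covered by finitely many balls of radius
  \<open>e / 2\<close>.  Two elements with the same pattern of covering balls differ by an element within the tolerance of the identity,
  so they are equal.\<close>

lemma finite_small_displacement: "finite {g \<in> \<Delta>. dist x (g x) \<le> 1}" (is "finite ?S")
proof -
  have "id isolated_in \<Delta>" using disc id_mem unfolding discrete_def by blast
  then obtain T where T: "open T" "T \<inter> \<Delta> = {id}" unfolding isolated_in_def by blast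
  have "id \<in> T" using T by blast
  obtain F e where F: "finite F" "e > 0" "\<forall>g. (\<forall>y\<in>F. dist (g y) (id y) < e) \<longrightarrow> g \<in> T"
    using open_fun_pointwise[OF T(1) \<open>id \<in> T\<close>] .
  have "\<exists>K. finite K \<and> cball x (dist x y + 1) \<subseteq> (\<Union>c\<in>K. ball c (e / 2))" for y
  proof -
    have "\<forall>e>0. \<exists>K. finite K \<and> cball x (dist x y + 1) \<subseteq> (\<Union>c\<in>K. ball c e)"
      using compact_hyp3_cball[of x "dist x y + 1"] unfolding compact_eq_totally_bounded by blast
    then show ?thesis using F(2) half_gt_zero by blast
  qed
  then obtain K where K: "\<And>y. finite (K y)" "\<And>y. cball x (dist x y + 1) \<subseteq> (\<Union>c\<in>K y. ball c (e / 2))" by metis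
  have ex: "\<exists>c. c \<in> K y \<and> g y \<in> ball c (e / 2)" if g: "g \<in> ?S" for g y
  proof -
    have "dist x (g y) \<le> dist x (g x) + dist (g x) (g y)" by (rule dist_triangle)
    then have "g y \<in> cball x (dist x y + 1)" using g iso[of g] by (simp add: hyp_isometry_dist)
    then show ?thesis using K(2) by blast
  qed
  define c where "c g y = (SOME c. c \<in> K y \<and> g y \<in> ball c (e / 2))" for g :: "hyp3 \<Rightarrow> hyp3" and y
  have c: "c g y \<in> K y \<and> g y \<in> ball (c g y) (e / 2)" if "g \<in> ?S" for g y
    unfolding c_def by (rule someI_ex[OF ex[OF that]])
  define code where "code g = restrict (c g) F" for g
  have inj: "inj_on code ?S"
  proof (rule inj_onI)
    fix g h assume gh: "g \<in> ?S" "h \<in> ?S" "code g = code h"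
    have gi: "hyp_isometry g" "hyp_isometry h" using gh iso by auto
    have "dist (g y) (h y) < e" if y: "y \<in> F" for y
    proof -
      have "c g y = c h y" using gh(3) y unfolding code_def by (metis restrict_apply')
      then show ?thesis using c[OF gh(1), of y] c[OF gh(2), of y]
        by (intro dist_triangle_half_r[of "c g y" "g y" e "h y"]) auto
    qed
    moreover have "dist (inv_into UNIV h (g y)) y = dist (g y) (h y)" for y
      using hyp_isometry_dist[OF gi(2), of "inv_into UNIV h (g y)" y] by (simp add: hyp_isometry_inv_apply[OF gi(2)])
    ultimately have "\<forall>y\<in>F. dist ((inv_into UNIV h \<circ> g) y) (id y) < e" by simp
    then have "inv_into UNIV h \<circ> g \<in> T" using F(3) by blast
    moreover have "inv_into UNIV h \<circ> g \<in> \<Delta>" using gh by (intro comp_mem inv_mem) auto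
    ultimately have "inv_into UNIV h \<circ> g = id" using T(2) by blast
    then have "h (inv_into UNIV h (g y)) = h y" for y by (simp add: fun_eq_iff)
    then show "g = h" by (simp add: hyp_isometry_inv_apply[OF gi(2)] fun_eq_iff)
  qed
  have sub: "code ` ?S \<subseteq> PiE F K"
  proof (rule image_subsetI)
    fix g assume "g \<in> ?S"
    then have "\<forall>y\<in>F. c g y \<in> K y" using c by blast
    then show "code g \<in> PiE F K" unfolding code_def restrict_PiE_iff .
  qed
  have "finite (code ` ?S)" by (rule finite_subset[OF sub finite_PiE[OF F(1) K(1)]])
  then show ?thesis using inj by (rule finite_imageD)
qed

text \<open>Only finitely many elements move \<open>x\<close> by at most \<open>1\<close>, and by freeness each of them except the identity
  moves \<open>x\<close> by a positive amount; two points of one orbit near \<open>x\<close> would give a smaller displacement.\<close>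

lemma orb_injective_near:
  obtains e where "e > 0" "\<forall>a b. orb a = orb b \<longrightarrow> dist x a + dist x b < e \<longrightarrow> a = b"
proof -
  define S where "S = {g \<in> \<Delta>. dist x (g x) \<le> 1} - {id}"
  define e where "e = Min (insert 1 ((\<lambda>g. dist x (g x)) ` S))"
  have fin: "finite S" using finite_small_displacement by (simp add: S_def)
  have pos: "dist x (g x) > 0" if "g \<in> S" for g using free[of g x] that by (auto simp: S_def)
  have "e > 0" using fin pos by (auto simp: e_def)
  moreover have "a = b" if ab: "orb a = orb b" "dist x a + dist x b < e" for a b
  proof -
    obtain g where g: "g \<in> \<Delta>" "a = g b" using orb_eqE[OF ab(1)] .
    have "dist x (g x) \<le> dist x a + dist a (g x)" by (rule dist_triangle)
    also have "dist a (g x) = dist x b" by (simp add: g(2) hyp_isometry_dist[OF iso[OF g(1)]] dist_commute)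
    finally have less: "dist x (g x) < e" using ab(2) by simp
    have e1: "e \<le> 1" "\<And>h. h \<in> S \<Longrightarrow> e \<le> dist x (h x)" using fin by (auto simp: e_def)
    have "g = id"
    proof (rule ccontr)
      assume "g \<noteq> id"
      then have "g \<in> S" using g(1) less e1(1) by (auto simp: S_def)
      then show False using e1(2) less by fastforce
    qed
    then show ?thesis using g by simp
  qed
  ultimately show ?thesis using that by blast
qed

text \<open>Two lifts of the same map that agree at one point agree nearby, by the injectivity of the
  projection on small balls, and hence everywhere.\<close>

lemma isometry_eq_mod_orb:
  assumes g: "hyp_isometry g" "hyp_isometry h" and U: "open U" "p \<in> U"
    and eq: "\<And>y. y \<in> U \<Longrightarrow> orb (g y) = orb (h y)" and p: "g p = h p"
  shows "g = h"
proof -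
  obtain e where e: "e > 0" "\<forall>a b. orb a = orb b \<longrightarrow> dist (g p) a + dist (g p) b < e \<longrightarrow> a = b"
    using orb_injective_near .
  have "g y = h y" if y: "y \<in> U \<inter> ball p (e / 2)" for y
  proof (rule e(2)[rule_format, OF eq])
    show "y \<in> U" using y by blast
    have "dist (g p) (g y) = dist p y" by (rule hyp_isometry_dist[OF g(1)])
    moreover have "dist (g p) (h y) = dist p y" unfolding p by (rule hyp_isometry_dist[OF g(2)])
    ultimately show "dist (g p) (g y) + dist (g p) (h y) < e" using y by simp
  qed
  then show ?thesis using U e(1) by (intro isometry_eq_on_open[OF g, of "U \<inter> ball p (e / 2)" p]) auto
qed

lemma orbit_dist_le: "orbit_dist (orb x) (orb y) \<le> dist x y"
  unfolding orbit_dist_def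
proof (rule cInf_lower)
  show "dist x y \<in> {dist a b |a b. a \<in> orb x \<and> b \<in> orb y}" using orb_self by blast
  show "bdd_below {dist a b |a b. a \<in> orb x \<and> b \<in> orb y}" by (intro bdd_belowI[of _ 0]) auto
qed

lemma orbit_dist_nonneg: "orbit_dist (orb x) (orb y) \<ge> 0"
  unfolding orbit_dist_def
proof (rule cInf_greatest)
  show "{dist a b |a b. a \<in> orb x \<and> b \<in> orb y} \<noteq> {}" using orb_self by blast
qed auto

lemma orbit_dist_less:
  assumes "orbit_dist (orb x) (orb y) < r"
  obtains z where "orb z = orb y" "dist x z < r"
proof -
  let ?A = "{dist a b |a b. a \<in> orb x \<and> b \<in> orb y}"
  have "?A \<noteq> {}" using orb_self by blast
  then have "\<exists>d\<in>?A. d < r" using assms unfolding orbit_dist_def by (rule cInf_lessD)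
  then obtain a b where ab: "a \<in> orb x" "b \<in> orb y" "dist a b < r" by blast
  obtain g where g: "g \<in> \<Delta>" "a = g x" using ab(1) by (auto simp: orbit_of_def)
  obtain h where h: "h \<in> \<Delta>" "b = h y" using ab(2) by (auto simp: orbit_of_def)
  let ?z = "inv_into UNIV g b"
  have "g ?z = b" by (rule hyp_isometry_inv_apply(1)[OF iso[OF g(1)]])
  then have "dist x ?z < r" using ab(3) hyp_isometry_dist[OF iso[OF g(1)], of x ?z] g(2) by simp
  moreover have "orb ?z = orb y" using orb_apply[OF inv_mem[OF g(1)]] orb_apply[OF h(1)] h(2) by simp
  ultimately show ?thesis by (intro that)
qed

end

section \<open>Developments of the polyhedra\<close>

text \<open>\<open>H\<close> identifies the quotient of hyperbolic space by \<open>\<Delta>\<close> isometrically with the glued space.\<close>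

locale developing = gluing n P \<phi> + free_discrete_action \<Delta>
  for n :: nat and P :: "nat \<Rightarrow> hyp3 set" and \<phi> :: "hyp3 set \<Rightarrow> hyp3 \<Rightarrow> hyp3"
    and \<Delta> :: "(hyp3 \<Rightarrow> hyp3) set" +
  fixes H :: "hyp3 set \<Rightarrow> hyp3 set"
  assumes orbit_dist_zero: "\<And>A B. A \<in> range (orbit_of \<Delta>) \<Longrightarrow> B \<in> range (orbit_of \<Delta>) \<Longrightarrow>
      orbit_dist A B = 0 \<Longrightarrow> A = B"
    and orbit_dist_triangle: "\<And>A B C. A \<in> range (orbit_of \<Delta>) \<Longrightarrow> B \<in> range (orbit_of \<Delta>) \<Longrightarrow>
      C \<in> range (orbit_of \<Delta>) \<Longrightarrow> orbit_dist A C \<le> orbit_dist A B + orbit_dist B C"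
    and H_bij: "bij_betw H (range (orbit_of \<Delta>)) (glued_space n P \<phi>)"
    and H_dist: "\<And>A B. A \<in> range (orbit_of \<Delta>) \<Longrightarrow> B \<in> range (orbit_of \<Delta>) \<Longrightarrow>
      glued_dist n P \<phi> (H A) (H B) = ereal (orbit_dist A B)"
begin

text \<open>The inclusion of the polyhedra into the quotient of hyperbolic space.\<close>

definition \<Psi> :: "hyp3 \<Rightarrow> hyp3 set" where
  "\<Psi> x = inv_into (range orb) H (cls x)"

lemma \<Psi>_mem: "x \<in> X \<Longrightarrow> \<Psi> x \<in> range orb" and H_\<Psi>: "x \<in> X \<Longrightarrow> H (\<Psi> x) = cls x"
proof -
  assume "x \<in> X"
  then have "cls x \<in> H ` range orb" using bij_betw_imp_surj_on[OF H_bij] glued_space_eq by simp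
  then show "\<Psi> x \<in> range orb" "H (\<Psi> x) = cls x" unfolding \<Psi>_def by (rule inv_into_into, rule f_inv_into_f)
qed

lemma \<Psi>_rep:
  assumes "x \<in> X"
  obtains a where "\<Psi> x = orb a"
  by (rule rangeE[OF \<Psi>_mem[OF assms]]) (rule that)

lemma \<Psi>_eq_iff:
  assumes "x \<in> X" "y \<in> X"
  shows "\<Psi> x = \<Psi> y \<longleftrightarrow> (x, y) \<in> glue"
proof -
  have "\<Psi> x = \<Psi> y \<longleftrightarrow> cls x = cls y"
  proof
    assume "\<Psi> x = \<Psi> y"
    then have "H (\<Psi> x) = H (\<Psi> y)" by (rule arg_cong)
    then show "cls x = cls y" by (simp only: H_\<Psi> assms)
  next
    assume "cls x = cls y"
    then show "\<Psi> x = \<Psi> y" by (simp only: \<Psi>_def)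
  qed
  then show ?thesis by (simp only: cls_eq_iff[OF assms])
qed

lemma \<Psi>_surj:
  obtains x where "x \<in> X" "orb a = \<Psi> x"
proof -
  have "H (orb a) \<in> cls ` X" using bij_betw_apply[OF H_bij, of "orb a"] glued_space_eq by simp
  then obtain x where x: "x \<in> X" "H (orb a) = cls x" by blast
  have "inj_on H (range orb)" using H_bij by (rule bij_betw_imp_inj_on)
  then have "\<Psi> x = orb a" unfolding \<Psi>_def x(2)[symmetric] by (rule inv_into_f_f) blast
  then show ?thesis using that x by metis
qed

lemma \<Psi>_dist: "x \<in> X \<Longrightarrow> y \<in> X \<Longrightarrow> ereal (orbit_dist (\<Psi> x) (\<Psi> y)) = glued_dist n P \<phi> (cls x) (cls y)"
  using H_dist[OF \<Psi>_mem \<Psi>_mem] by (simp add: H_\<Psi>)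

lemma \<Psi>_dist_le: "i \<in> {1..n} \<Longrightarrow> x \<in> P i \<Longrightarrow> y \<in> P i \<Longrightarrow> orbit_dist (\<Psi> x) (\<Psi> y) \<le> dist x y"
  using \<Psi>_dist[OF P_X P_X] glued_dist_le by (metis ereal_less_eq(3))

definition develops :: "(hyp3 \<Rightarrow> hyp3) \<Rightarrow> nat \<Rightarrow> bool" where
  "develops g i \<longleftrightarrow> hyp_isometry g \<and> (\<forall>x\<in>P i. orb (g x) = \<Psi> x)"

text \<open>Near an interior point the inclusion into the quotient preserves distances, and so does the projection of a
  small ball around \<open>a\<close>.  Hence the inclusion lifts to a distance-preserving map \<open>s\<close> between balls, and \<open>s\<close>
  extends to an isometry.\<close>

lemma lift_near_interior:
  assumes i: "i \<in> {1..n}" and p: "p \<in> interior (P i)" and a: "\<Psi> p = orb a"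
  obtains g r where "hyp_isometry g" "g p = a" "r > 0" "ball p r \<subseteq> interior (P i)"
    "\<forall>x\<in>ball p r. orb (g x) = \<Psi> x"
proof -
  obtain \<rho> where \<rho>: "\<rho> > 0" "ball p \<rho> \<subseteq> interior (P i)" using openE[OF open_interior p] .
  obtain e where e: "e > 0" "\<forall>u v. orb u = orb v \<longrightarrow> dist a u + dist a v < e \<longrightarrow> u = v"
    using orb_injective_near .
  define r where "r = min (\<rho> / 4) (e / 4)"
  have r: "r > 0" "4 * r \<le> \<rho>" "4 * r \<le> e" using \<rho>(1) e(1) by (auto simp: r_def)
  have int: "x \<in> interior (P i)" if "x \<in> ball p r" for x using that \<rho>(2) r by auto
  have inX: "x \<in> X" if "x \<in> ball p r" for x using P_X[OF i] int[OF that] interior_subset by blast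
  have pr: "p \<in> ball p r" using r by simp
  have iso: "orbit_dist (\<Psi> x) (\<Psi> y) = dist x y" if xy: "x \<in> ball p r" "y \<in> ball p r" for x y
  proof -
    have xy2: "dist x y < 2 * r" using xy dist_triangle[of x y p] by (simp add: dist_commute)
    have "ball x (2 * r) \<subseteq> interior (P i)"
    proof
      fix z assume "z \<in> ball x (2 * r)"
      then have "dist p z < \<rho>" using xy(1) r dist_triangle[of p z x] by simp
      then show "z \<in> interior (P i)" using \<rho>(2) by auto
    qed
    from glued_dist_interior[OF i this xy2] show ?thesis using \<Psi>_dist[OF inX[OF xy(1)] inX[OF xy(2)]] by simp
  qed
  have "\<exists>b. orb b = \<Psi> x \<and> dist a b < r" if x: "x \<in> ball p r" for x
  proof -
    obtain b where b: "\<Psi> x = orb b" using \<Psi>_rep[OF inX[OF x]] .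
    have "orbit_dist (orb a) (orb b) < r" using iso[OF pr x] x a b by simp
    then show ?thesis using b by (metis orbit_dist_less)
  qed
  then obtain s where s: "\<And>x. x \<in> ball p r \<Longrightarrow> orb (s x) = \<Psi> x \<and> dist a (s x) < r" by metis
  have sp: "s p = a" using e(2)[rule_format, of "s p" a] s[OF pr] a r by simp
  have s_dist: "dist (s x) (s y) = dist x y" if xy: "x \<in> ball p r" "y \<in> ball p r" for x y
  proof (rule antisym)
    have od: "orbit_dist (orb (s x)) (orb (s y)) = dist x y" using iso[OF xy] s xy by simp
    then show "dist x y \<le> dist (s x) (s y)" using orbit_dist_le[of "s x" "s y"] by simp
    have "dist x y < 2 * r" using xy dist_triangle[of x y p] by (simp add: dist_commute)
    then show "dist (s x) (s y) \<le> dist x y"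
    proof (rule dense_ge_bounded)
      fix c assume c: "dist x y < c" "c < 2 * r"
      obtain z where z: "orb z = orb (s y)" "dist (s x) z < c" using orbit_dist_less[of "s x" "s y" c] od c(1) by auto
      have "dist a z \<le> dist a (s x) + dist (s x) z" by (rule dist_triangle)
      then have "dist a z + dist a (s y) < e" using s[OF xy(1)] s[OF xy(2)] z(2) c(2) r by linarith
      then have "z = s y" by (rule e(2)[rule_format, OF z(1)])
      then show "dist (s x) (s y) \<le> c" using z(2) by simp
    qed
  qed
  obtain g where g: "hyp_isometry g" "\<forall>x\<in>ball p r. g x = s x"
    using partial_isometry_extends[OF span_UNIV_of_open[OF open_ball pr] s_dist] .
  show ?thesis
  proof (rule that[OF g(1) _ r(1)])
    show "g p = a" using g(2) pr sp by simp
    show "ball p r \<subseteq> interior (P i)" using int by blast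
    show "\<forall>x\<in>ball p r. orb (g x) = \<Psi> x" using g(2) s by simp
  qed
qed

text \<open>Analytic continuation: the set \<open>A\<close> where the isometry lifts the inclusion locally is open and relatively closed in
  the connected interior, because near any interior point all local lifts differ by elements of \<open>\<Delta>\<close>.
  Continuity of both sides takes care of the boundary.\<close>

lemma develops_if_near:
  assumes i: "i \<in> {1..n}" and g: "hyp_isometry g" and p: "r > 0" "ball p r \<subseteq> interior (P i)"
    and near: "\<forall>x\<in>ball p r. orb (g x) = \<Psi> x"
  shows "develops g i"
proof -
  define A where "A = {x. \<exists>r>0. ball x r \<subseteq> interior (P i) \<and> (\<forall>y\<in>ball x r. orb (g y) = \<Psi> y)}"
  define A' where "A' = \<Union>{ball x r |x r. r > 0 \<and> x \<in> interior (P i) - A \<and> ball x r \<inter> A = {}}"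
  have openA: "open A"
    unfolding open_contains_ball
  proof
    fix x assume "x \<in> A"
    then obtain r where r: "r > 0" "ball x r \<subseteq> interior (P i)" "\<forall>y\<in>ball x r. orb (g y) = \<Psi> y" by (auto simp: A_def)
    have "ball x r \<subseteq> A"
    proof
      fix y assume "y \<in> ball x r"
      then obtain d where "d > 0" "ball y d \<subseteq> ball x r" using openE[OF open_ball] by blast
      then show "y \<in> A" using r unfolding A_def by blast
    qed
    then show "\<exists>e>0. ball x e \<subseteq> A" using r(1) by blast
  qed
  have closed: "\<exists>r>0. ball x r \<inter> A = {}" if x: "x \<in> interior (P i) - A" for x
  proof -
    have xX: "x \<in> X" using P_X[OF i] x interior_subset by blast
    obtain a where a: "\<Psi> x = orb a" using \<Psi>_rep[OF xX] .
    obtain h r where h: "hyp_isometry h" "h x = a" "r > 0" "ball x r \<subseteq> interior (P i)"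
      "\<forall>y\<in>ball x r. orb (h y) = \<Psi> y"
      using lift_near_interior[OF i _ a] x by blast
    have "ball x r \<inter> A = {}"
    proof (rule ccontr)
      assume "ball x r \<inter> A \<noteq> {}"
      then obtain b where b: "b \<in> ball x r" "b \<in> A" by blast
      then obtain d where d: "d > 0" "\<forall>y\<in>ball b d. orb (g y) = \<Psi> y" by (auto simp: A_def)
      have "orb (g b) = orb (h b)" using d h(5) b by simp
      then obtain \<delta> where \<delta>: "\<delta> \<in> \<Delta>" "g b = \<delta> (h b)" by (rule orb_eqE)
      have "g = \<delta> \<circ> h"
      proof (rule isometry_eq_mod_orb[OF g hyp_isometry_comp[OF iso[OF \<delta>(1)] h(1)]])
        show "open (ball x r \<inter> ball b d)" "b \<in> ball x r \<inter> ball b d" using b d by auto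
        show "orb (g y) = orb ((\<delta> \<circ> h) y)" if "y \<in> ball x r \<inter> ball b d" for y
          using that d(2) h(5) by (simp add: orb_apply[OF \<delta>(1)])
        show "g b = (\<delta> \<circ> h) b" using \<delta>(2) by simp
      qed
      then have "\<forall>y\<in>ball x r. orb (g y) = \<Psi> y" using h(5) by (simp add: orb_apply[OF \<delta>(1)])
      then have "x \<in> A" using h(3,4) unfolding A_def by blast
      then show False using x by blast
    qed
    then show ?thesis using h(3) by blast
  qed
  have openA': "open A'" unfolding A'_def by (rule open_Union) auto
  have disjoint: "A \<inter> A' = {}" unfolding A'_def by blast
  have cover: "interior (P i) \<subseteq> A \<union> A'"
  proof
    fix x assume x: "x \<in> interior (P i)"
    show "x \<in> A \<union> A'"
    proof (cases "x \<in> A")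
      case False
      then obtain r where "r > 0" "ball x r \<inter> A = {}" using closed x by blast
      then have "ball x r \<subseteq> A'" unfolding A'_def using x False by blast
      moreover have "x \<in> ball x r" using \<open>r > 0\<close> by simp
      ultimately show ?thesis by blast
    qed simp
  qed
  have pA: "p \<in> A" using p near unfolding A_def by blast
  have p_int: "p \<in> interior (P i)" using p by auto
  have "A \<inter> A' \<inter> interior (P i) = {}" using disjoint by blast
  from connectedD[OF connected_polyhedral_interior[OF facet_normals[OF i]] openA openA' this cover]
  have "A' \<inter> interior (P i) = {}" using pA p_int by blast
  then have sub: "interior (P i) \<subseteq> A" using cover by blast
  have int: "orb (g x) = \<Psi> x" if x: "x \<in> interior (P i)" for x
  proof -
    obtain r where "r > 0" "\<forall>y\<in>ball x r. orb (g y) = \<Psi> y" using subsetD[OF sub x] unfolding A_def by blast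
    then show ?thesis by simp
  qed
  have "orb (g x) = \<Psi> x" if x: "x \<in> P i" for x
  proof -
    have \<Psi>x: "\<Psi> x \<in> range orb" by (rule \<Psi>_mem[OF P_X[OF i x]])
    have small: "orbit_dist (orb (g x)) (\<Psi> x) \<le> e" if "e > 0" for e
    proof -
      obtain y where y: "y \<in> interior (P i)" "dist y x < e / 2"
        using polyhedron_subset_closure_interior[OF facet_normals[OF i]] x \<open>e > 0\<close>
        unfolding closure_approachable subset_iff by (meson half_gt_zero)
      have yP: "y \<in> P i" using y interior_subset by blast
      have "orbit_dist (orb (g x)) (\<Psi> x) \<le> orbit_dist (orb (g x)) (\<Psi> y) + orbit_dist (\<Psi> y) (\<Psi> x)"
        by (rule orbit_dist_triangle[OF _ \<Psi>_mem[OF P_X[OF i yP]] \<Psi>x]) simp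
      also have "orbit_dist (orb (g x)) (\<Psi> y) \<le> dist x y"
        using orbit_dist_le[of "g x" "g y"] by (simp add: int[OF y(1)] hyp_isometry_dist[OF g])
      also have "orbit_dist (\<Psi> y) (\<Psi> x) \<le> dist y x" by (rule \<Psi>_dist_le[OF i yP x])
      finally show ?thesis using y(2) by (simp add: dist_commute)
    qed
    then have "orbit_dist (orb (g x)) (\<Psi> x) \<le> 0" by (rule field_le_epsilon[of _ 0, simplified])
    moreover have "orbit_dist (orb (g x)) (\<Psi> x) \<ge> 0" using \<Psi>x orbit_dist_nonneg by auto
    ultimately have "orbit_dist (orb (g x)) (\<Psi> x) = 0" by simp
    then show ?thesis by (intro orbit_dist_zero \<Psi>x) simp_all
  qed
  then show ?thesis using g by (simp add: develops_def)
qed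

lemma develops_at:
  assumes i: "i \<in> {1..n}" and p: "p \<in> interior (P i)" and a: "orb a = \<Psi> p"
  obtains g where "develops g i" "g p = a"
proof -
  obtain g r where "hyp_isometry g" "g p = a" "r > 0" "ball p r \<subseteq> interior (P i)"
    "\<forall>x\<in>ball p r. orb (g x) = \<Psi> x"
    using lift_near_interior[OF i p a[symmetric]] .
  then show ?thesis using that develops_if_near[OF i] by blast
qed

lemma develops_unique:
  assumes i: "i \<in> {1..n}" and g: "develops g i" "develops h i" and p: "p \<in> interior (P i)" "g p = h p"
  shows "g = h"
proof (rule isometry_eq_mod_orb[where U = "interior (P i)" and p = p])
  show "hyp_isometry g" "hyp_isometry h" using g by (auto simp: develops_def)
  show "orb (g y) = orb (h y)" if "y \<in> interior (P i)" for y
    using g subsetD[OF interior_subset that] by (simp add: develops_def)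
qed (use p in simp_all)

end

section \<open>Crossing a face\<close>

context developing
begin

text \<open>Choose a relative interior point \<open>z\<close> of \<open>f\<close>.  Near its image in the quotient the only identification is the
  one between \<open>z\<close> and its partner \<open>z'\<close>.  Every point of the quotient comes from some polyhedron; this applies to a
  point \<open>g y1\<close> just beyond the face \<open>g f\<close>.  It cannot come from \<open>P i\<close> near \<open>z\<close>, as \<open>g\<close> already lifts that
  part injectively, so it comes from a point \<open>y\<close> of \<open>P j\<close> near \<open>z'\<close>.  In
  particular a face cannot be folded onto itself with \<open>z' = z\<close>.  The development \<open>G\<close> of \<open>P j\<close> that takes \<open>y\<close> to
  \<open>g y1\<close> agrees with \<open>g \<circ> (\<phi> f)\<^sup>-\<^sup>1\<close> on the paired face near \<open>z'\<close>, so it is that isometry, possibly composed with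
  the reflection in the face; but the reflection would put \<open>g y1\<close> on the same side of \<open>g f\<close> as \<open>g (P i)\<close>.\<close>

lemma develops_step:
  assumes i: "i \<in> {1..n}" and g: "develops g i" and f: "f \<in> faces (P i)"
    and j: "j \<in> {1..n}" "\<phi> f ` f \<in> faces (P j)"
  shows "develops (g \<circ> inv_into UNIV (\<phi> f)) j"
proof -
  define f' where "f' = \<phi> f ` f"
  define m where "m = face_normal (P i) f"
  define m' where "m' = face_normal (P j) f'"
  have f': "f' \<in> faces (P j)" using j(2) by (simp add: f'_def)
  have \<phi>i: "hyp_isometry (\<phi> f)" by (rule pairing_isometry[OF i f])
  have gi: "hyp_isometry g" and g_orb: "\<And>x. x \<in> P i \<Longrightarrow> orb (g x) = \<Psi> x" using g by (auto simp: develops_def)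
  note int = interior_nonempty[OF i] interior_nonempty[OF j(1)]
  have fP: "f \<subseteq> P i" "f' \<subseteq> P j" using f f' face_subset by blast+
  have m: "unit_spacelike m" "P i \<subseteq> halfspace m" "f = P i \<inter> hplane m"
    using face_outward_normal(1)[OF int(1) f] by (auto simp: outward_normal_def m_def)
  have m': "unit_spacelike m'" "P j \<subseteq> halfspace m'" "f' = P j \<inter> hplane m'"
    using face_outward_normal(1)[OF int(2) f'] by (auto simp: outward_normal_def m'_def)
  have glued_faces: "\<phi> f ` P i \<inter> P j = f'"
  proof -
    obtain k where k: "k \<in> {1..n}" "\<phi> f ` f \<in> faces (P k)" "\<phi> f ` P i \<inter> P k = \<phi> f ` f"
      "\<phi> (\<phi> f ` f) = inv_into UNIV (\<phi> f)" "hyp_isometry (\<phi> f)"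
      using pairing[OF i f] .
    obtain z where "z \<in> face_interior (P j) f'" using face_outward_normal(2)[OF int(2) f'] by blast
    then have "z \<in> f'" by (auto simp: face_interior_def)
    then have "z \<in> P k" "z \<in> P j" using k(2) face_subset fP(2) by (auto simp: f'_def)
    then have "k = j" using index_unique[OF k(1) j(1)] by blast
    then show ?thesis using k(3) by (simp add: f'_def)
  qed
  obtain z where z: "z \<in> face_interior (P i) f" using face_outward_normal(2)[OF int(1) f] by blast
  define z' where "z' = \<phi> f z"
  have normals: "m' = lmap (\<phi> f) m \<or> m' = - lmap (\<phi> f) m" and z': "z' \<in> face_interior (P j) f'"
    using isometry_face_to_face[OF \<phi>i int(1) f int(2) j(2) z] by (simp_all add: m_def m'_def f'_def z'_def)
  have zf: "z \<in> f" "z \<in> hplane m" "z' \<in> f'" "z' \<in> hplane m'"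
    using z z' by (auto simp: face_interior_def m_def m'_def)
  obtain \<rho>1 where \<rho>1: "\<rho>1 > 0" "\<forall>y\<in>ball z \<rho>1. lor (vec_of y) m \<le> 0 \<longrightarrow> y \<in> P i"
    "\<forall>y\<in>ball z \<rho>1. \<forall>h\<in>faces (P i). y \<in> h \<longrightarrow> h = f"
    unfolding m_def using face_chart[OF facet_normals[OF i] f z] .
  obtain \<rho>2 where \<rho>2: "\<rho>2 > 0" "\<forall>y\<in>ball z' \<rho>2. lor (vec_of y) m' \<le> 0 \<longrightarrow> y \<in> P j"
    "\<forall>y\<in>ball z' \<rho>2. \<forall>h\<in>faces (P j). y \<in> h \<longrightarrow> h = f'"
    unfolding m'_def using face_chart[OF facet_normals[OF j(1)] f' z'] .
  obtain e where e: "e > 0" "\<forall>a b. orb a = orb b \<longrightarrow> dist (g z) a + dist (g z) b < e \<longrightarrow> a = b"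
    using orb_injective_near .
  define r where "r = min (min \<rho>1 \<rho>2) (e / 4)"
  have r: "r > 0" "r \<le> \<rho>1" "r \<le> \<rho>2" "4 * r \<le> e" using \<rho>1(1) \<rho>2(1) e(1) by (auto simp: r_def)
  have \<phi>z: "dist z' (\<phi> f y) = dist z y" for y unfolding z'_def by (rule hyp_isometry_dist[OF \<phi>i])
  have inv_\<phi>: "\<phi> f (inv_into UNIV (\<phi> f) y) = y" "inv_into UNIV (\<phi> f) (\<phi> f y) = y" for y
    by (rule hyp_isometry_inv_apply[OF \<phi>i])+
  have f'_inv: "inv_into UNIV (\<phi> f) y \<in> f" if "y \<in> f'" for y
    using that by (auto simp: f'_def inv_\<phi>)
  have inX: "x \<in> P i \<Longrightarrow> x \<in> X" "x \<in> P j \<Longrightarrow> x \<in> X" for x using P_X i j by blast+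
  have \<Psi>_f: "\<Psi> (\<phi> f x) = \<Psi> x" if "x \<in> f" for x
  proof -
    have "(x, \<phi> f x) \<in> glue" by (rule glue_if_pairing[OF pairing_relI[OF i f that]])
    moreover have "x \<in> X" "\<phi> f x \<in> X" using that fP inX by (auto simp: f'_def)
    ultimately have "\<Psi> x = \<Psi> (\<phi> f x)" using \<Psi>_eq_iff[of x "\<phi> f x"] by blast
    then show ?thesis by (rule sym)
  qed
  \<comment> \<open>a point just beyond the face \<open>g f\<close>\<close>
  obtain y1 where y1: "y1 \<in> ball z r" "lor (vec_of y1) m > 0"
  proof -
    obtain d where d: "d > 0" "\<And>t. \<bar>t\<bar> < d \<Longrightarrow> vec_of z + t *\<^sub>R m \<in> timelike \<and> hproj (vec_of z + t *\<^sub>R m) \<in> ball z r"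
      using hproj_line_in_open[of "ball z r" "vec_of z" m] r(1) by auto
    define v where "v = vec_of z + (d / 2) *\<^sub>R m"
    have v: "v \<in> timelike" "hproj v \<in> ball z r" using d(2)[of "d / 2"] d(1) by (auto simp: v_def)
    have "lor v m = d / 2" using zf(2) m(1) by (simp add: v_def lor_simps hplane_def unit_spacelike_def)
    then have "\<not> lor (vec_of (hproj v)) m \<le> 0" using d(1) v(1) by (simp add: lor_hproj_nonpos_iff)
    then show ?thesis using that v(2) by simp
  qed
  have y1P: "y1 \<notin> P i" using y1(2) m(2) by (auto simp: halfspace_def)
  \<comment> \<open>near the face, the pairing is the only identification\<close>
  let ?C = "{(z, i), (z', j)}"
  have track: "\<exists>c' i'. (c', i') \<in> ?C \<and> y' \<in> P i' \<and> dist c' y' = dist c y"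
    if ck: "(c, k) \<in> ?C" and y: "y \<in> P k" "dist c y < r" "(y, y') \<in> glue" for c k y y'
  proof -
    have via_f: "\<exists>c' i'. (c', i') \<in> ?C \<and> x' \<in> P i' \<and> dist c' x' = dist z x"
      if x: "x \<in> f" "dist z x < r" "(x, x') \<in> glue" for x x'
    proof -
      have o1: "\<forall>h\<in>faces (P i). x \<in> h \<longrightarrow> h = f" using \<rho>1(3) x(2) r by auto
      have "\<phi> f x \<in> ball z' \<rho>2" using x(2) r \<phi>z[of x] by simp
      then have o2: "\<forall>h\<in>faces (P j). \<phi> f x \<in> h \<longrightarrow> h = \<phi> f ` f" using \<rho>2(3) by (simp add: f'_def)
      from face_glue[OF i f x(1) o1 j o2 x(3)] show ?thesis
      proof
        assume "x' = x"
        then show ?thesis using x(1) fP by blast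
      next
        assume x': "x' = \<phi> f x"
        then have "x' \<in> P j" using x(1) fP(2) by (auto simp: f'_def)
        then show ?thesis using \<phi>z[of x] x' by blast
      qed
    qed
    from ck consider "c = z" "k = i" | "c = z'" "k = j" by blast
    then show ?thesis
    proof cases
      case 1
      show ?thesis
      proof (cases "y \<in> f")
        case True
        then show ?thesis using via_f[of y y'] y 1 by simp
      next
        case False
        have "y \<in> interior (P i)"
          using interior_iff_no_face[OF facet_normals[OF i]] y 1 False \<rho>1(3) r by auto
        then have "y' = y" using interior_glue[OF i] y(3) by blast
        then show ?thesis using ck y by blast
      qed
    next
      case 2
      show ?thesis
      proof (cases "y \<in> f'")
        case True
        define x where "x = inv_into UNIV (\<phi> f) y"
        have x: "x \<in> f" "y = \<phi> f x" using f'_inv[OF True] by (simp_all add: x_def inv_\<phi>)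
        have d: "dist z x = dist z' y" using \<phi>z[of x] x by simp
        have "(x, y) \<in> glue" unfolding x(2) by (rule glue_if_pairing[OF pairing_relI[OF i f x(1)]])
        then have "(x, y') \<in> glue" using y(3) equiv_glue by (meson equivE transD)
        then show ?thesis using via_f[OF x(1), of y'] d y(2) 2 by simp
      next
        case False
        have "y \<in> interior (P j)"
          using interior_iff_no_face[OF facet_normals[OF j(1)]] y 2 False \<rho>2(3) r by auto
        then have "y' = y" using interior_glue[OF j(1)] y(3) by blast
        then show ?thesis using ck y by blast
      qed
    qed
  qed
  \<comment> \<open>it is developed from a point of \<open>P j\<close> near the paired face\<close>
  obtain y0 where y0: "y0 \<in> X" "orb (g y1) = \<Psi> y0" using \<Psi>_surj .
  have not_near_z: "\<not> (dist z y < r)" if y: "y \<in> P i" "\<Psi> y = \<Psi> y0" for y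
  proof
    assume "dist z y < r"
    then have "dist (g z) (g y) + dist (g z) (g y1) < e"
      using y1(1) r by (simp add: hyp_isometry_dist[OF gi])
    moreover have "orb (g y) = orb (g y1)" using g_orb[OF y(1)] y(2) y0(2) by simp
    ultimately have "g y = g y1" using e(2) by blast
    then have "y = y1" by (simp add: hyp_isometry_inj[OF gi])
    then show False using y(1) y1P by simp
  qed
  have zX: "z \<in> X" using zf fP inX by blast
  have "ereal (orbit_dist (orb (g z)) (orb (g y1))) = glued_dist n P \<phi> (cls z) (cls y0)"
    using \<Psi>_dist[OF zX y0(1)] g_orb[of z] zf fP y0(2) by auto
  moreover have "orbit_dist (orb (g z)) (orb (g y1)) < r"
    using orbit_dist_le[of "g z" "g y1"] y1(1) by (simp add: hyp_isometry_dist[OF gi])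
  ultimately have "glued_dist n P \<phi> (cls z) (cls y0) < ereal r" by (metis less_ereal.simps(1))
  have "\<exists>c' i' y. (c', i') \<in> ?C \<and> y \<in> cls y0 \<and> y \<in> P i' \<and> dist c' y < r"
  proof (rule glued_dist_less[where C = ?C and \<rho> = r])
    show "z \<in> P i" using zf fP by blast
    show "glued_dist n P \<phi> (cls z) (cls y0) < ereal r" by fact
    show "k \<in> {1..n}" if "(c, k) \<in> ?C" for c k using that i j by blast
  qed (use track in \<open>blast+\<close>)
  then obtain c k y where cky: "(c, k) \<in> ?C" "y \<in> cls y0" "y \<in> P k" "dist c y < r" by blast
  have "y \<in> X" using cky(1,3) inX by blast
  then have \<Psi>y: "\<Psi> y = \<Psi> y0" using cky(2) y0(1) \<Psi>_eq_iff[of y0 y] by (simp add: cls_def)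
  have y: "y \<in> P j" "dist z' y < r"
    using cky not_near_z[of y] \<Psi>y by auto
  have yf: "y \<notin> f'"
  proof
    assume "y \<in> f'"
    define x where "x = inv_into UNIV (\<phi> f) y"
    have x: "x \<in> f" "y = \<phi> f x" using f'_inv[OF \<open>y \<in> f'\<close>] by (simp_all add: x_def inv_\<phi>)
    have "dist z x < r" using \<phi>z[of x] x y by simp
    moreover have "\<Psi> x = \<Psi> y0" using \<Psi>_f[OF x(1)] x(2) \<Psi>y by simp
    ultimately show False using not_near_z x(1) fP by blast
  qed
  have y_int: "y \<in> interior (P j)"
    using interior_iff_no_face[OF facet_normals[OF j(1)] y(1)] yf \<rho>2(3) y(2) r by auto
  have "orb (g y1) = \<Psi> y" using y0(2) \<Psi>y by simp
  then obtain G where G: "develops G j" "G y = g y1" using develops_at[OF j(1) y_int] by blast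
  have Gi: "hyp_isometry G" and G_orb: "\<And>x. x \<in> P j \<Longrightarrow> orb (G x) = \<Psi> x" using G by (auto simp: develops_def)
  \<comment> \<open>both developments agree on a piece of the face, hence differ at most by its reflection\<close>
  let ?h = "g \<circ> inv_into UNIV (\<phi> f)"
  have hi: "hyp_isometry ?h" by (intro hyp_isometry_comp gi hyp_isometry_inv \<phi>i)
  have agree: "G x' = ?h x'" if x': "x' \<in> ball z' r \<inter> hplane m'" for x'
  proof -
    have "lor (vec_of x') m' \<le> 0" using x' by (simp add: hplane_def)
    then have "x' \<in> P j" using \<rho>2(2) x' r by auto
    then have x'f: "x' \<in> f'" using x' m'(3) by blast
    define x where "x = inv_into UNIV (\<phi> f) x'"
    have x: "x \<in> f" "x' = \<phi> f x" using f'_inv[OF x'f] by (simp_all add: x_def inv_\<phi>)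
    have dx: "dist z x < r" using \<phi>z[of x] x x' by simp
    have "orb (G x') = orb (g x)"
      using G_orb[of x'] g_orb[of x] \<Psi>_f[OF x(1)] x x'f fP by auto
    moreover have "dist (g z) (G x') + dist (g z) (g x) < e"
    proof -
      have "dist (g z) (G x') \<le> dist (g z) (G y) + dist (G y) (G x')" by (rule dist_triangle)
      also have "dist (g z) (G y) < r" using y1(1) by (simp add: G(2) hyp_isometry_dist[OF gi])
      also have "dist (G y) (G x') = dist y x'" by (rule hyp_isometry_dist[OF Gi])
      also have "dist y x' \<le> dist y z' + dist z' x'" by (rule dist_triangle)
      finally have "dist (g z) (G x') < 3 * r" using y(2) x' by (simp add: dist_commute)
      then show ?thesis using dx r by (simp add: hyp_isometry_dist[OF gi])
    qed
    ultimately have "G x' = g x" using e(2) by blast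
    then show ?thesis by (simp add: x_def)
  qed
  have "z' \<in> ball z' r" using r by simp
  from isometry_eq_on_hplane[OF Gi hi m'(1) open_ball this zf(4) agree]
  have "G = ?h \<or> G = ?h \<circ> reflection m'" .
  moreover have "G \<noteq> ?h \<circ> reflection m'"
  proof
    assume "G = ?h \<circ> reflection m'"
    then have "g y1 = g (inv_into UNIV (\<phi> f) (reflection m' y))" using G(2) by simp
    then have y1_eq: "\<phi> f y1 = reflection m' y" by (simp add: hyp_isometry_inj[OF gi] inv_\<phi>)
    \<comment> \<open>\<open>\<phi> f (P i)\<close> and \<open>P j\<close> lie on different sides of their common face\<close>
    have neg: "m' = - lmap (\<phi> f) m"
    proof (rule ccontr)
      assume "m' \<noteq> - lmap (\<phi> f) m"
      then have m'_eq: "m' = lmap (\<phi> f) m" using normals by blast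
      have "inv_into UNIV (\<phi> f) y \<in> ball z \<rho>1" using \<phi>z[of "inv_into UNIV (\<phi> f) y"] y(2) r by (simp add: inv_\<phi>)
      moreover have "lor (vec_of (inv_into UNIV (\<phi> f) y)) m \<le> 0"
        using y(1) m'(2) by (simp add: lor_isometry_inv[OF \<phi>i] m'_eq[symmetric] subset_iff halfspace_def)
      ultimately have "inv_into UNIV (\<phi> f) y \<in> P i" using \<rho>1(2) by blast
      then have "\<phi> f (inv_into UNIV (\<phi> f) y) \<in> \<phi> f ` P i" by (rule imageI)
      then have "y \<in> \<phi> f ` P i" by (simp only: inv_\<phi>)
      then show False using glued_faces y(1) yf by blast
    qed
    have "lor (vec_of y1) m = lor (vec_of (\<phi> f y1)) (lmap (\<phi> f) m)" by (simp add: lmap_isometry(2)[OF \<phi>i] lor_lmap[OF \<phi>i])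
    also have "\<dots> = - lor (vec_of (reflection m' y)) m'" by (simp add: y1_eq neg)
    also have "\<dots> = lor (vec_of y) m'" using m'(1) by (simp add: lor_reflection unit_spacelike_def)
    also have "\<dots> \<le> 0" using y(1) m'(2) by (auto simp: halfspace_def)
    finally show False using y1(2) by simp
  qed
  ultimately show ?thesis using G(1) by blast
qed

text \<open>Induction on words, appending letters on the right: \<open>g0 w s (P b)\<close> is the mirror image of the tile \<open>g0 w (P b)\<close>
  in one of its own faces.  That tile is a developed \<open>g (P i)\<close>, and by the hypothesis on the pairing its mirror image
  is the tile on the other side of the face.\<close>

lemma develops_reflected_tiles:
  assumes refl: "\<forall>i\<in>{1..n}. \<forall>f\<in>faces (P i). \<forall>j\<in>{1..n}.
      \<phi> f ` f \<subseteq> P j \<longrightarrow> (\<phi> f \<circ> face_reflection (P i) f) ` P i = P j"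
    and one: "b \<in> {1..n}" and PN: "polyhedral_normals (P b) N"
    and g0: "develops g0 b" and ns: "ns \<in> lists N"
  shows "\<exists>i g. i \<in> {1..n} \<and> develops g i \<and> g ` P i = (g0 \<circ> refl_word ns) ` P b"
  using ns
proof (induction ns rule: rev_induct)
  case Nil
  have "(g0 \<circ> id) ` P b = g0 ` P b" by auto
  then show ?case using one g0 unfolding refl_word_simps by blast
next
  case (snoc s ns)
  then have s: "s \<in> N" and ns: "ns \<in> lists N" by auto
  obtain i g where i: "i \<in> {1..n}" and g: "develops g i" and tile: "g ` P i = (g0 \<circ> refl_word ns) ` P b"
    using snoc.IH[OF ns] by blast
  have gi: "hyp_isometry g" and g0i: "hyp_isometry g0" using g g0 by (auto simp: develops_def)
  have "\<forall>a\<in>set ns. unit_spacelike a" using ns polyhedral_normalsD(2)[OF PN] by blast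
  then have wi: "hyp_isometry (refl_word ns)" by (rule refl_word_isometry)
  define u where "u = inv_into UNIV g \<circ> (g0 \<circ> refl_word ns)"
  have u: "hyp_isometry u" unfolding u_def by (intro hyp_isometry_comp hyp_isometry_inv gi g0i wi)
  have gu: "g (u x) = g0 (refl_word ns x)" for x by (simp add: u_def hyp_isometry_inv_apply[OF gi])
  have uP: "u ` P b = P i"
  proof -
    have "u ` P b = inv_into UNIV g ` (g0 \<circ> refl_word ns) ` P b" by (auto simp: u_def image_image)
    also have "\<dots> = P i" unfolding tile[symmetric] by (simp add: image_image hyp_isometry_inv_apply(2)[OF gi])
    finally show ?thesis .
  qed
  define F where "F = P b \<inter> hplane s"
  have F: "F \<in> faces (P b)" "face_reflection (P b) F = reflection s"
    using normal_face[OF PN s] by (simp_all add: F_def face_reflection_def)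
  define f where "f = u ` F"
  have f: "f \<in> faces (P i)" "\<And>x. face_reflection (P i) f (u x) = u (reflection s x)"
    using isometry_face_image(1,3)[OF u interior_nonempty[OF one] F(1)] by (simp_all add: uP f_def F(2))
  obtain j where j: "j \<in> {1..n}" "\<phi> f ` f \<in> faces (P j)" "\<phi> f ` P i \<inter> P j = \<phi> f ` f"
    "\<phi> (\<phi> f ` f) = inv_into UNIV (\<phi> f)" "hyp_isometry (\<phi> f)"
    using pairing[OF i f(1)] .
  have "(\<phi> f \<circ> face_reflection (P i) f) ` P i = P j"
    using refl i f(1) j(1,2) face_subset by blast
  then have Pj: "P j = \<phi> f ` u ` reflection s ` P b"
  proof -
    have "P j = (\<phi> f \<circ> face_reflection (P i) f) ` u ` P b" unfolding uP by (rule sym) fact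
    then show ?thesis by (simp add: image_image f(2))
  qed
  have "develops (g \<circ> inv_into UNIV (\<phi> f)) j" by (rule develops_step[OF i g f(1) j(1,2)])
  moreover have "(g \<circ> inv_into UNIV (\<phi> f)) ` P j = (g0 \<circ> refl_word (ns @ [s])) ` P b"
    unfolding Pj by (simp add: image_image hyp_isometry_inv_apply(2)[OF j(5)] gu refl_word_append)
  ultimately show ?case using j(1) by blast
qed

end

section \<open>Conjugation of the covering group\<close>

lemma isometric_trans:
  assumes "isometric A dA B dB" "isometric B dB C dC"
  shows "isometric A dA C dC"
proof -
  obtain h where h: "bij_betw h A B" "\<forall>x\<in>A. \<forall>y\<in>A. dB (h x) (h y) = dA x y" using assms(1) unfolding isometric_def by blast
  obtain k where k: "bij_betw k B C" "\<forall>x\<in>B. \<forall>y\<in>B. dC (k x) (k y) = dB x y" using assms(2) unfolding isometric_def by blast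
  have "bij_betw (k \<circ> h) A C" using h(1) k(1) by (rule bij_betw_trans)
  moreover have "h x \<in> B" if "x \<in> A" for x using h(1) that by (rule bij_betw_apply)
  ultimately show ?thesis unfolding isometric_def using h(2) k(2) by (intro exI[of _ "k \<circ> h"]) simp
qed

lemma conjugate_eq:
  assumes "hyp_isometry u"
  shows "conjugate u \<Delta> = (\<lambda>h. u \<circ> h \<circ> inv_into UNIV u) ` \<Delta>"
  unfolding conjugate_def inv_IsomH3[OF assms] IsomH3_simps ..

text \<open>Conjugation by \<open>u\<close> is a homeomorphism for pointwise convergence, and \<open>u\<close> maps orbits to orbits
  preserving their distances.\<close>

lemma holonomy_group_conjugate:
  assumes hol: "holonomy_group \<Delta> M d" and u: "hyp_isometry u"
  shows "holonomy_group (conjugate u \<Delta>) M d"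
proof -
  interpret I: group IsomH3 by (rule group_IsomH3)
  let ?v = "inv_into UNIV u"
  let ?c = "\<lambda>h. u \<circ> h \<circ> ?v"
  let ?D = "conjugate u \<Delta>"
  have sub: "subgroup \<Delta> IsomH3" and disc: "discrete \<Delta>" and free: "\<And>g x. g \<in> \<Delta> \<Longrightarrow> g \<noteq> id \<Longrightarrow> g x \<noteq> x"
    and iso: "isometric (range (orbit_of \<Delta>)) orbit_dist M d"
    using hol unfolding holonomy_group_def by blast+
  have D: "?D = ?c ` \<Delta>" by (rule conjugate_eq[OF u])
  have uv: "u (?v x) = x" "?v (u x) = x" for x by (rule hyp_isometry_inv_apply[OF u])+
  have \<Delta>_iso: "hyp_isometry h" if "h \<in> \<Delta>" for h using subgroup.subset[OF sub] that by (auto simp: IsomH3_simps)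
  have "subgroup ?D IsomH3"
  proof (rule I.subgroupI)
    show "?D \<subseteq> carrier IsomH3"
      unfolding D IsomH3_simps by (intro image_subsetI CollectI hyp_isometry_comp u hyp_isometry_inv \<Delta>_iso)
    show "?D \<noteq> {}" unfolding D using subgroup.one_closed[OF sub] by blast
  next
    fix a assume "a \<in> ?D"
    then obtain h where h: "h \<in> \<Delta>" "a = ?c h" unfolding D by blast
    have ha: "hyp_isometry a" unfolding h(2) by (intro hyp_isometry_comp u hyp_isometry_inv \<Delta>_iso[OF h(1)])
    have hv: "inv_into UNIV h \<in> \<Delta>" using subgroup.m_inv_closed[OF sub h(1)] by (simp add: inv_IsomH3 \<Delta>_iso[OF h(1)])
    have "inv_into UNIV a x = ?c (inv_into UNIV h) x" for x
    proof -
      have "a (?c (inv_into UNIV h) x) = x"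
        by (simp add: h(2) uv hyp_isometry_inv_apply[OF \<Delta>_iso[OF h(1)]])
      then show ?thesis by (metis hyp_isometry_inv_apply(2)[OF ha])
    qed
    then have "inv_into UNIV a = ?c (inv_into UNIV h)" by (rule ext)
    then have "inv_into UNIV a \<in> ?D" unfolding D using hv by blast
    then show "inv\<^bsub>IsomH3\<^esub> a \<in> ?D" by (simp only: inv_IsomH3[OF ha])
  next
    fix a b assume "a \<in> ?D" "b \<in> ?D"
    then obtain h k where hk: "h \<in> \<Delta>" "a = ?c h" "k \<in> \<Delta>" "b = ?c k" unfolding D by blast
    have "a \<circ> b = ?c (h \<circ> k)" by (simp add: hk fun_eq_iff uv)
    moreover have "h \<circ> k \<in> \<Delta>" using subgroup.m_closed[OF sub hk(1,3)] unfolding IsomH3_simps .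
    ultimately show "a \<otimes>\<^bsub>IsomH3\<^esub> b \<in> ?D" unfolding IsomH3_simps D by blast
  qed
  moreover have "discrete ?D"
    unfolding discrete_def
  proof
    fix a assume "a \<in> ?D"
    then obtain h where h: "h \<in> \<Delta>" "a = ?c h" unfolding D by blast
    have "h isolated_in \<Delta>" using disc h(1) unfolding discrete_def by blast
    then obtain T where T: "open T" "T \<inter> \<Delta> = {h}" unfolding isolated_in_def by blast
    have cont: "continuous_on UNIV (\<lambda>f x. ?v (f (u x)))"
    proof (rule continuous_on_coordinatewise_then_product)
      fix x
      show "continuous_on UNIV (\<lambda>f. ?v (f (u x)))"
        by (rule continuous_on_compose2[OF isometry_continuous_on[OF hyp_isometry_inv[OF u], of UNIV]])
          (auto intro: continuous_on_product_coordinates)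
    qed
    define T' where "T' = (\<lambda>f x. ?v (f (u x))) -` T"
    have "open T'" unfolding T'_def by (rule open_vimage[OF T(1) cont])
    moreover have "T' \<inter> ?D = {a}"
    proof
      show "{a} \<subseteq> T' \<inter> ?D" using T(2) h \<open>a \<in> ?D\<close> by (auto simp: T'_def uv)
      show "T' \<inter> ?D \<subseteq> {a}"
      proof
        fix b assume b: "b \<in> T' \<inter> ?D"
        then obtain k where k: "k \<in> \<Delta>" "b = ?c k" unfolding D by blast
        have "(\<lambda>x. ?v (b (u x))) = k" by (simp add: k(2) uv)
        then have "k \<in> T" using b by (simp add: T'_def)
        then have "k = h" using T(2) k(1) by blast
        then show "b \<in> {a}" using k(2) h(2) by simp
      qed
    qed
    ultimately show "a isolated_in ?D" unfolding isolated_in_def using \<open>a \<in> ?D\<close> by blast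
  qed
  moreover have "g x \<noteq> x" if g: "g \<in> ?D" "g \<noteq> id" for g x
  proof
    assume gx: "g x = x"
    obtain h where h: "h \<in> \<Delta>" "g = ?c h" using g(1) unfolding D by blast
    have "h (?v x) = ?v (g x)" by (simp add: h(2) uv)
    then have "h (?v x) = ?v x" using gx by simp
    then have "h = id" using free[OF h(1)] by blast
    then have "g y = y" for y by (simp add: h(2) uv)
    then show False using g(2) by (auto simp: fun_eq_iff)
  qed
  moreover have "isometric (range (orbit_of ?D)) orbit_dist (range (orbit_of \<Delta>)) orbit_dist"
  proof -
    have orb_D: "orbit_of ?D x = u ` orbit_of \<Delta> (?v x)" for x
      unfolding orbit_of_def D by (simp add: image_image)
    have inverse: "?v ` orbit_of ?D x = orbit_of \<Delta> (?v x)" for x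
      by (simp add: orb_D image_image uv)
    have "bij_betw (image ?v) (range (orbit_of ?D)) (range (orbit_of \<Delta>))"
    proof (rule bij_betw_byWitness[where f' = "image u"])
      show "\<forall>A\<in>range (orbit_of ?D). u ` ?v ` A = A" by (simp add: image_image uv)
      show "\<forall>A\<in>range (orbit_of \<Delta>). ?v ` u ` A = A" by (simp add: image_image uv)
      show "image ?v ` range (orbit_of ?D) \<subseteq> range (orbit_of \<Delta>)" by (intro image_subsetI) (auto simp: inverse)
      show "image u ` range (orbit_of \<Delta>) \<subseteq> range (orbit_of ?D)"
      proof (clarify)
        fix x
        have "u ` orbit_of \<Delta> x = orbit_of ?D (u x)" by (simp add: orb_D uv)
        then show "u ` orbit_of \<Delta> x \<in> range (orbit_of ?D)" by simp
      qed
    qed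
    moreover have "orbit_dist (?v ` A) (?v ` B) = orbit_dist A B" for A B
    proof -
      have pairs: "{dist a b |a b. a \<in> S \<and> b \<in> T} = (\<lambda>p. dist (fst p) (snd p)) ` (S \<times> T)" for S T :: "hyp3 set"
        by force
      have "?v ` A \<times> ?v ` B = map_prod ?v ?v ` (A \<times> B)" by force
      then have "{dist a b |a b. a \<in> ?v ` A \<and> b \<in> ?v ` B} = {dist a b |a b. a \<in> A \<and> b \<in> B}"
        unfolding pairs by (simp add: image_image hyp_isometry_dist[OF hyp_isometry_inv[OF u]])
      then show ?thesis by (simp add: orbit_dist_def)
    qed
    ultimately show ?thesis unfolding isometric_def by blast
  qed
  ultimately show ?thesis
    unfolding holonomy_group_def using isometric_trans[OF _ iso] by blast
qed

theorem lemma6p1: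
  fixes M :: "'m set" and d :: "'m \<Rightarrow> 'm \<Rightarrow> real"
    and n :: nat and P :: "nat \<Rightarrow> hyp3 set" and \<phi> :: "hyp3 set \<Rightarrow> hyp3 \<Rightarrow> hyp3"
    and \<Delta> :: "(hyp3 \<Rightarrow> hyp3) set"
  assumes "complete_hyperbolic_3_manifold M d"
    and "holonomy_group \<Delta> M d"
    and "n \<ge> 1"
    and "ideal_decomposition n P \<phi> M d"
    and "\<forall>i\<in>{1..n}. right_angled (P i)"
    and "\<forall>i\<in>{1..n}. \<forall>f\<in>faces (P i). \<forall>j\<in>{1..n}.
           \<phi> f ` f \<subseteq> P j \<longrightarrow> (\<phi> f \<circ> face_reflection (P i) f) ` P i = P j"
  shows "\<exists>S. internal_semidirect_product IsomH3 S (reflection_group (P 1)) (symmetry_group (P 1)) \<and>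
             (\<exists>g\<in>carrier IsomH3. holonomy_group (conjugate g \<Delta>) M d \<and> conjugate g \<Delta> \<subseteq> S)"
proof -
  have one: "1 \<in> {1..n}" using assms(3) by simp
  have disj: "disjoint_ideal_polyhedra n P" and fp: "face_pairing n P \<phi>"
    and decomp: "isometric M (\<lambda>x y. ereal (d x y)) (glued_space n P \<phi>) (glued_dist n P \<phi>)"
    using assms(4) unfolding ideal_decomposition_def by blast+
  have sub: "subgroup \<Delta> IsomH3" and disc: "discrete \<Delta>" and free: "\<forall>g\<in>\<Delta>. g \<noteq> id \<longrightarrow> (\<forall>x. g x \<noteq> x)"
    and quot: "isometric (range (orbit_of \<Delta>)) orbit_dist M d"
    using assms(2) unfolding holonomy_group_def by blast+
  interpret M: Metric_space M d using assms(1) unfolding complete_hyperbolic_3_manifold_def by blast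
  obtain h1 where h1: "bij_betw h1 (range (orbit_of \<Delta>)) M"
    "\<forall>A\<in>range (orbit_of \<Delta>). \<forall>B\<in>range (orbit_of \<Delta>). d (h1 A) (h1 B) = orbit_dist A B"
    using quot unfolding isometric_def by blast
  obtain h2 where h2: "bij_betw h2 M (glued_space n P \<phi>)"
    "\<forall>x\<in>M. \<forall>y\<in>M. glued_dist n P \<phi> (h2 x) (h2 y) = ereal (d x y)"
    using decomp unfolding isometric_def by blast
  have h1M: "h1 A \<in> M" if "A \<in> range (orbit_of \<Delta>)" for A using h1(1) that by (rule bij_betw_apply)
  define H where "H = h2 \<circ> h1"
  interpret D: developing n P \<phi> \<Delta> H
  proof (intro developing.intro gluing.intro free_discrete_action.intro developing_axioms.intro)
    show "g x \<noteq> x" if "g \<in> \<Delta>" "g \<noteq> id" for g x using free that by blast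
    show "bij_betw H (range (orbit_of \<Delta>)) (glued_space n P \<phi>)"
      unfolding H_def using h1(1) h2(1) by (rule bij_betw_trans)
    fix A B assume AB: "A \<in> range (orbit_of \<Delta>)" "B \<in> range (orbit_of \<Delta>)"
    show "glued_dist n P \<phi> (H A) (H B) = ereal (orbit_dist A B)"
      using bspec[OF bspec[OF h1(2) AB(1)] AB(2)] h2(2) AB h1M by (simp add: H_def)
    show "A = B" if "orbit_dist A B = 0"
    proof -
      have "h1 A = h1 B" using bspec[OF bspec[OF h1(2) AB(1)] AB(2)] that M.zero[OF h1M[OF AB(1)] h1M[OF AB(2)]] by simp
      then show ?thesis using bij_betw_imp_inj_on[OF h1(1)] AB by (simp add: inj_on_eq_iff)
    qed
    show "orbit_dist A C \<le> orbit_dist A B + orbit_dist B C" if C: "C \<in> range (orbit_of \<Delta>)" for C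
      using M.triangle[OF h1M[OF AB(1)] h1M[OF AB(2)] h1M[OF C]]
        bspec[OF bspec[OF h1(2) AB(1)] AB(2)] bspec[OF bspec[OF h1(2) AB(1)] C] bspec[OF bspec[OF h1(2) AB(2)] C]
      by simp
  qed (fact disj fp sub disc)+
  have "ideal_polyhedron (P 1)" "right_angled (P 1)"
    using disj assms(5) one unfolding disjoint_ideal_polyhedra_def by blast+
  then obtain N where "coxeter_chamber (P 1) N" by (rule right_angled_ideal_chamber)
  then interpret C: coxeter_chamber "P 1" N .
  \<comment> \<open>place \<open>P 1\<close> so that it is a tile of the developed tessellation\<close>
  obtain p where p: "p \<in> interior (P 1)" using D.interior_nonempty[OF one] by blast
  then have pP: "p \<in> P 1" using interior_subset by blast
  have pX: "p \<in> D.X" by (rule D.P_X[OF one pP])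
  obtain a where a: "D.\<Psi> p = orbit_of \<Delta> a" using D.\<Psi>_rep[OF pX] .
  obtain g0 where g0: "D.develops g0 1" "g0 p = a" using D.develops_at[OF one p a[symmetric]] .
  have g0i: "hyp_isometry g0" using g0(1) by (simp add: D.develops_def)
  define u where "u = inv_into UNIV g0"
  have u: "hyp_isometry u" unfolding u_def by (rule hyp_isometry_inv[OF g0i])
  have ug: "u (g0 x) = x" "g0 (u x) = x" for x by (simp_all add: u_def hyp_isometry_inv_apply[OF g0i])
  have inv_u: "inv_into UNIV u = g0"
  proof
    fix x
    show "inv_into UNIV u x = g0 x" using hyp_isometry_inv_apply(2)[OF u, of "g0 x"] by (simp add: ug)
  qed
  let ?S = "C.W <#>\<^bsub>IsomH3\<^esub> symmetry_group (P 1)"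
  have "conjugate u \<Delta> \<subseteq> ?S"
  proof
    fix k assume "k \<in> conjugate u \<Delta>"
    then obtain \<delta> where \<delta>: "\<delta> \<in> \<Delta>" "k = u \<circ> \<delta> \<circ> g0" unfolding conjugate_eq[OF u] inv_u by blast
    have ki: "hyp_isometry k" unfolding \<delta>(2) by (intro hyp_isometry_comp u g0i D.iso[OF \<delta>(1)])
    have g0k: "g0 (k x) = \<delta> (g0 x)" for x by (simp add: \<delta>(2) ug)
    \<comment> \<open>the point \<open>k p\<close> lies in some reflected copy of \<open>P 1\<close>, which is developed from some \<open>P i\<close>\<close>
    obtain w where w: "w \<in> C.W" "k p \<in> w ` P 1" using C.W_covers by blast
    obtain ns where ns: "ns \<in> lists N" "w = refl_word ns" using w(1) unfolding C.W_def by blast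
    obtain i g where i: "i \<in> {1..n}" and g: "D.develops g i" and tile: "g ` P i = (g0 \<circ> w) ` P 1"
      using D.develops_reflected_tiles[OF assms(6) one C.PN g0(1) ns(1)] unfolding ns(2) by blast
    have "g0 (k p) \<in> (g0 \<circ> w) ` P 1" using w(2) by auto
    then obtain y where y: "y \<in> P i" "g y = \<delta> (g0 p)" unfolding tile[symmetric] g0k by auto
    have dev: "D.develops (\<delta> \<circ> g0) 1"
      using g0(1) hyp_isometry_comp[OF D.iso[OF \<delta>(1)] g0i] by (simp add: D.develops_def D.orb_apply[OF \<delta>(1)])
    have "D.\<Psi> y = D.\<Psi> p"
      using g dev y pP unfolding D.develops_def by (metis comp_apply)
    then have "(p, y) \<in> D.glue" using D.\<Psi>_eq_iff[OF pX D.P_X[OF i y(1)]] by simp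
    then have yp: "y = p" by (rule D.interior_glue[OF one p])
    then have i1: "i = 1" using D.index_unique[OF i one] y(1) pP by blast
    have "g = \<delta> \<circ> g0" using D.develops_unique[OF one _ dev p] g y(2) unfolding i1 yp by simp
    then have kP: "\<delta> ` g0 ` P 1 = g0 ` w ` P 1" using tile unfolding i1 by (simp add: image_comp)
    define v where "v = inv_into UNIV w"
    have wi: "hyp_isometry w" by (rule C.W_isometry[OF w(1)])
    have "(v \<circ> k) ` P 1 = v ` u ` \<delta> ` g0 ` P 1" by (simp add: \<delta>(2) image_comp o_assoc)
    also have "\<dots> = v ` u ` g0 ` w ` P 1" unfolding kP ..
    also have "\<dots> = P 1" by (simp add: image_image ug v_def hyp_isometry_inv_apply(2)[OF wi])
    finally have "v \<circ> k \<in> symmetry_group (P 1)"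
      unfolding symmetry_group_def IsomH3_simps v_def
      using hyp_isometry_comp[OF hyp_isometry_inv[OF wi] ki] by blast
    moreover have "k = w \<circ> (v \<circ> k)" by (simp add: fun_eq_iff v_def hyp_isometry_inv_apply(1)[OF wi])
    ultimately show "k \<in> ?S" unfolding set_mult_def IsomH3_simps using w(1) by blast
  qed
  moreover have "holonomy_group (conjugate u \<Delta>) M d" by (rule holonomy_group_conjugate[OF assms(2) u])
  moreover have "u \<in> carrier IsomH3" using u by (simp add: IsomH3_simps)
  moreover have "internal_semidirect_product IsomH3 ?S (reflection_group (P 1)) (symmetry_group (P 1))"
    unfolding C.reflection_group_eq by (rule C.semidirect)
  ultimately show ?thesis by blast
qed

end
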